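(* Let $\Phi$ be a local interaction on $V$ and $\beta>0$, and assume that $\Phi$ has strong local effective Hamiltonians at $\beta$, i.e. for every $L\subset V$ there is a local interaction $\widetilde\Phi^{L,\beta}$ on $V$ such that (i) $\widetilde\Phi^{L,\beta}_X$ is supported in $X\cap L$ for every finite $X$; (ii) for every $L'\subset V$, $\widetilde\Phi^{L,\beta}_X=\widetilde\Phi^{L',\beta}_X$ for all finite $X$ with $X\cap L'=X\cap L$; (iii) for every finite $\Lambda\subset V$, $-\frac1\beta\log\mathbb E_L[e^{-\beta H_\Lambda}]=\sum_{X\subset\Lambda}\widetilde\Phi^{L,\beta}_X$. Assume further that there are $\lambda,\mu,\Delta>0$ such that for every $L\subset V$ $$\sup_{x\in V}\sum_{X\ni x}\|\widetilde\Phi^{L,\beta}_X\|\,e^{\lambda|X|+\mu\operatorname{diam}(X)}\le\Delta .$$ Then, if $\beta<\lambda/(2\Delta)$, for every finite $\Lambda\subset V$ and every pair of disjoint nonempty subsets $A,C\subset\Lambda$, the Gibbs state $\rho=\rho^\Lambda_\beta$ satisfies $$\big\|\rho_{AC}\,\rho_A^{-1}\otimes\rho_C^{-1}-\mathbb 1\big\|\le\exp\Big(\frac{4\Delta\lambda\beta}{\lambda-2\Delta\beta}\sum_{x\in A}e^{-\mu\operatorname{dist}(x,C)}\Big)\,\frac{4\Delta\lambda\beta}{\lambda-2\Delta\beta}\sum_{x\in A}e^{-\mu\operatorname{dist}(x,C)}.$$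
   Context: $V$ is a set with a metric $\operatorname{dist}$; $\operatorname{diam}(X)=\max_{x,y\in X}\operatorname{dist}(x,y)$. Each site carries $\mathbb C^D$; $\mathfrak A_X=\mathcal B(\mathcal H_X)$, $\mathcal H_X=\bigotimes_{v\in X}\mathbb C^D$ for finite $X$, embedded in $\mathfrak A_Y$ ($X\subset Y$) via $Q\mapsto Q\otimes\mathbb 1$. A local interaction is a family $(\Phi_X)$ indexed by finite $X\subset V$ with $\Phi_X=\Phi_X^*\in\mathfrak A_X$; $H_\Lambda=\sum_{X\subset\Lambda}\Phi_X$. For $L\subset V$ and $Q\in\mathfrak A_\Lambda$, $\mathbb E_L[Q]=D^{-|\Lambda\setminus L|}\operatorname{tr}_{\Lambda\setminus L}(Q)\otimes\mathbb 1_{\Lambda\setminus L}$; $\log$ is the self-adjoint logarithm. The Gibbs state is $\rho^\Lambda_\beta=e^{-\beta H_\Lambda}/\operatorname{Tr}[e^{-\beta H_\Lambda}]$ and for $X\subset\Lambda$, $\rho_X=\operatorname{tr}_{\Lambda\setminus X}\rho^\Lambda_\beta$ is its marginal on $\mathcal H_X$; $\rho_{AC}\,\rho_A^{-1}\otimes\rho_C^{-1}$ is the product of operators on $\mathcal H_{A\cup C}$. $\|\cdot\|$ is the operator norm. *)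

theory Defs
  imports "HOL-Analysis.Analysis"
begin

text \<open>Quantum spin system on the sites of a metric space 'v, each site carrying C^D.
  A basis of H_X (X finite) is the set of configurations conf D X: functions
  'v => nat with values < D on X and 0 off X.  An operator on H_X is represented
  by its matrix kernel over conf D X (entries outside are 0).\<close>

type_synonym 'v qop = "('v \<Rightarrow> nat) \<Rightarrow> ('v \<Rightarrow> nat) \<Rightarrow> complex"

definition conf :: "nat \<Rightarrow> 'v set \<Rightarrow> ('v \<Rightarrow> nat) set" where
  "conf D X = {\<sigma>. (\<forall>v\<in>X. \<sigma> v < D) \<and> (\<forall>v. v \<notin> X \<longrightarrow> \<sigma> v = 0)}"

definition restr :: "'v set \<Rightarrow> ('v \<Rightarrow> nat) \<Rightarrow> ('v \<Rightarrow> nat)" where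
  "restr X \<sigma> = (\<lambda>v. if v \<in> X then \<sigma> v else 0)"

definition merge :: "'v set \<Rightarrow> ('v \<Rightarrow> nat) \<Rightarrow> ('v \<Rightarrow> nat) \<Rightarrow> ('v \<Rightarrow> nat)" where
  "merge X \<sigma> \<eta> = (\<lambda>v. if v \<in> X then \<sigma> v else \<eta> v)"

definition is_op :: "nat \<Rightarrow> 'v set \<Rightarrow> 'v qop \<Rightarrow> bool" where
  "is_op D X Q \<longleftrightarrow> (\<forall>\<sigma> \<tau>. \<sigma> \<notin> conf D X \<or> \<tau> \<notin> conf D X \<longrightarrow> Q \<sigma> \<tau> = 0)"

definition selfadj :: "nat \<Rightarrow> 'v set \<Rightarrow> 'v qop \<Rightarrow> bool" where
  "selfadj D X Q \<longleftrightarrow> is_op D X Q \<and> (\<forall>\<sigma> \<tau>. Q \<sigma> \<tau> = cnj (Q \<tau> \<sigma>))"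

definition op_id :: "nat \<Rightarrow> 'v set \<Rightarrow> 'v qop" where
  "op_id D X = (\<lambda>\<sigma> \<tau>. if \<sigma> \<in> conf D X \<and> \<sigma> = \<tau> then 1 else 0)"

definition op_mult :: "nat \<Rightarrow> 'v set \<Rightarrow> 'v qop \<Rightarrow> 'v qop \<Rightarrow> 'v qop" where
  "op_mult D X P Q = (\<lambda>\<sigma> \<tau>. \<Sum>\<rho>\<in>conf D X. P \<sigma> \<rho> * Q \<rho> \<tau>)"

definition op_scale :: "complex \<Rightarrow> 'v qop \<Rightarrow> 'v qop" where
  "op_scale c Q = (\<lambda>\<sigma> \<tau>. c * Q \<sigma> \<tau>)"

definition op_add :: "'v qop \<Rightarrow> 'v qop \<Rightarrow> 'v qop" where
  "op_add P Q = (\<lambda>\<sigma> \<tau>. P \<sigma> \<tau> + Q \<sigma> \<tau>)"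

definition op_diff :: "'v qop \<Rightarrow> 'v qop \<Rightarrow> 'v qop" where
  "op_diff P Q = (\<lambda>\<sigma> \<tau>. P \<sigma> \<tau> - Q \<sigma> \<tau>)"

definition op_sum :: "('a \<Rightarrow> 'v qop) \<Rightarrow> 'a set \<Rightarrow> 'v qop" where
  "op_sum F S = (\<lambda>\<sigma> \<tau>. \<Sum>s\<in>S. F s \<sigma> \<tau>)"

fun op_pow :: "nat \<Rightarrow> 'v set \<Rightarrow> 'v qop \<Rightarrow> nat \<Rightarrow> 'v qop" where
  "op_pow D X Q 0 = op_id D X"
| "op_pow D X Q (Suc n) = op_mult D X Q (op_pow D X Q n)"

definition op_exp :: "nat \<Rightarrow> 'v set \<Rightarrow> 'v qop \<Rightarrow> 'v qop" where
  "op_exp D X Q = (\<lambda>\<sigma> \<tau>. \<Sum>n. op_pow D X Q n \<sigma> \<tau> / of_nat (fact n))"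

definition op_log :: "nat \<Rightarrow> 'v set \<Rightarrow> 'v qop \<Rightarrow> 'v qop" where
  "op_log D X Q = (THE B. selfadj D X B \<and> op_exp D X B = Q)"

definition op_inv :: "nat \<Rightarrow> 'v set \<Rightarrow> 'v qop \<Rightarrow> 'v qop" where
  "op_inv D X Q = (THE B. is_op D X B \<and> op_mult D X Q B = op_id D X \<and> op_mult D X B Q = op_id D X)"

definition op_trace :: "nat \<Rightarrow> 'v set \<Rightarrow> 'v qop \<Rightarrow> complex" where
  "op_trace D X Q = (\<Sum>\<sigma>\<in>conf D X. Q \<sigma> \<sigma>)"

text \<open>Embedding A_X into A_Y (X \<subseteq> Y): Q \<mapsto> Q \<otimes> 1_{Y-X}.\<close>
definition emb :: "nat \<Rightarrow> 'v set \<Rightarrow> 'v set \<Rightarrow> 'v qop \<Rightarrow> 'v qop" where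
  "emb D X Y Q = (\<lambda>\<sigma> \<tau>. if \<sigma> \<in> conf D Y \<and> \<tau> \<in> conf D Y \<and> (\<forall>v\<in>Y - X. \<sigma> v = \<tau> v)
      then Q (restr X \<sigma>) (restr X \<tau>) else 0)"

definition ptr :: "nat \<Rightarrow> 'v set \<Rightarrow> 'v set \<Rightarrow> 'v qop \<Rightarrow> 'v qop" where
  "ptr D Y X Q = (\<lambda>\<sigma> \<tau>. if \<sigma> \<in> conf D X \<and> \<tau> \<in> conf D X
      then (\<Sum>\<eta>\<in>conf D (Y - X). Q (merge X \<sigma> \<eta>) (merge X \<tau> \<eta>)) else 0)"

definition cond_exp :: "nat \<Rightarrow> 'v set \<Rightarrow> 'v set \<Rightarrow> 'v qop \<Rightarrow> 'v qop" where
  "cond_exp D \<Lambda> L Q = op_scale (1 / of_nat (D ^ card (\<Lambda> - L)))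
      (emb D (\<Lambda> \<inter> L) \<Lambda> (ptr D \<Lambda> (\<Lambda> \<inter> L) Q))"

definition vnorm :: "nat \<Rightarrow> 'v set \<Rightarrow> (('v \<Rightarrow> nat) \<Rightarrow> complex) \<Rightarrow> real" where
  "vnorm D X \<psi> = sqrt (\<Sum>\<sigma>\<in>conf D X. (cmod (\<psi> \<sigma>))\<^sup>2)"

definition op_apply :: "nat \<Rightarrow> 'v set \<Rightarrow> 'v qop \<Rightarrow> (('v \<Rightarrow> nat) \<Rightarrow> complex) \<Rightarrow> (('v \<Rightarrow> nat) \<Rightarrow> complex)" where
  "op_apply D X Q \<psi> = (\<lambda>\<sigma>. \<Sum>\<tau>\<in>conf D X. Q \<sigma> \<tau> * \<psi> \<tau>)"

definition op_norm :: "nat \<Rightarrow> 'v set \<Rightarrow> 'v qop \<Rightarrow> real" where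
  "op_norm D X Q = Sup {vnorm D X (op_apply D X Q \<psi>) | \<psi>. vnorm D X \<psi> \<le> 1}"

definition hamiltonian :: "nat \<Rightarrow> ('v set \<Rightarrow> 'v qop) \<Rightarrow> 'v set \<Rightarrow> 'v qop" where
  "hamiltonian D \<Phi> \<Lambda> = op_sum (\<lambda>X. emb D X \<Lambda> (\<Phi> X)) (Pow \<Lambda>)"

definition local_interaction :: "nat \<Rightarrow> ('v set \<Rightarrow> 'v qop) \<Rightarrow> bool" where
  "local_interaction D \<Phi> \<longleftrightarrow> (\<forall>X. finite X \<longrightarrow> selfadj D X (\<Phi> X))"

definition gibbs :: "nat \<Rightarrow> ('v set \<Rightarrow> 'v qop) \<Rightarrow> real \<Rightarrow> 'v set \<Rightarrow> 'v qop" where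
  "gibbs D \<Phi> \<beta> \<Lambda> =
     (let E = op_exp D \<Lambda> (op_scale (- complex_of_real \<beta>) (hamiltonian D \<Phi> \<Lambda>))
      in op_scale (1 / op_trace D \<Lambda> E) E)"

definition strong_local_eff_ham ::
  "nat \<Rightarrow> ('v set \<Rightarrow> 'v qop) \<Rightarrow> real \<Rightarrow> ('v set \<Rightarrow> 'v set \<Rightarrow> 'v qop) \<Rightarrow> bool" where
  "strong_local_eff_ham D \<Phi> \<beta> \<Psi> \<longleftrightarrow>
     (\<forall>L. local_interaction D (\<Psi> L)) \<and>
     (\<forall>L X. finite X \<longrightarrow> (\<exists>Q. is_op D (X \<inter> L) Q \<and> \<Psi> L X = emb D (X \<inter> L) X Q)) \<and>
     (\<forall>L L' X. finite X \<longrightarrow> X \<inter> L' = X \<inter> L \<longrightarrow> \<Psi> L X = \<Psi> L' X) \<and>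
     (\<forall>L \<Lambda>. finite \<Lambda> \<longrightarrow>
        op_scale (- 1 / complex_of_real \<beta>)
          (op_log D \<Lambda> (cond_exp D \<Lambda> L
             (op_exp D \<Lambda> (op_scale (- complex_of_real \<beta>) (hamiltonian D \<Phi> \<Lambda>)))))
        = hamiltonian D (\<Psi> L) \<Lambda>)"

end

theory Submission
  imports Defs
begin

text \<open>
  Write $H^L$ for the effective Hamiltonian $\sum_{X \subseteq \Lambda} \widetilde\Phi^{L,\beta}_X$, so that
  $\mathbb{E}_L[e^{-\beta H_\Lambda}] = e^{-\beta H^L}$. Up to powers of $D$ and the partition function the
  marginal on $L$ is $e^{-\beta H^L}$, and all these scalars combine into $e^{-\beta H^\emptyset}$. As $H^A$, $H^C$
  and $H^\emptyset$ commute, $\rho_{AC}\,\rho_A^{-1} \otimes \rho_C^{-1} = e^{-\beta G} e^{\beta (G - W)}$ with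
  $G = H^{A \cup C}$ and $W = H^{A \cup C} - H^A - H^C + H^\emptyset$. By consistency of the effective interactions
  only sets $X$ meeting both $A$ and $C$ contribute to $W$, which makes $W$ exponentially small in the distance.
  The product $U(t) = e^{-t G} e^{t (G - W)}$ solves $U' = -(e^{-t G} W e^{t G}) U$, and the imaginary time evolution
  of $W$ is controlled by its series in iterated commutators, whose $n$-th term grows at most
  like $n!\,(2 \Delta / \lambda)^n$.
  The logarithm in the hypothesis is defined by description, so one also needs that a conditional expectation of
  $e^{-\beta H_\Lambda}$ has exactly one self-adjoint logarithm.
\<close>

section \<open>Operator norm of kernels\<close>

text \<open>The constant is a product of separate effects. \<open>W\<close> consists of four
  families of effective terms, each of total weight at most \<Delta> times the sum of exp(- \<mu>
  dist(x, C)). The n! in the commutator bound cancels the 1/n! of the conjugation series and leaves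
  a geometric series of ratio at most 2 \<Delta> \<beta> / \<lambda>, hence the restriction on
  \<beta>. A Gronwall argument then gives exp K - 1, which is at most K exp K. The n! reflects the
  growth of supports: each commutator enlarges the set on which the operator lives, so the next term
  has more sites at which to meet it. The weight exp(\<lambda> |X|) pays for this growth. Existence
  and uniqueness of logarithms are obtained without eigenvalues. Positivity is encoded as ||1 - c
  Q|| < 1 for some c > 0, a condition preserved by every linear unital contraction, in particular by
  conditional expectations, and sufficient for a logarithm built from Neumann series. Uniqueness
  follows from uniqueness of positive square roots, applied at all dyadic scales.\<close>

lemma finite_conf [simp]: "finite X \<Longrightarrow> finite (conf D X)"
proof -
  assume "finite X"
  have "conf D X = {f. \<forall>x. (x \<in> X \<longrightarrow> f x \<in> {..<D}) \<and> (x \<notin> X \<longrightarrow> f x = 0)}"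
    by (auto simp: conf_def)
  then show ?thesis using finite_set_of_finite_funs[OF \<open>finite X\<close>, of "{..<D}" 0] by simp
qed

lemma zero_in_conf: "D > 0 \<Longrightarrow> (\<lambda>_. 0) \<in> conf D X"
  by (auto simp: conf_def)

lemma card_conf:
  assumes "finite X"
  shows "card (conf D X) = D ^ card X"
proof -
  have "bij_betw (\<lambda>\<sigma>. restrict \<sigma> X) (conf D X) (X \<rightarrow>\<^sub>E {..<D})"
    by (rule bij_betwI[where g = "restr X"])
       (auto simp: conf_def restr_def restrict_def fun_eq_iff PiE_iff extensional_def)
  then have "card (conf D X) = card (X \<rightarrow>\<^sub>E {..<D})"
    by (rule bij_betw_same_card)
  then show ?thesis using assms by (simp add: card_PiE)
qed

lemma vnorm_eq_L2_set: "vnorm D X \<psi> = L2_set (\<lambda>\<sigma>. cmod (\<psi> \<sigma>)) (conf D X)"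
  by (simp add: vnorm_def L2_set_def)

lemma vnorm_nonneg [simp]: "0 \<le> vnorm D X \<psi>"
  by (simp add: vnorm_eq_L2_set)

lemma vnorm_power2: "(vnorm D X \<psi>)\<^sup>2 = (\<Sum>\<sigma>\<in>conf D X. (cmod (\<psi> \<sigma>))\<^sup>2)"
  by (simp add: vnorm_def sum_nonneg)

lemma vnorm_cong: "(\<And>\<sigma>. \<sigma> \<in> conf D X \<Longrightarrow> \<phi> \<sigma> = \<psi> \<sigma>) \<Longrightarrow> vnorm D X \<phi> = vnorm D X \<psi>"
  by (simp add: vnorm_def)

lemma vnorm_zero [simp]: "vnorm D X (\<lambda>_. 0) = 0"
  by (simp add: vnorm_def)

lemma vnorm_triangle: "vnorm D X (\<lambda>\<sigma>. \<phi> \<sigma> + \<psi> \<sigma>) \<le> vnorm D X \<phi> + vnorm D X \<psi>"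
proof -
  have "L2_set (\<lambda>\<sigma>. cmod (\<phi> \<sigma> + \<psi> \<sigma>)) (conf D X)
      \<le> L2_set (\<lambda>\<sigma>. cmod (\<phi> \<sigma>) + cmod (\<psi> \<sigma>)) (conf D X)"
    by (rule L2_set_mono) (auto simp: norm_triangle_ineq)
  also have "\<dots> \<le> vnorm D X \<phi> + vnorm D X \<psi>"
    unfolding vnorm_eq_L2_set by (rule L2_set_triangle_ineq)
  finally show ?thesis by (simp add: vnorm_eq_L2_set)
qed

lemma vnorm_scale: "vnorm D X (\<lambda>\<sigma>. c * \<psi> \<sigma>) = cmod c * vnorm D X \<psi>"
  by (simp add: vnorm_eq_L2_set norm_mult L2_set_right_distrib)

lemma vnorm_sum: "vnorm D X (\<lambda>\<sigma>. \<Sum>i\<in>I. f i \<sigma>) \<le> (\<Sum>i\<in>I. vnorm D X (f i))"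
proof (induction I rule: infinite_finite_induct)
  case (insert i I)
  then show ?case using vnorm_triangle[of D X "f i" "\<lambda>\<sigma>. \<Sum>i\<in>I. f i \<sigma>"] by simp
qed auto

lemma norm_le_vnorm: "finite X \<Longrightarrow> \<sigma> \<in> conf D X \<Longrightarrow> cmod (\<psi> \<sigma>) \<le> vnorm D X \<psi>"
  unfolding vnorm_eq_L2_set by (rule member_le_L2_set) auto

lemma vnorm_le_sum: "vnorm D X \<psi> \<le> (\<Sum>\<sigma>\<in>conf D X. cmod (\<psi> \<sigma>))"
  unfolding vnorm_eq_L2_set by (rule L2_set_le_sum) auto

lemma vnorm_delta:
  assumes "finite X" "\<tau> \<in> conf D X"
  shows "vnorm D X (\<lambda>\<sigma>. if \<sigma> = \<tau> then 1 else 0) = 1"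
proof -
  have "(\<Sum>\<sigma>\<in>conf D X. (cmod (if \<sigma> = \<tau> then 1 else 0))\<^sup>2) = (\<Sum>\<sigma>\<in>conf D X. if \<sigma> = \<tau> then 1 else 0)"
    by (rule sum.cong) auto
  then show ?thesis using assms by (simp add: vnorm_def)
qed

lemma op_apply_add: "op_apply D X (op_add P Q) \<psi> = (\<lambda>\<sigma>. op_apply D X P \<psi> \<sigma> + op_apply D X Q \<psi> \<sigma>)"
  by (simp add: op_apply_def op_add_def sum.distrib algebra_simps)

lemma op_apply_scale: "op_apply D X (op_scale c Q) \<psi> = (\<lambda>\<sigma>. c * op_apply D X Q \<psi> \<sigma>)"
  by (simp add: op_apply_def op_scale_def sum_distrib_left mult.assoc)

lemma op_apply_scale_vec: "op_apply D X Q (\<lambda>\<sigma>. c * \<psi> \<sigma>) = (\<lambda>\<sigma>. c * op_apply D X Q \<psi> \<sigma>)"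
  by (simp add: op_apply_def sum_distrib_left algebra_simps)

lemma op_apply_mult: "op_apply D X (op_mult D X P Q) \<psi> = op_apply D X P (op_apply D X Q \<psi>)"
proof
  fix \<sigma>
  show "op_apply D X (op_mult D X P Q) \<psi> \<sigma> = op_apply D X P (op_apply D X Q \<psi>) \<sigma>"
    unfolding op_apply_def op_mult_def sum_distrib_left sum_distrib_right mult.assoc by (rule sum.swap)
qed

lemma op_apply_id: "finite X \<Longrightarrow> \<sigma> \<in> conf D X \<Longrightarrow> op_apply D X (op_id D X) \<psi> \<sigma> = \<psi> \<sigma>"
proof -
  assume a: "finite X" "\<sigma> \<in> conf D X"
  have "op_apply D X (op_id D X) \<psi> \<sigma> = (\<Sum>\<tau>\<in>conf D X. if \<sigma> = \<tau> then \<psi> \<tau> else 0)"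
    unfolding op_apply_def by (rule sum.cong) (use a in \<open>auto simp: op_id_def\<close>)
  then show ?thesis using a by simp
qed

lemma op_apply_delta:
  "finite X \<Longrightarrow> \<tau> \<in> conf D X \<Longrightarrow> op_apply D X Q (\<lambda>\<sigma>. if \<sigma> = \<tau> then 1 else 0) \<sigma> = Q \<sigma> \<tau>"
  by (simp add: op_apply_def if_distrib[where f="\<lambda>x. _ * x"] cong: if_cong)

text \<open>This crude bound comes before any use of the supremum in \<open>op_norm\<close>: it
  makes the supremum finite and settles vectors of norm zero, which cannot be normalised.\<close>

lemma vnorm_op_apply_bound:
  assumes "finite X"
  shows "vnorm D X (op_apply D X Q \<psi>) \<le> (\<Sum>\<sigma>\<in>conf D X. \<Sum>\<tau>\<in>conf D X. cmod (Q \<sigma> \<tau>)) * vnorm D X \<psi>"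
proof -
  have "vnorm D X (op_apply D X Q \<psi>) \<le> (\<Sum>\<sigma>\<in>conf D X. cmod (op_apply D X Q \<psi> \<sigma>))"
    by (rule vnorm_le_sum)
  also have "\<dots> \<le> (\<Sum>\<sigma>\<in>conf D X. \<Sum>\<tau>\<in>conf D X. cmod (Q \<sigma> \<tau>) * vnorm D X \<psi>)"
    unfolding op_apply_def
    by (intro sum_mono order_trans[OF norm_sum] )
       (auto simp: norm_mult assms intro!: mult_left_mono norm_le_vnorm)
  finally show ?thesis by (simp add: sum_distrib_right)
qed

lemma op_norm_bdd:
  assumes "finite X"
  shows "bdd_above {vnorm D X (op_apply D X Q \<psi>) | \<psi>. vnorm D X \<psi> \<le> 1}"
proof (rule bdd_aboveI)
  fix r assume "r \<in> {vnorm D X (op_apply D X Q \<psi>) | \<psi>. vnorm D X \<psi> \<le> 1}"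
  then obtain \<psi> where \<psi>: "vnorm D X \<psi> \<le> 1" "r = vnorm D X (op_apply D X Q \<psi>)" by blast
  let ?M = "\<Sum>\<sigma>\<in>conf D X. \<Sum>\<tau>\<in>conf D X. cmod (Q \<sigma> \<tau>)"
  have "r \<le> ?M * vnorm D X \<psi>" using \<psi> vnorm_op_apply_bound[OF assms] by simp
  also have "\<dots> \<le> ?M * 1" using \<psi> by (intro mult_left_mono) (auto intro!: sum_nonneg)
  finally show "r \<le> ?M" by simp
qed

lemma op_norm_nonneg:
  assumes "finite X"
  shows "0 \<le> op_norm D X Q"
proof -
  have "vnorm D X (op_apply D X Q (\<lambda>_. 0)) \<le> op_norm D X Q"
    unfolding op_norm_def by (rule cSup_upper[OF _ op_norm_bdd[OF assms]]) (auto intro!: exI[of _ "\<lambda>_. 0"])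
  then show ?thesis using vnorm_nonneg order_trans by blast
qed

lemma vnorm_op_apply:
  assumes "finite X"
  shows "vnorm D X (op_apply D X Q \<psi>) \<le> op_norm D X Q * vnorm D X \<psi>"
proof (cases "vnorm D X \<psi> = 0")
  case True
  then show ?thesis using vnorm_op_apply_bound[OF assms, of D Q \<psi>] by simp
next
  case False
  define r where "r = vnorm D X \<psi>"
  have r: "r > 0" using False vnorm_nonneg[of D X \<psi>] unfolding r_def by linarith
  define c where "c = complex_of_real (1 / r)"
  have c: "cmod c = 1 / r" using r by (simp add: c_def norm_divide)
  have "vnorm D X (\<lambda>\<sigma>. c * \<psi> \<sigma>) \<le> 1" using r by (simp add: vnorm_scale c r_def[symmetric])
  then have "vnorm D X (op_apply D X Q (\<lambda>\<sigma>. c * \<psi> \<sigma>)) \<le> op_norm D X Q"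
    unfolding op_norm_def by (intro cSup_upper[OF _ op_norm_bdd[OF assms]]) blast
  then have "vnorm D X (op_apply D X Q \<psi>) / r \<le> op_norm D X Q"
    by (simp add: op_apply_scale_vec vnorm_scale c)
  then show ?thesis using r by (simp add: pos_divide_le_eq r_def[symmetric])
qed

lemma op_norm_leI:
  assumes "0 \<le> M" "\<And>\<psi>. vnorm D X (op_apply D X Q \<psi>) \<le> M * vnorm D X \<psi>"
  shows "op_norm D X Q \<le> M"
  unfolding op_norm_def
proof (rule cSup_least)
  show "{vnorm D X (op_apply D X Q \<psi>) | \<psi>. vnorm D X \<psi> \<le> 1} \<noteq> {}"
    by (auto intro!: exI[of _ "\<lambda>_. 0"])
  fix r assume "r \<in> {vnorm D X (op_apply D X Q \<psi>) | \<psi>. vnorm D X \<psi> \<le> 1}"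
  then obtain \<psi> where \<psi>: "vnorm D X \<psi> \<le> 1" "r = vnorm D X (op_apply D X Q \<psi>)" by blast
  have "r \<le> M * vnorm D X \<psi>" using \<psi> assms by simp
  also have "\<dots> \<le> M * 1" using \<psi> assms by (intro mult_left_mono) auto
  finally show "r \<le> M" by simp
qed

lemma op_norm_zero [simp]: "op_norm D X (\<lambda>_ _. 0) = 0"
proof -
  have "vnorm D X (op_apply D X (\<lambda>_ _. 0) \<psi>) = 0" for \<psi> by (simp add: op_apply_def)
  then have "{vnorm D X (op_apply D X (\<lambda>_ _. 0) \<psi>) | \<psi>. vnorm D X \<psi> \<le> 1} = {0}"
    by (auto intro!: exI[of _ "\<lambda>_. 0"])
  then show ?thesis unfolding op_norm_def by simp
qed

text \<open>Entries outside \<open>conf D X\<close> are invisible to \<open>op_norm\<close>;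
  \<open>is_op\<close> makes them vanish. The comparison later turns norm convergence into
  convergence of entries.\<close>

lemma norm_entry_le_op_norm:
  assumes "finite X" "is_op D X Q"
  shows "cmod (Q \<sigma> \<tau>) \<le> op_norm D X Q"
proof (cases "\<sigma> \<in> conf D X \<and> \<tau> \<in> conf D X")
  case True
  let ?\<psi> = "\<lambda>\<sigma>. if \<sigma> = \<tau> then 1 else (0::complex)"
  have "cmod (Q \<sigma> \<tau>) = cmod (op_apply D X Q ?\<psi> \<sigma>)"
    using True assms by (subst op_apply_delta) auto
  also have "\<dots> \<le> vnorm D X (op_apply D X Q ?\<psi>)"
    using True assms by (intro norm_le_vnorm) auto
  also have "\<dots> \<le> op_norm D X Q * vnorm D X ?\<psi>" by (rule vnorm_op_apply[OF assms(1)])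
  finally show ?thesis using True assms by (simp add: vnorm_delta)
next
  case False
  then have "Q \<sigma> \<tau> = 0" using assms by (auto simp: is_op_def)
  then show ?thesis using op_norm_nonneg[OF assms(1)] by simp
qed

lemma op_norm_add:
  assumes "finite X"
  shows "op_norm D X (op_add P Q) \<le> op_norm D X P + op_norm D X Q"
proof (rule op_norm_leI)
  fix \<psi>
  have "vnorm D X (op_apply D X (op_add P Q) \<psi>)
      \<le> vnorm D X (op_apply D X P \<psi>) + vnorm D X (op_apply D X Q \<psi>)"
    unfolding op_apply_add by (rule vnorm_triangle)
  also have "\<dots> \<le> op_norm D X P * vnorm D X \<psi> + op_norm D X Q * vnorm D X \<psi>"
    by (intro add_mono vnorm_op_apply assms)
  finally show "vnorm D X (op_apply D X (op_add P Q) \<psi>) \<le> (op_norm D X P + op_norm D X Q) * vnorm D X \<psi>"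
    by (simp add: algebra_simps)
qed (simp add: op_norm_nonneg assms)

lemma op_norm_scale_le:
  assumes "finite X"
  shows "op_norm D X (op_scale c Q) \<le> cmod c * op_norm D X Q"
proof (rule op_norm_leI)
  fix \<psi>
  show "vnorm D X (op_apply D X (op_scale c Q) \<psi>) \<le> cmod c * op_norm D X Q * vnorm D X \<psi>"
    using mult_left_mono[OF vnorm_op_apply[OF assms, of D Q \<psi>], of "cmod c"]
    by (simp add: op_apply_scale vnorm_scale mult.assoc)
qed (simp add: op_norm_nonneg assms)

lemma op_norm_scale:
  assumes "finite X"
  shows "op_norm D X (op_scale c Q) = cmod c * op_norm D X Q"
proof (cases "c = 0")
  case True
  then show ?thesis by (simp add: op_scale_def)
next
  case False
  have "Q = op_scale (1/c) (op_scale c Q)" using False by (simp add: op_scale_def)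
  then have "op_norm D X Q \<le> cmod (1/c) * op_norm D X (op_scale c Q)"
    using op_norm_scale_le[OF assms, of D "1/c" "op_scale c Q"] by simp
  then have "cmod c * op_norm D X Q \<le> op_norm D X (op_scale c Q)"
    using False by (simp add: norm_divide field_simps)
  then show ?thesis using op_norm_scale_le[OF assms, of D c Q] by simp
qed

lemma op_norm_mult:
  assumes "finite X"
  shows "op_norm D X (op_mult D X P Q) \<le> op_norm D X P * op_norm D X Q"
proof (rule op_norm_leI)
  fix \<psi>
  have "vnorm D X (op_apply D X (op_mult D X P Q) \<psi>) \<le> op_norm D X P * vnorm D X (op_apply D X Q \<psi>)"
    unfolding op_apply_mult by (rule vnorm_op_apply[OF assms])
  also have "\<dots> \<le> op_norm D X P * (op_norm D X Q * vnorm D X \<psi>)"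
    by (intro mult_left_mono vnorm_op_apply assms op_norm_nonneg)
  finally show "vnorm D X (op_apply D X (op_mult D X P Q) \<psi>) \<le> op_norm D X P * op_norm D X Q * vnorm D X \<psi>"
    by (simp add: mult.assoc)
qed (simp add: op_norm_nonneg assms)

lemma op_norm_id:
  assumes "finite X" "D > 0"
  shows "op_norm D X (op_id D X) = 1"
proof (rule antisym)
  show "op_norm D X (op_id D X) \<le> 1"
    by (rule op_norm_leI) (auto simp: op_apply_id[OF assms(1)] intro!: eq_refl vnorm_cong)
  have "is_op D X (op_id D X)" by (auto simp: is_op_def op_id_def)
  from norm_entry_le_op_norm[OF assms(1) this, of "\<lambda>_. 0" "\<lambda>_. 0"]
  show "1 \<le> op_norm D X (op_id D X)" using zero_in_conf[OF assms(2), of X] by (simp add: op_id_def)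
qed

text \<open>Since \<open>conf D X\<close> is finite, entrywise convergence implies convergence of
  every image vector. Completeness of \<open>opfam\<close> uses this twice, to bound the limit and
  to bound the distance to it.\<close>

lemma op_norm_tendsto_le:
  assumes fin: "finite X" and lim: "\<And>\<sigma> \<tau>. (\<lambda>n. Q n \<sigma> \<tau>) \<longlonglongrightarrow> R \<sigma> \<tau>"
    and bnd: "\<forall>\<^sub>F n in sequentially. op_norm D X (Q n) \<le> M"
  shows "op_norm D X R \<le> M"
proof (rule op_norm_leI)
  obtain n where "op_norm D X (Q n) \<le> M" using bnd by (auto simp: eventually_sequentially)
  then show "0 \<le> M" using op_norm_nonneg[OF fin, of D "Q n"] by simp
next
  fix \<psi>
  have "(\<lambda>n. vnorm D X (op_apply D X (Q n) \<psi>)) \<longlonglongrightarrow> vnorm D X (op_apply D X R \<psi>)"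
    unfolding vnorm_def op_apply_def by (intro tendsto_intros lim)
  moreover have "\<forall>\<^sub>F n in sequentially. vnorm D X (op_apply D X (Q n) \<psi>) \<le> M * vnorm D X \<psi>"
    using bnd
  proof eventually_elim
    case (elim n)
    then show ?case using vnorm_op_apply[OF fin, of D "Q n" \<psi>] mult_right_mono[OF elim, of "vnorm D X \<psi>"]
      by simp
  qed
  ultimately show "vnorm D X (op_apply D X R \<psi>) \<le> M * vnorm D X \<psi>"
    by (intro tendsto_upperbound) auto
qed

section \<open>Operators on a fixed set as a unital algebra\<close>

lemma is_op_id [simp]: "is_op D X (op_id D X)"
  by (auto simp: is_op_def op_id_def)

lemma is_op_zero [simp]: "is_op D X (\<lambda>_ _. 0)"
  by (auto simp: is_op_def)

lemma is_op_add [simp]: "is_op D X P \<Longrightarrow> is_op D X Q \<Longrightarrow> is_op D X (op_add P Q)"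
  by (auto simp: is_op_def op_add_def)

lemma is_op_diff [simp]: "is_op D X P \<Longrightarrow> is_op D X Q \<Longrightarrow> is_op D X (op_diff P Q)"
  by (auto simp: is_op_def op_diff_def)

lemma is_op_scale [simp]: "is_op D X Q \<Longrightarrow> is_op D X (op_scale c Q)"
  by (auto simp: is_op_def op_scale_def)

lemma is_op_sum: "(\<And>s. s \<in> S \<Longrightarrow> is_op D X (F s)) \<Longrightarrow> is_op D X (op_sum F S)"
  by (auto simp: is_op_def op_sum_def intro!: sum.neutral)

lemma is_op_mult [simp]: "is_op D X P \<Longrightarrow> is_op D X Q \<Longrightarrow> is_op D X (op_mult D X P Q)"
  by (auto simp: is_op_def op_mult_def)

lemma is_op_emb [simp]: "is_op D Y (emb D X Y Q)"
  by (auto simp: is_op_def emb_def)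

lemma is_op_ptr [simp]: "is_op D X (ptr D Y X Q)"
  by (auto simp: is_op_def ptr_def)

lemma is_op_pow [simp]: "is_op D X Q \<Longrightarrow> is_op D X (op_pow D X Q n)"
  by (induction n) auto

lemma op_mult_assoc: "op_mult D X (op_mult D X P Q) R = op_mult D X P (op_mult D X Q R)"
proof (intro ext)
  fix \<sigma> \<tau>
  show "op_mult D X (op_mult D X P Q) R \<sigma> \<tau> = op_mult D X P (op_mult D X Q R) \<sigma> \<tau>"
    unfolding op_mult_def sum_distrib_left sum_distrib_right mult.assoc by (rule sum.swap)
qed

lemma op_mult_id_left: "finite X \<Longrightarrow> is_op D X Q \<Longrightarrow> op_mult D X (op_id D X) Q = Q"
proof (intro ext)
  fix \<sigma> \<tau> assume a: "finite X" "is_op D X Q"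
  have "op_mult D X (op_id D X) Q \<sigma> \<tau> = (\<Sum>\<rho>\<in>conf D X. if \<rho> = \<sigma> then Q \<sigma> \<tau> else 0)"
    unfolding op_mult_def by (rule sum.cong) (auto simp: op_id_def)
  then show "op_mult D X (op_id D X) Q \<sigma> \<tau> = Q \<sigma> \<tau>" using a by (auto simp: is_op_def)
qed

lemma op_mult_id_right: "finite X \<Longrightarrow> is_op D X Q \<Longrightarrow> op_mult D X Q (op_id D X) = Q"
proof (intro ext)
  fix \<sigma> \<tau> assume a: "finite X" "is_op D X Q"
  have "op_mult D X Q (op_id D X) \<sigma> \<tau> = (\<Sum>\<rho>\<in>conf D X. if \<rho> = \<tau> then Q \<sigma> \<tau> else 0)"
    unfolding op_mult_def by (rule sum.cong) (auto simp: op_id_def)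
  then show "op_mult D X Q (op_id D X) \<sigma> \<tau> = Q \<sigma> \<tau>" using a by (auto simp: is_op_def)
qed

lemma op_inv_eqI:
  assumes "finite X" "is_op D X B" "op_mult D X Q B = op_id D X" "op_mult D X B Q = op_id D X"
  shows "op_inv D X Q = B"
  unfolding op_inv_def
proof (rule the_equality)
  fix B' assume B': "is_op D X B' \<and> op_mult D X Q B' = op_id D X \<and> op_mult D X B' Q = op_id D X"
  have "B' = op_mult D X (op_mult D X B Q) B'" using B' assms(1) by (simp only: assms(4) op_mult_id_left)
  also have "\<dots> = B" using B' assms(1,2) by (simp only: op_mult_assoc op_mult_id_right)
  finally show "B' = B" .
qed (use assms in auto)

section \<open>Tensor products and partial traces\<close>

lemma merge_in_conf: "X \<subseteq> Y \<Longrightarrow> \<alpha> \<in> conf D X \<Longrightarrow> \<eta> \<in> conf D (Y - X) \<Longrightarrow> merge X \<alpha> \<eta> \<in> conf D Y"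
  by (auto simp: conf_def merge_def)

lemma restr_in_conf: "X \<subseteq> Y \<Longrightarrow> \<sigma> \<in> conf D Y \<Longrightarrow> restr X \<sigma> \<in> conf D X"
  by (auto simp: conf_def restr_def)

lemma restr_merge: "\<alpha> \<in> conf D X \<Longrightarrow> restr X (merge X \<alpha> \<eta>) = \<alpha>"
  by (auto simp: conf_def merge_def restr_def)

lemma merge_restr: "\<sigma> \<in> conf D Y \<Longrightarrow> merge X (restr X \<sigma>) (restr (Y - X) \<sigma>) = \<sigma>"
  by (auto simp: conf_def merge_def restr_def)

lemma merge_inject:
  assumes "\<alpha> \<in> conf D X" "\<alpha>' \<in> conf D X" "\<eta> \<in> conf D (Y - X)" "\<eta>' \<in> conf D (Y - X)"
  shows "merge X \<alpha> \<eta> = merge X \<alpha>' \<eta>' \<longleftrightarrow> \<alpha> = \<alpha>' \<and> \<eta> = \<eta>'"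
proof
  assume m: "merge X \<alpha> \<eta> = merge X \<alpha>' \<eta>'"
  have "\<alpha> v = \<alpha>' v \<and> \<eta> v = \<eta>' v" for v
    using fun_cong[OF m, of v] assms by (cases "v \<in> X") (auto simp: merge_def conf_def)
  then show "\<alpha> = \<alpha>' \<and> \<eta> = \<eta>'" by auto
qed simp

lemma conf_mergeE:
  assumes "X \<subseteq> Y" "\<sigma> \<in> conf D Y"
  obtains \<alpha> \<eta> where "\<alpha> \<in> conf D X" "\<eta> \<in> conf D (Y - X)" "\<sigma> = merge X \<alpha> \<eta>"
  using that[of "restr X \<sigma>" "restr (Y - X) \<sigma>"] restr_in_conf[OF assms] restr_in_conf[OF _ assms(2), of "Y - X"]
    merge_restr[OF assms(2)] by simp

text \<open>The basis form of the factorisation of the Hilbert space over \<open>X\<close> and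
  \<open>Y - X\<close>. The computations with tensor products and partial traces reduce to this
  reindexing.\<close>

lemma sum_conf_merge:
  assumes "X \<subseteq> Y"
  shows "(\<Sum>\<sigma>\<in>conf D Y. f \<sigma>) = (\<Sum>\<eta>\<in>conf D (Y - X). \<Sum>\<alpha>\<in>conf D X. f (merge X \<alpha> \<eta>))"
proof -
  have "bij_betw (\<lambda>(\<eta>, \<alpha>). merge X \<alpha> \<eta>) (conf D (Y - X) \<times> conf D X) (conf D Y)"
    by (rule bij_betwI[where g = "\<lambda>\<sigma>. (restr (Y - X) \<sigma>, restr X \<sigma>)"])
       (use assms in \<open>auto simp: merge_in_conf restr_in_conf restr_merge merge_restr\<close>,
        auto simp: conf_def restr_def merge_def)
  from sum.reindex_bij_betw[OF this, of f] show ?thesis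
    by (simp add: sum.cartesian_product case_prod_unfold)
qed

lemma emb_merge:
  assumes "X \<subseteq> Y" "\<alpha> \<in> conf D X" "\<alpha>' \<in> conf D X" "\<eta> \<in> conf D (Y - X)" "\<eta>' \<in> conf D (Y - X)"
  shows "emb D X Y Q (merge X \<alpha> \<eta>) (merge X \<alpha>' \<eta>') = (if \<eta> = \<eta>' then Q \<alpha> \<alpha>' else 0)"
proof -
  have "(\<forall>v\<in>Y - X. merge X \<alpha> \<eta> v = merge X \<alpha>' \<eta>' v) \<longleftrightarrow> \<eta> = \<eta>'"
  proof
    assume e: "\<forall>v\<in>Y - X. merge X \<alpha> \<eta> v = merge X \<alpha>' \<eta>' v"
    have "\<eta> v = \<eta>' v" for v
      using e assms(4,5) by (cases "v \<in> Y - X") (auto simp: merge_def conf_def)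
    then show "\<eta> = \<eta>'" by auto
  qed (simp add: merge_def)
  then show ?thesis using assms by (simp add: emb_def merge_in_conf restr_merge)
qed

lemma qop_eqI:
  assumes "is_op D X P" "is_op D X Q"
    and "\<And>\<sigma> \<tau>. \<sigma> \<in> conf D X \<Longrightarrow> \<tau> \<in> conf D X \<Longrightarrow> P \<sigma> \<tau> = Q \<sigma> \<tau>"
  shows "P = Q"
  using assms unfolding is_op_def fun_eq_iff by metis

lemma qop_merge_eqI:
  assumes "X \<subseteq> Y" "is_op D Y P" "is_op D Y Q"
    and "\<And>\<alpha> \<eta> \<alpha>' \<eta>'. \<alpha> \<in> conf D X \<Longrightarrow> \<eta> \<in> conf D (Y - X) \<Longrightarrow> \<alpha>' \<in> conf D X \<Longrightarrow> \<eta>' \<in> conf D (Y - X) \<Longrightarrow>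
      P (merge X \<alpha> \<eta>) (merge X \<alpha>' \<eta>') = Q (merge X \<alpha> \<eta>) (merge X \<alpha>' \<eta>')"
  shows "P = Q"
  by (rule qop_eqI[OF assms(2,3)]) (metis assms(1,4) conf_mergeE)

lemma emb_mult:
  assumes "X \<subseteq> Y" "finite Y"
  shows "emb D X Y (op_mult D X P Q) = op_mult D Y (emb D X Y P) (emb D X Y Q)"
proof (rule qop_merge_eqI[OF assms(1)])
  fix \<alpha> \<eta> \<alpha>' \<eta>' assume a: "\<alpha> \<in> conf D X" "\<eta> \<in> conf D (Y - X)" "\<alpha>' \<in> conf D X" "\<eta>' \<in> conf D (Y - X)"
  have "op_mult D Y (emb D X Y P) (emb D X Y Q) (merge X \<alpha> \<eta>) (merge X \<alpha>' \<eta>')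
    = (\<Sum>\<zeta>\<in>conf D (Y - X). \<Sum>\<gamma>\<in>conf D X. (if \<eta> = \<zeta> then P \<alpha> \<gamma> else 0) * (if \<zeta> = \<eta>' then Q \<gamma> \<alpha>' else 0))"
    unfolding op_mult_def sum_conf_merge[OF assms(1)]
    by (intro sum.cong refl arg_cong2[of _ _ _ _ "(*)"] emb_merge assms a)
  also have "\<dots> = (\<Sum>\<zeta>\<in>conf D (Y - X). if \<eta> = \<zeta> then (if \<eta> = \<eta>' then \<Sum>\<gamma>\<in>conf D X. P \<alpha> \<gamma> * Q \<gamma> \<alpha>' else 0) else 0)"
    by (intro sum.cong refl) auto
  also have "\<dots> = emb D X Y (op_mult D X P Q) (merge X \<alpha> \<eta>) (merge X \<alpha>' \<eta>')"
    using a assms by (simp add: emb_merge op_mult_def)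
  finally show "emb D X Y (op_mult D X P Q) (merge X \<alpha> \<eta>) (merge X \<alpha>' \<eta>')
    = op_mult D Y (emb D X Y P) (emb D X Y Q) (merge X \<alpha> \<eta>) (merge X \<alpha>' \<eta>')" by (rule sym)
qed auto

lemma emb_id:
  assumes "X \<subseteq> Y"
  shows "emb D X Y (op_id D X) = op_id D Y"
proof (rule qop_merge_eqI[OF assms])
  fix \<alpha> \<eta> \<alpha>' \<eta>' assume a: "\<alpha> \<in> conf D X" "\<eta> \<in> conf D (Y - X)" "\<alpha>' \<in> conf D X" "\<eta>' \<in> conf D (Y - X)"
  show "emb D X Y (op_id D X) (merge X \<alpha> \<eta>) (merge X \<alpha>' \<eta>') = op_id D Y (merge X \<alpha> \<eta>) (merge X \<alpha>' \<eta>')"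
    unfolding emb_merge[OF assms a(1,3,2,4)] op_id_def merge_inject[OF a(1,3,2,4)]
    using a merge_in_conf[OF assms a(1,2)] by auto
qed auto

lemma emb_diff: "emb D X Y (op_diff P Q) = op_diff (emb D X Y P) (emb D X Y Q)"
  by (auto simp: emb_def op_diff_def fun_eq_iff)

lemma emb_scale: "emb D X Y (op_scale c Q) = op_scale c (emb D X Y Q)"
  by (auto simp: emb_def op_scale_def fun_eq_iff)

lemma emb_sum: "emb D X Y (op_sum F S) = op_sum (\<lambda>s. emb D X Y (F s)) S"
proof (intro ext)
  fix \<sigma> \<tau>
  show "emb D X Y (op_sum F S) \<sigma> \<tau> = op_sum (\<lambda>s. emb D X Y (F s)) S \<sigma> \<tau>"
  proof (cases "\<sigma> \<in> conf D Y \<and> \<tau> \<in> conf D Y \<and> (\<forall>v\<in>Y - X. \<sigma> v = \<tau> v)")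
    case False
    then have "emb D X Y Z \<sigma> \<tau> = 0" for Z unfolding emb_def by (rule if_not_P)
    then show ?thesis by (simp add: op_sum_def)
  next
    case True
    then have "emb D X Y Z \<sigma> \<tau> = Z (restr X \<sigma>) (restr X \<tau>)" for Z unfolding emb_def by (rule if_P)
    then show ?thesis by (simp add: op_sum_def)
  qed
qed

lemma emb_trans:
  assumes "X \<subseteq> Y" "Y \<subseteq> Z"
  shows "emb D Y Z (emb D X Y Q) = emb D X Z Q"
proof (intro ext)
  fix \<sigma> \<tau>
  have r: "restr X (restr Y \<sigma>) = restr X \<sigma>" for \<sigma> :: "'a \<Rightarrow> nat"
    using assms by (auto simp: restr_def fun_eq_iff)
  have q: "(\<forall>v\<in>Z - Y. \<sigma> v = \<tau> v) \<and> (\<forall>v\<in>Y - X. restr Y \<sigma> v = restr Y \<tau> v) \<longleftrightarrow> (\<forall>v\<in>Z - X. \<sigma> v = \<tau> v)"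
    using assms by (auto simp: restr_def)
  show "emb D Y Z (emb D X Y Q) \<sigma> \<tau> = emb D X Z Q \<sigma> \<tau>"
    unfolding emb_def r using q restr_in_conf[OF assms(2)] by auto
qed

lemma emb_inject:
  assumes "X \<subseteq> Y" "0 < D" "is_op D X P" "is_op D X Q" "emb D X Y P = emb D X Y Q"
  shows "P = Q"
proof (rule qop_eqI[OF assms(3,4)])
  fix \<sigma> \<tau> assume a: "\<sigma> \<in> conf D X" "\<tau> \<in> conf D X"
  \<comment> \<open>Positivity of \<open>D\<close> supplies a configuration on the complement over
    which both blocks can be read.\<close>
  have z: "(\<lambda>_. 0) \<in> conf D (Y - X)" by (rule zero_in_conf[OF assms(2)])
  from emb_merge[OF assms(1) a z z] show "P \<sigma> \<tau> = Q \<sigma> \<tau>" using assms(5) by metis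
qed

lemma emb_eq_zero: "\<not> (\<forall>v\<in>Y - X. \<sigma> v = \<tau> v) \<Longrightarrow> emb D X Y Q \<sigma> \<tau> = 0"
  unfolding emb_def by (rule if_not_P) blast

text \<open>In the product only one intermediate configuration can contribute: it has the values of
  \<tau> on \<open>X\<close> and of \<sigma> elsewhere. The entry then factorises, in a form
  symmetric in the two operators.\<close>

lemma emb_commute:
  assumes XY: "X \<subseteq> Z" "Y \<subseteq> Z" "X \<inter> Y = {}" and fin: "finite Z"
  shows "op_mult D Z (emb D X Z P) (emb D Y Z Q) = op_mult D Z (emb D Y Z Q) (emb D X Z P)"
proof -
  have *: "op_mult D Z (emb D X Z P) (emb D Y Z Q) \<sigma> \<tau>
      = (if \<forall>v\<in>Z - (X \<union> Y). \<sigma> v = \<tau> v then P (restr X \<sigma>) (restr X \<tau>) * Q (restr Y \<sigma>) (restr Y \<tau>) else 0)"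
    if XY: "X \<subseteq> Z" "Y \<subseteq> Z" "X \<inter> Y = {}" and st: "\<sigma> \<in> conf D Z" "\<tau> \<in> conf D Z" for X Y P Q \<sigma> \<tau>
  proof -
    define \<rho> where "\<rho> = merge X \<tau> \<sigma>"
    have disj: "v \<notin> X" if "v \<in> Y" for v using XY(3) that by blast
    have \<rho>: "\<rho> \<in> conf D Z" "restr X \<rho> = restr X \<tau>" "restr Y \<rho> = restr Y \<sigma>"
    proof -
      show "\<rho> \<in> conf D Z" using st by (simp add: \<rho>_def conf_def merge_def)
    qed (simp_all add: fun_eq_iff \<rho>_def merge_def restr_def disj)
    have u: "\<rho>' = \<rho> \<and> (\<forall>v\<in>Z - (X \<union> Y). \<sigma> v = \<tau> v)"
      if "\<rho>' \<in> conf D Z" "\<forall>v\<in>Z - X. \<sigma> v = \<rho>' v" "\<forall>v\<in>Z - Y. \<rho>' v = \<tau> v" for \<rho>'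
    proof -
      have "\<rho>' v = \<rho> v" for v
      proof (cases "v \<in> Z")
        case True
        show ?thesis
        proof (cases "v \<in> X")
          case True
          then have "v \<in> Z - Y" using XY by auto
          then show ?thesis using that(3) True by (simp add: \<rho>_def merge_def)
        next
          case False
          then have "\<sigma> v = \<rho>' v" using that(2) \<open>v \<in> Z\<close> by auto
          then show ?thesis using False by (simp add: \<rho>_def merge_def)
        qed
      next
        case False
        then have "\<rho>' v = 0" "\<sigma> v = 0" "\<tau> v = 0" using that(1) st by (auto simp: conf_def)
        then show ?thesis by (simp add: \<rho>_def merge_def)
      qed
      moreover have "\<sigma> v = \<tau> v" if "v \<in> Z - (X \<union> Y)" for v
        using \<open>\<forall>v\<in>Z - X. \<sigma> v = \<rho>' v\<close> \<open>\<forall>v\<in>Z - Y. \<rho>' v = \<tau> v\<close> that by (metis Diff_iff UnCI)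
      ultimately show ?thesis by blast
    qed
    have "op_mult D Z (emb D X Z P) (emb D Y Z Q) \<sigma> \<tau>
      = (\<Sum>\<rho>'\<in>conf D Z. if \<rho>' = \<rho> then emb D X Z P \<sigma> \<rho> * emb D Y Z Q \<rho> \<tau> else 0)"
      unfolding op_mult_def
    proof (rule sum.cong)
      fix \<rho>' assume \<rho>': "\<rho>' \<in> conf D Z"
      show "emb D X Z P \<sigma> \<rho>' * emb D Y Z Q \<rho>' \<tau> = (if \<rho>' = \<rho> then emb D X Z P \<sigma> \<rho> * emb D Y Z Q \<rho> \<tau> else 0)"
      proof (cases "\<rho>' = \<rho>")
        case False
        then have "\<not> (\<forall>v\<in>Z - X. \<sigma> v = \<rho>' v) \<or> \<not> (\<forall>v\<in>Z - Y. \<rho>' v = \<tau> v)" using u[OF \<rho>'] by blast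
        then have "emb D X Z P \<sigma> \<rho>' = 0 \<or> emb D Y Z Q \<rho>' \<tau> = 0" by (rule disj_forward) (erule emb_eq_zero)+
        then show ?thesis using False by auto
      qed simp
    qed simp
    also have "\<dots> = emb D X Z P \<sigma> \<rho> * emb D Y Z Q \<rho> \<tau>" using \<rho>(1) fin by simp
    also have "\<dots> = (if \<forall>v\<in>Z - (X \<union> Y). \<sigma> v = \<tau> v then P (restr X \<sigma>) (restr X \<tau>) * Q (restr Y \<sigma>) (restr Y \<tau>) else 0)"
    proof -
      have 1: "\<forall>v\<in>Z - X. \<sigma> v = \<rho> v" by (simp add: \<rho>_def merge_def)
      have 2: "(\<forall>v\<in>Z - Y. \<rho> v = \<tau> v) \<longleftrightarrow> (\<forall>v\<in>Z - (X \<union> Y). \<sigma> v = \<tau> v)"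
        by (auto simp: \<rho>_def merge_def)
      have "emb D X Z P \<sigma> \<rho> = P (restr X \<sigma>) (restr X \<tau>)"
        unfolding emb_def \<rho>(2) using 1 \<rho>(1) st(1) by (intro if_P) blast
      moreover have "emb D Y Z Q \<rho> \<tau> = (if \<forall>v\<in>Z - (X \<union> Y). \<sigma> v = \<tau> v then Q (restr Y \<sigma>) (restr Y \<tau>) else 0)"
        unfolding emb_def \<rho>(3) 2 using \<rho>(1) st(2) by (simp only: simp_thms)
      ultimately show ?thesis by (simp only: mult_zero_right simp_thms split: if_split) blast
    qed
    finally show ?thesis .
  qed
  show ?thesis
  proof (rule qop_eqI[of D Z])
    fix \<sigma> \<tau> assume st: "\<sigma> \<in> conf D Z" "\<tau> \<in> conf D Z"
    have YX: "Y \<inter> X = {}" using XY(3) by blast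
    show "op_mult D Z (emb D X Z P) (emb D Y Z Q) \<sigma> \<tau> = op_mult D Z (emb D Y Z Q) (emb D X Z P) \<sigma> \<tau>"
      unfolding *[OF XY st] *[OF XY(2,1) YX st] by (simp only: Un_commute[of X Y] mult.commute)
  qed auto
qed

section \<open>Norms of embeddings, partial traces and conditional expectations\<close>

lemma vnorm_merge:
  assumes "X \<subseteq> Y"
  shows "(vnorm D Y \<psi>)\<^sup>2 = (\<Sum>\<eta>\<in>conf D (Y - X). (vnorm D X (\<lambda>\<alpha>. \<psi> (merge X \<alpha> \<eta>)))\<^sup>2)"
  by (simp add: vnorm_power2 sum_conf_merge[OF assms])

lemma vnorm_slice_le:
  assumes "X \<subseteq> Y" "finite Y" "\<eta> \<in> conf D (Y - X)"
  shows "vnorm D X (\<lambda>\<alpha>. \<psi> (merge X \<alpha> \<eta>)) \<le> vnorm D Y \<psi>"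
proof (rule power2_le_imp_le)
  show "(vnorm D X (\<lambda>\<alpha>. \<psi> (merge X \<alpha> \<eta>)))\<^sup>2 \<le> (vnorm D Y \<psi>)\<^sup>2"
    unfolding vnorm_merge[OF assms(1)] using assms
    by (intro member_le_sum[where f = "\<lambda>\<eta>. (vnorm D X (\<lambda>\<alpha>. \<psi> (merge X \<alpha> \<eta>)))\<^sup>2"]) auto
qed simp

lemma op_apply_emb:
  assumes "X \<subseteq> Y" "finite Y" "\<alpha> \<in> conf D X" "\<eta> \<in> conf D (Y - X)"
  shows "op_apply D Y (emb D X Y Q) \<psi> (merge X \<alpha> \<eta>) = op_apply D X Q (\<lambda>\<alpha>. \<psi> (merge X \<alpha> \<eta>)) \<alpha>"
proof -
  have "op_apply D Y (emb D X Y Q) \<psi> (merge X \<alpha> \<eta>)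
    = (\<Sum>\<zeta>\<in>conf D (Y - X). \<Sum>\<gamma>\<in>conf D X. (if \<eta> = \<zeta> then Q \<alpha> \<gamma> else 0) * \<psi> (merge X \<gamma> \<zeta>))"
    unfolding op_apply_def sum_conf_merge[OF assms(1)]
    by (intro sum.cong refl arg_cong2[of _ _ _ _ "(*)"] emb_merge assms)
  also have "\<dots> = (\<Sum>\<zeta>\<in>conf D (Y - X). if \<eta> = \<zeta> then op_apply D X Q (\<lambda>\<alpha>. \<psi> (merge X \<alpha> \<eta>)) \<alpha> else 0)"
    by (intro sum.cong refl) (auto simp: op_apply_def)
  finally show ?thesis using assms by simp
qed

text \<open>The tensor product of \<phi> with the basis vector of the configuration \<eta>; it is
  used with \<open>Z\<close> equal to the complement of \<open>X\<close>.\<close>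

definition tensor_vec :: "'v set \<Rightarrow> ('v \<Rightarrow> nat) \<Rightarrow> (('v \<Rightarrow> nat) \<Rightarrow> complex) \<Rightarrow> 'v set \<Rightarrow> (('v \<Rightarrow> nat) \<Rightarrow> complex)" where
  "tensor_vec X \<eta> \<phi> Z = (\<lambda>\<sigma>. if restr Z \<sigma> = \<eta> then \<phi> (restr X \<sigma>) else 0)"

lemma tensor_vec_merge:
  assumes "\<alpha> \<in> conf D X" "\<zeta> \<in> conf D (Y - X)"
  shows "tensor_vec X \<eta> \<phi> (Y - X) (merge X \<alpha> \<zeta>) = (if \<zeta> = \<eta> then \<phi> \<alpha> else 0)"
proof -
  have "restr (Y - X) (merge X \<alpha> \<zeta>) = \<zeta>" using assms by (auto simp: restr_def merge_def conf_def)
  then show ?thesis using restr_merge[OF assms(1)] by (simp add: tensor_vec_def)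
qed

lemma vnorm_tensor_vec:
  assumes "X \<subseteq> Y" "finite Y" "\<eta> \<in> conf D (Y - X)"
  shows "vnorm D Y (tensor_vec X \<eta> \<phi> (Y - X)) = vnorm D X \<phi>"
proof -
  have "(vnorm D Y (tensor_vec X \<eta> \<phi> (Y - X)))\<^sup>2
    = (\<Sum>\<zeta>\<in>conf D (Y - X). if \<zeta> = \<eta> then (vnorm D X \<phi>)\<^sup>2 else 0)"
    unfolding vnorm_merge[OF assms(1)]
  proof (rule sum.cong)
    fix \<zeta> assume "\<zeta> \<in> conf D (Y - X)"
    then have "vnorm D X (\<lambda>\<alpha>. tensor_vec X \<eta> \<phi> (Y - X) (merge X \<alpha> \<zeta>)) = vnorm D X (\<lambda>\<alpha>. if \<zeta> = \<eta> then \<phi> \<alpha> else 0)"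
      by (intro vnorm_cong tensor_vec_merge)
    then show "(vnorm D X (\<lambda>\<alpha>. tensor_vec X \<eta> \<phi> (Y - X) (merge X \<alpha> \<zeta>)))\<^sup>2 = (if \<zeta> = \<eta> then (vnorm D X \<phi>)\<^sup>2 else 0)"
      by simp
  qed simp
  then show ?thesis using assms by simp
qed

text \<open>The embedded operator acts on every slice separately and squared norms of slices add,
  which gives the upper bound. For the lower bound a vector on \<open>X\<close> is tensored with the
  zero configuration on the complement.\<close>

lemma op_norm_emb:
  assumes "X \<subseteq> Y" "finite Y" "0 < D"
  shows "op_norm D Y (emb D X Y Q) = op_norm D X Q"
proof (rule antisym)
  have fX: "finite X" using assms finite_subset by blast
  show "op_norm D Y (emb D X Y Q) \<le> op_norm D X Q"
  proof (rule op_norm_leI[OF op_norm_nonneg[OF fX]], rule power2_le_imp_le)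
    fix \<psi>
    have "(vnorm D Y (op_apply D Y (emb D X Y Q) \<psi>))\<^sup>2
      = (\<Sum>\<eta>\<in>conf D (Y - X). (vnorm D X (op_apply D X Q (\<lambda>\<alpha>. \<psi> (merge X \<alpha> \<eta>))))\<^sup>2)"
      unfolding vnorm_merge[OF assms(1)]
      by (intro sum.cong refl arg_cong[of _ _ "\<lambda>x. x\<^sup>2"] vnorm_cong op_apply_emb assms)
    also have "\<dots> \<le> (\<Sum>\<eta>\<in>conf D (Y - X). (op_norm D X Q * vnorm D X (\<lambda>\<alpha>. \<psi> (merge X \<alpha> \<eta>)))\<^sup>2)"
      by (intro sum_mono power_mono vnorm_op_apply fX) auto
    also have "\<dots> = (op_norm D X Q * vnorm D Y \<psi>)\<^sup>2"
      unfolding power_mult_distrib vnorm_merge[OF assms(1)] by (simp add: sum_distrib_left)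
    finally show "(vnorm D Y (op_apply D Y (emb D X Y Q) \<psi>))\<^sup>2 \<le> (op_norm D X Q * vnorm D Y \<psi>)\<^sup>2" .
  qed (simp add: op_norm_nonneg[OF fX])
  show "op_norm D X Q \<le> op_norm D Y (emb D X Y Q)"
  proof (rule op_norm_leI[OF op_norm_nonneg[OF assms(2)]])
    fix \<phi>
    let ?z = "(\<lambda>_. 0) :: 'a \<Rightarrow> nat"
    let ?\<psi> = "tensor_vec X ?z \<phi> (Y - X)"
    have z: "?z \<in> conf D (Y - X)" by (rule zero_in_conf[OF assms(3)])
    have "vnorm D X (op_apply D X Q \<phi>) = vnorm D X (\<lambda>\<alpha>. op_apply D Y (emb D X Y Q) ?\<psi> (merge X \<alpha> ?z))"
    proof (rule vnorm_cong)
      fix \<alpha> assume \<alpha>: "\<alpha> \<in> conf D X"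
      have "op_apply D X Q \<phi> \<alpha> = op_apply D X Q (\<lambda>\<alpha>. ?\<psi> (merge X \<alpha> ?z)) \<alpha>"
        unfolding op_apply_def by (intro sum.cong refl arg_cong2[of _ _ _ _ "(*)"]) (simp add: tensor_vec_merge[OF _ z])
      then show "op_apply D X Q \<phi> \<alpha> = op_apply D Y (emb D X Y Q) ?\<psi> (merge X \<alpha> ?z)"
        by (simp add: op_apply_emb[OF assms(1,2) \<alpha> z])
    qed
    also have "\<dots> \<le> vnorm D Y (op_apply D Y (emb D X Y Q) ?\<psi>)" by (rule vnorm_slice_le[OF assms(1,2) z])
    also have "\<dots> \<le> op_norm D Y (emb D X Y Q) * vnorm D Y ?\<psi>" by (rule vnorm_op_apply[OF assms(2)])
    finally show "vnorm D X (op_apply D X Q \<phi>) \<le> op_norm D Y (emb D X Y Q) * vnorm D X \<phi>"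
      by (simp add: vnorm_tensor_vec[OF assms(1,2) z])
  qed
qed

text \<open>A partial trace is the sum over \<eta> of the compressions of \<open>Q\<close> to the
  slice at \<eta>. Compression does not increase the norm, and there are
  \<open>D ^ card (Y - X)\<close> slices.\<close>

lemma op_norm_ptr_le:
  assumes "X \<subseteq> Y" "finite Y"
  shows "op_norm D X (ptr D Y X Q) \<le> real (D ^ card (Y - X)) * op_norm D Y Q"
proof (rule op_norm_leI)
  fix \<phi>
  have ap: "op_apply D X (ptr D Y X Q) \<phi> \<alpha>
      = (\<Sum>\<eta>\<in>conf D (Y - X). op_apply D Y Q (tensor_vec X \<eta> \<phi> (Y - X)) (merge X \<alpha> \<eta>))"
    if \<alpha>: "\<alpha> \<in> conf D X" for \<alpha>
  proof -
    have "op_apply D Y Q (tensor_vec X \<eta> \<phi> (Y - X)) (merge X \<alpha> \<eta>)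
        = (\<Sum>\<gamma>\<in>conf D X. Q (merge X \<alpha> \<eta>) (merge X \<gamma> \<eta>) * \<phi> \<gamma>)" if \<eta>: "\<eta> \<in> conf D (Y - X)" for \<eta>
    proof -
      have "op_apply D Y Q (tensor_vec X \<eta> \<phi> (Y - X)) (merge X \<alpha> \<eta>)
        = (\<Sum>\<zeta>\<in>conf D (Y - X). \<Sum>\<gamma>\<in>conf D X. Q (merge X \<alpha> \<eta>) (merge X \<gamma> \<zeta>) * (if \<zeta> = \<eta> then \<phi> \<gamma> else 0))"
        unfolding op_apply_def sum_conf_merge[OF assms(1)]
        by (intro sum.cong refl arg_cong2[of _ _ _ _ "(*)"] tensor_vec_merge)
      also have "\<dots> = (\<Sum>\<zeta>\<in>conf D (Y - X). if \<zeta> = \<eta> then \<Sum>\<gamma>\<in>conf D X. Q (merge X \<alpha> \<eta>) (merge X \<gamma> \<eta>) * \<phi> \<gamma> else 0)"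
        by (intro sum.cong refl) auto
      finally show ?thesis using \<eta> assms by simp
    qed
    then show ?thesis
      using \<alpha> by (simp add: op_apply_def[of D X] ptr_def sum_distrib_right) (rule sum.swap)
  qed
  have "vnorm D X (op_apply D X (ptr D Y X Q) \<phi>)
      = vnorm D X (\<lambda>\<alpha>. \<Sum>\<eta>\<in>conf D (Y - X). op_apply D Y Q (tensor_vec X \<eta> \<phi> (Y - X)) (merge X \<alpha> \<eta>))"
    by (rule vnorm_cong) (rule ap)
  also have "\<dots> \<le> (\<Sum>\<eta>\<in>conf D (Y - X). vnorm D X (\<lambda>\<alpha>. op_apply D Y Q (tensor_vec X \<eta> \<phi> (Y - X)) (merge X \<alpha> \<eta>)))"
    by (rule vnorm_sum)
  also have "\<dots> \<le> (\<Sum>\<eta>\<in>conf D (Y - X). op_norm D Y Q * vnorm D X \<phi>)"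
  proof (rule sum_mono)
    fix \<eta> assume \<eta>: "\<eta> \<in> conf D (Y - X)"
    have "vnorm D X (\<lambda>\<alpha>. op_apply D Y Q (tensor_vec X \<eta> \<phi> (Y - X)) (merge X \<alpha> \<eta>))
        \<le> vnorm D Y (op_apply D Y Q (tensor_vec X \<eta> \<phi> (Y - X)))"
      by (rule vnorm_slice_le[OF assms \<eta>])
    also have "\<dots> \<le> op_norm D Y Q * vnorm D Y (tensor_vec X \<eta> \<phi> (Y - X))"
      by (rule vnorm_op_apply[OF assms(2)])
    finally show "vnorm D X (\<lambda>\<alpha>. op_apply D Y Q (tensor_vec X \<eta> \<phi> (Y - X)) (merge X \<alpha> \<eta>)) \<le> op_norm D Y Q * vnorm D X \<phi>"
      by (simp add: vnorm_tensor_vec[OF assms \<eta>])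
  qed
  finally show "vnorm D X (op_apply D X (ptr D Y X Q) \<phi>) \<le> real (D ^ card (Y - X)) * op_norm D Y Q * vnorm D X \<phi>"
    using assms by (simp add: card_conf mult.assoc)
qed (simp add: op_norm_nonneg[OF assms(2)])

text \<open>The normalisation cancels the number of slices exactly. Contractivity and
  \<open>cond_exp_id\<close> are what carry an estimate ||1 - c Q|| < 1 over to the conditional
  expectation.\<close>

lemma op_norm_cond_exp_le:
  assumes "finite \<Lambda>" "0 < D"
  shows "op_norm D \<Lambda> (cond_exp D \<Lambda> L Q) \<le> op_norm D \<Lambda> Q"
proof -
  have d: "\<Lambda> - \<Lambda> \<inter> L = \<Lambda> - L" by auto
  have "op_norm D (\<Lambda> \<inter> L) (ptr D \<Lambda> (\<Lambda> \<inter> L) Q) \<le> real (D ^ card (\<Lambda> - L)) * op_norm D \<Lambda> Q"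
    using op_norm_ptr_le[of "\<Lambda> \<inter> L" \<Lambda> D Q] assms d by simp
  then show ?thesis
    using assms unfolding cond_exp_def
    by (simp add: op_norm_scale op_norm_emb norm_divide norm_power divide_le_eq mult.commute)
qed

lemma ptr_diff: "ptr D Y X (op_diff P Q) = op_diff (ptr D Y X P) (ptr D Y X Q)"
  by (auto simp: ptr_def op_diff_def sum_subtractf fun_eq_iff)

lemma ptr_scale: "ptr D Y X (op_scale c Q) = op_scale c (ptr D Y X Q)"
  by (auto simp: ptr_def op_scale_def sum_distrib_left fun_eq_iff)

lemma ptr_id:
  assumes "X \<subseteq> Y" "finite Y"
  shows "ptr D Y X (op_id D Y) = op_scale (of_nat (D ^ card (Y - X))) (op_id D X)"
proof (rule qop_eqI[of D X])
  fix \<sigma> \<tau> assume a: "\<sigma> \<in> conf D X" "\<tau> \<in> conf D X"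
  have "ptr D Y X (op_id D Y) \<sigma> \<tau> = (\<Sum>\<eta>\<in>conf D (Y - X). if \<sigma> = \<tau> then 1 else 0)"
    using a by (simp add: ptr_def op_id_def merge_in_conf[OF assms(1)] merge_inject)
  then show "ptr D Y X (op_id D Y) \<sigma> \<tau> = op_scale (of_nat (D ^ card (Y - X))) (op_id D X) \<sigma> \<tau>"
    using a assms by (simp add: op_scale_def op_id_def card_conf)
qed auto

lemma cond_exp_diff: "cond_exp D \<Lambda> L (op_diff P Q) = op_diff (cond_exp D \<Lambda> L P) (cond_exp D \<Lambda> L Q)"
  by (simp add: cond_exp_def ptr_diff emb_diff) (simp add: op_scale_def op_diff_def algebra_simps)

lemma cond_exp_scale: "cond_exp D \<Lambda> L (op_scale c Q) = op_scale c (cond_exp D \<Lambda> L Q)"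
  by (simp add: cond_exp_def ptr_scale emb_scale) (simp add: op_scale_def algebra_simps)

lemma cond_exp_id:
  assumes "finite \<Lambda>" "0 < D"
  shows "cond_exp D \<Lambda> L (op_id D \<Lambda>) = op_id D \<Lambda>"
proof -
  have d: "\<Lambda> - \<Lambda> \<inter> L = \<Lambda> - L" by auto
  show ?thesis using assms by (simp add: cond_exp_def ptr_id emb_scale emb_id d) (simp add: op_scale_def)
qed

lemma is_op_exp [simp]: "is_op D X Q \<Longrightarrow> is_op D X (op_exp D X Q)"
  using is_op_pow[of D X Q] unfolding is_op_def[of D X "op_pow D X Q _"] by (auto simp: is_op_def op_exp_def)

lemma emb_pow:
  assumes "X \<subseteq> Y" "finite Y"
  shows "emb D X Y (op_pow D X Q n) = op_pow D Y (emb D X Y Q) n"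
  by (induction n) (simp_all add: emb_id emb_mult assms)

text \<open>At fixed configurations \<open>emb\<close> is either zero or the evaluation of one
  entry, so it passes through the series without a convergence argument.\<close>

lemma emb_exp:
  assumes "X \<subseteq> Y" "finite Y"
  shows "emb D X Y (op_exp D X Q) = op_exp D Y (emb D X Y Q)"
  unfolding op_exp_def emb_pow[OF assms, symmetric]
proof (intro ext)
  fix \<sigma> \<tau>
  show "emb D X Y (\<lambda>\<sigma> \<tau>. \<Sum>n. op_pow D X Q n \<sigma> \<tau> / of_nat (fact n)) \<sigma> \<tau>
      = (\<Sum>n. emb D X Y (op_pow D X Q n) \<sigma> \<tau> / of_nat (fact n))"
  proof (cases "\<sigma> \<in> conf D Y \<and> \<tau> \<in> conf D Y \<and> (\<forall>v\<in>Y - X. \<sigma> v = \<tau> v)")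
    case False
    then have "emb D X Y Z \<sigma> \<tau> = 0" for Z unfolding emb_def by (rule if_not_P)
    then show ?thesis by simp
  next
    case True
    then have "emb D X Y Z \<sigma> \<tau> = Z (restr X \<sigma>) (restr X \<tau>)" for Z unfolding emb_def by (rule if_P)
    then show ?thesis by simp
  qed
qed

section \<open>A Banach algebra of operator families\<close>

lemma op_mult_add_left: "op_mult D X (op_add P Q) R = op_add (op_mult D X P R) (op_mult D X Q R)"
  by (simp add: op_mult_def op_add_def algebra_simps sum.distrib)

lemma op_mult_add_right: "op_mult D X R (op_add P Q) = op_add (op_mult D X R P) (op_mult D X R Q)"
  by (simp add: op_mult_def op_add_def algebra_simps sum.distrib)

lemma op_mult_scale_left: "op_mult D X (op_scale c P) Q = op_scale c (op_mult D X P Q)"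
  by (simp add: op_mult_def op_scale_def sum_distrib_left mult.assoc)

lemma op_mult_scale_right: "op_mult D X P (op_scale c Q) = op_scale c (op_mult D X P Q)"
  by (simp add: op_mult_def op_scale_def sum_distrib_left algebra_simps)

text \<open>
  The dimension of the operator space depends on $D$ and $X$, so no single space of kernels is a type. Uniformly
  bounded families of operators, one for every $D > 0$ and finite $X$, form one Banach algebra whose
  components are unital contractive homomorphisms onto all the operator spaces.
\<close>

definition bounded_family :: "(nat \<Rightarrow> 'v set \<Rightarrow> 'v qop) \<Rightarrow> bool" where
  "bounded_family T \<longleftrightarrow> (\<forall>D X. is_op D X (T D X)) \<and>
    (\<forall>D X. \<not> (0 < D \<and> finite X) \<longrightarrow> T D X = (\<lambda>_ _. 0)) \<and>
    (\<exists>M. \<forall>D X. 0 < D \<longrightarrow> finite X \<longrightarrow> op_norm D X (T D X) \<le> M)"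

lemma bounded_familyI:
  assumes "\<And>D X. is_op D X (T D X)" "\<And>D X. \<not> (0 < D \<and> finite X) \<Longrightarrow> T D X = (\<lambda>_ _. 0)"
    "\<And>D X. 0 < D \<Longrightarrow> finite X \<Longrightarrow> op_norm D X (T D X) \<le> M"
  shows "bounded_family T"
  using assms unfolding bounded_family_def by blast

lemma bounded_familyE:
  assumes "bounded_family T"
  obtains M where "\<And>D X. is_op D X (T D X)" "\<And>D X. \<not> (0 < D \<and> finite X) \<Longrightarrow> T D X = (\<lambda>_ _. 0)"
    "\<And>D X. 0 < D \<Longrightarrow> finite X \<Longrightarrow> op_norm D X (T D X) \<le> M"
  using assms unfolding bounded_family_def by blast

typedef 'v opfam = "{T :: nat \<Rightarrow> 'v set \<Rightarrow> 'v qop. bounded_family T}"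
  morphisms component Abs_opfam
  by (rule exI[of _ "\<lambda>_ _ _ _. 0"]) (auto intro!: bounded_familyI[of _ 0])

setup_lifting type_definition_opfam

lemma is_op_component [simp]: "is_op D X (component T D X)"
  by transfer (auto elim: bounded_familyE)

lemma component_eq_zero: "\<not> (0 < D \<and> finite X) \<Longrightarrow> component T D X = (\<lambda>_ _. 0)"
  by transfer (erule bounded_familyE, simp)

text \<open>At the remaining indices all components are zero by construction. For this reason a
  supremum over \<open>0 < D\<close> and finite \<open>X\<close> alone is a definite norm.\<close>

lemma opfam_eqI:
  assumes "\<And>D X. 0 < D \<Longrightarrow> finite X \<Longrightarrow> component S D X = component T D X"
  shows "S = T"
proof -
  have "component S D X = component T D X" for D X
    using assms[of D X] component_eq_zero[of D X S] component_eq_zero[of D X T]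
    by (cases "0 < D \<and> finite X") auto
  then show ?thesis by (simp add: component_inject[symmetric] fun_eq_iff)
qed

instantiation opfam :: (type) real_normed_algebra_1
begin

lift_definition zero_opfam :: "'a opfam" is "\<lambda>_ _ _ _. 0" by (rule bounded_familyI[of _ 0]) auto

lift_definition one_opfam :: "'a opfam"
  is "\<lambda>D X. if 0 < D \<and> finite X then op_id D X else (\<lambda>_ _. 0)"
  by (rule bounded_familyI[of _ 1]) (auto simp: op_norm_id)

lift_definition plus_opfam :: "'a opfam \<Rightarrow> 'a opfam \<Rightarrow> 'a opfam"
  is "\<lambda>S T D X. op_add (S D X) (T D X)"
proof -
  fix S T :: "nat \<Rightarrow> 'a set \<Rightarrow> 'a qop" assume "bounded_family S" "bounded_family T"
  then show "bounded_family (\<lambda>D X. op_add (S D X) (T D X))"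
  proof (elim bounded_familyE)
    fix M N
    assume a: "\<And>D X. is_op D X (S D X)" "\<And>D X. is_op D X (T D X)"
      "\<And>D X. \<not> (0 < D \<and> finite X) \<Longrightarrow> S D X = (\<lambda>_ _. 0)"
      "\<And>D X. \<not> (0 < D \<and> finite X) \<Longrightarrow> T D X = (\<lambda>_ _. 0)"
      "\<And>D X. 0 < D \<Longrightarrow> finite X \<Longrightarrow> op_norm D X (S D X) \<le> M"
      "\<And>D X. 0 < D \<Longrightarrow> finite X \<Longrightarrow> op_norm D X (T D X) \<le> N"
    show ?thesis
    proof (rule bounded_familyI)
      show "op_norm D X (op_add (S D X) (T D X)) \<le> M + N" if "0 < D" "finite X" for D X
        using a(5,6)[OF that] op_norm_add[OF that(2), of D "S D X" "T D X"] by simp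
    qed (simp_all add: a(1,2) a(3,4) op_add_def[of "\<lambda>_ _. 0"])
  qed
qed

lift_definition times_opfam :: "'a opfam \<Rightarrow> 'a opfam \<Rightarrow> 'a opfam"
  is "\<lambda>S T D X. op_mult D X (S D X) (T D X)"
proof -
  fix S T :: "nat \<Rightarrow> 'a set \<Rightarrow> 'a qop" assume "bounded_family S" "bounded_family T"
  then show "bounded_family (\<lambda>D X. op_mult D X (S D X) (T D X))"
  proof (elim bounded_familyE)
    fix M N
    assume a: "\<And>D X. is_op D X (S D X)" "\<And>D X. is_op D X (T D X)"
      "\<And>D X. \<not> (0 < D \<and> finite X) \<Longrightarrow> S D X = (\<lambda>_ _. 0)"
      "\<And>D X. 0 < D \<Longrightarrow> finite X \<Longrightarrow> op_norm D X (S D X) \<le> M"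
      "\<And>D X. 0 < D \<Longrightarrow> finite X \<Longrightarrow> op_norm D X (T D X) \<le> N"
    show ?thesis
    proof (rule bounded_familyI)
      show "op_norm D X (op_mult D X (S D X) (T D X)) \<le> M * N" if DX: "0 < D" "finite X" for D X
      proof -
        have "op_norm D X (op_mult D X (S D X) (T D X)) \<le> op_norm D X (S D X) * op_norm D X (T D X)"
          by (rule op_norm_mult[OF DX(2)])
        also have "\<dots> \<le> M * N"
          using a(4,5)[OF DX] op_norm_nonneg[OF DX(2)] order_trans[OF op_norm_nonneg[OF DX(2)] a(4)[OF DX]]
          by (intro mult_mono) auto
        finally show ?thesis .
      qed
    qed (simp_all add: a(1,2) a(3) op_mult_def[where P = "\<lambda>_ _. 0"])
  qed
qed

lift_definition scaleR_opfam :: "real \<Rightarrow> 'a opfam \<Rightarrow> 'a opfam"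
  is "\<lambda>r T D X. op_scale (of_real r) (T D X)"
proof -
  fix r and T :: "nat \<Rightarrow> 'a set \<Rightarrow> 'a qop" assume "bounded_family T"
  then show "bounded_family (\<lambda>D X. op_scale (complex_of_real r) (T D X))"
  proof (rule bounded_familyE)
    fix M
    assume a: "\<And>D X. is_op D X (T D X)" "\<And>D X. \<not> (0 < D \<and> finite X) \<Longrightarrow> T D X = (\<lambda>_ _. 0)"
      "\<And>D X. 0 < D \<Longrightarrow> finite X \<Longrightarrow> op_norm D X (T D X) \<le> M"
    show ?thesis
      by (rule bounded_familyI[where M = "\<bar>r\<bar> * M"])
         (simp_all add: a(1) a(2) a(3) op_scale_def[where Q = "\<lambda>_ _. 0"] op_norm_scale mult_left_mono)
  qed
qed

definition uminus_opfam :: "'a opfam \<Rightarrow> 'a opfam" where "uminus_opfam T = (-1) *\<^sub>R T"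

definition minus_opfam :: "'a opfam \<Rightarrow> 'a opfam \<Rightarrow> 'a opfam" where "minus_opfam S T = S + (-1) *\<^sub>R T"

definition norm_opfam :: "'a opfam \<Rightarrow> real" where
  "norm_opfam T = (SUP (D, X)\<in>{0<..} \<times> {X. finite X}. op_norm D X (component T D X))"

definition sgn_opfam :: "'a opfam \<Rightarrow> 'a opfam" where "sgn_opfam T = inverse (norm T) *\<^sub>R T"

definition dist_opfam :: "'a opfam \<Rightarrow> 'a opfam \<Rightarrow> real" where "dist_opfam S T = norm (S - T)"

definition uniformity_opfam :: "('a opfam \<times> 'a opfam) filter" where
  "uniformity_opfam = (INF e\<in>{0<..}. principal {(x, y). dist x y < e})"

definition open_opfam :: "'a opfam set \<Rightarrow> bool" where
  "open_opfam U \<longleftrightarrow> (\<forall>x\<in>U. \<forall>\<^sub>F (x', y) in uniformity. x' = x \<longrightarrow> y \<in> U)"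

lemma op_norm_component_le:
  assumes "0 < D" "finite X"
  shows "op_norm D X (component T D X) \<le> norm T"
proof -
  obtain M where M: "\<And>D X. 0 < D \<Longrightarrow> finite X \<Longrightarrow> op_norm D X (component T D X) \<le> M"
    using component[of T] unfolding bounded_family_def by blast
  have "bdd_above ((\<lambda>(D, X). op_norm D X (component T D X)) ` ({0<..} \<times> {X. finite X}))"
    by (rule bdd_aboveI[of _ M]) (auto intro: M)
  from cSUP_upper[OF _ this, of "(D, X)"] show ?thesis using assms by (simp add: norm_opfam_def)
qed

lemma norm_opfam_leI:
  assumes "\<And>D X. 0 < D \<Longrightarrow> finite X \<Longrightarrow> op_norm D X (component T D X) \<le> M"
  shows "norm T \<le> M"
  \<comment> \<open>\<open>D = 1\<close> and \<open>X = {}\<close> witness that the supremum is over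
    a nonempty index set.\<close>
  unfolding norm_opfam_def by (rule cSUP_least) (auto intro!: assms intro: exI[of _ 1] exI[of _ "{}"])

lemma component_minus: "component (S - T) D X = op_diff (component S D X) (component T D X)"
  unfolding minus_opfam_def by transfer (simp add: op_add_def op_scale_def op_diff_def)

instance
proof
  fix a b c :: "'a opfam" and r s :: real
  show "a - b = a + - b" by (simp add: minus_opfam_def uminus_opfam_def)
  show "a + b + c = a + (b + c)" by transfer (simp add: op_add_def algebra_simps)
  show "a + b = b + a" by transfer (simp add: op_add_def algebra_simps)
  show "0 + a = a" by transfer (simp add: op_add_def)
  show "- a + a = 0" unfolding uminus_opfam_def by transfer (simp add: op_add_def op_scale_def)
  show "r *\<^sub>R (a + b) = r *\<^sub>R a + r *\<^sub>R b" by transfer (simp add: op_add_def op_scale_def algebra_simps)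
  show "(r + s) *\<^sub>R a = r *\<^sub>R a + s *\<^sub>R a" by transfer (simp add: op_add_def op_scale_def algebra_simps)
  show "r *\<^sub>R s *\<^sub>R a = (r * s) *\<^sub>R a" by transfer (simp add: op_scale_def mult.assoc)
  show "1 *\<^sub>R a = a" by transfer (simp add: op_scale_def)
  show "a * b * c = a * (b * c)" by transfer (simp add: op_mult_assoc)
  show "(a + b) * c = a * c + b * c" by transfer (simp add: op_mult_add_left)
  show "a * (b + c) = a * b + a * c" by transfer (simp add: op_mult_add_right)
  show "r *\<^sub>R a * b = r *\<^sub>R (a * b)" by transfer (simp add: op_mult_scale_left)
  show "a * r *\<^sub>R b = r *\<^sub>R (a * b)" by transfer (simp add: op_mult_scale_right)
  show "1 * a = a" by (rule opfam_eqI) (simp add: times_opfam.rep_eq one_opfam.rep_eq op_mult_id_left)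
  show "a * 1 = a" by (rule opfam_eqI) (simp add: times_opfam.rep_eq one_opfam.rep_eq op_mult_id_right)
  show "(0::'a opfam) \<noteq> 1"
  proof
    assume "(0::'a opfam) = 1"
    \<comment> \<open>Over the empty set the operator space is one-dimensional, and its single entry
      distinguishes 0 from 1.\<close>
    then have "component (0::'a opfam) 1 {} (\<lambda>_. 0) (\<lambda>_. 0) = component 1 1 {} (\<lambda>_. 0) (\<lambda>_. 0)" by simp
    then show False
      using zero_in_conf[of 1 "{} :: 'a set"] by (simp add: zero_opfam.rep_eq one_opfam.rep_eq op_id_def)
  qed
  show "dist a b = norm (a - b)" by (simp add: dist_opfam_def)
  show "sgn a = inverse (norm a) *\<^sub>R a" by (simp add: sgn_opfam_def)
  show "(uniformity :: ('a opfam \<times> 'a opfam) filter) = (INF e\<in>{0<..}. principal {(x, y). dist x y < e})"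
    by (simp add: uniformity_opfam_def)
  show "open U \<longleftrightarrow> (\<forall>x\<in>U. \<forall>\<^sub>F (x', y) in uniformity. x' = x \<longrightarrow> y \<in> U)" for U :: "'a opfam set"
    by (simp add: open_opfam_def)
  have nonneg: "0 \<le> norm a" for a :: "'a opfam"
    using op_norm_component_le[of 1 "{}" a] op_norm_nonneg[of "{}" 1 "component a 1 {}"] by simp
  show "norm a = 0 \<longleftrightarrow> a = 0"
  proof
    assume a: "norm a = 0"
    show "a = 0"
    proof (rule opfam_eqI)
      fix D :: nat and X :: "'a set" assume DX: "0 < D" "finite X"
      have "cmod (component a D X \<sigma> \<tau>) \<le> 0" for \<sigma> \<tau>
        using order_trans[OF norm_entry_le_op_norm[OF DX(2) is_op_component] op_norm_component_le[OF DX, of a]] a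
        by simp
      then show "component a D X = component 0 D X"
        by (simp add: zero_opfam.rep_eq fun_eq_iff)
    qed
  next
    assume "a = 0"
    then have "norm a \<le> 0" by (intro norm_opfam_leI) (simp add: zero_opfam.rep_eq)
    then show "norm a = 0" using nonneg[of a] by simp
  qed
  show "norm (a + b) \<le> norm a + norm b"
    by (rule norm_opfam_leI)
       (auto simp: plus_opfam.rep_eq intro!: order_trans[OF op_norm_add] add_mono op_norm_component_le)
  have le: "norm (r *\<^sub>R a) \<le> \<bar>r\<bar> * norm a" for r and a :: "'a opfam"
    by (rule norm_opfam_leI)
       (auto simp: scaleR_opfam.rep_eq op_norm_scale intro!: mult_left_mono op_norm_component_le)
  show "norm (r *\<^sub>R a) = \<bar>r\<bar> * norm a"
  proof (cases "r = 0")
    case True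
    then show ?thesis using le[of 0 a] nonneg[of "0 *\<^sub>R a"] by simp
  next
    case False
    have "inverse r *\<^sub>R (r *\<^sub>R a) = a"
      using False by transfer (simp add: op_scale_def mult.assoc[symmetric])
    then have "norm a \<le> \<bar>inverse r\<bar> * norm (r *\<^sub>R a)" using le[of "inverse r" "r *\<^sub>R a"] by simp
    then have "\<bar>r\<bar> * norm a \<le> norm (r *\<^sub>R a)" using False by (simp add: field_simps)
    then show ?thesis using le[of r a] by simp
  qed
  show "norm (a * b) \<le> norm a * norm b"
  proof (rule norm_opfam_leI)
    fix D :: nat and X :: "'a set" assume DX: "0 < D" "finite X"
    have "op_norm D X (component (a * b) D X) \<le> op_norm D X (component a D X) * op_norm D X (component b D X)"
      using op_norm_mult[OF DX(2)] by (simp add: times_opfam.rep_eq)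
    also have "\<dots> \<le> norm a * norm b"
      by (intro mult_mono op_norm_component_le op_norm_nonneg nonneg DX)
    finally show "op_norm D X (component (a * b) D X) \<le> norm a * norm b" .
  qed
  show "norm (1::'a opfam) = 1"
  proof (rule antisym)
    show "norm (1::'a opfam) \<le> 1" by (rule norm_opfam_leI) (simp add: one_opfam.rep_eq op_norm_id)
    show "1 \<le> norm (1::'a opfam)"
      using op_norm_component_le[of 1 "{}" "1 :: 'a opfam"] by (simp add: one_opfam.rep_eq op_norm_id)
  qed
qed

end

lemma norm_entry_component_le: "cmod (component T D X \<sigma> \<tau>) \<le> norm T"
proof (cases "0 < D \<and> finite X")
  case True
  then have DX: "0 < D" "finite X" by auto
  show ?thesis
    by (rule order_trans[OF norm_entry_le_op_norm[OF DX(2) is_op_component] op_norm_component_le[OF DX]])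
qed (simp add: component_eq_zero)

text \<open>Through these functionals limits, series and integrals in \<open>opfam\<close> become
  statements about the entries of kernels. They are real linear, \<open>opfam\<close> being a real
  algebra.\<close>

lemma bounded_linear_entry: "bounded_linear (\<lambda>T. component T D X \<sigma> \<tau>)"
  by (rule bounded_linear_intro[of _ 1])
     (auto simp: plus_opfam.rep_eq scaleR_opfam.rep_eq op_add_def op_scale_def scaleR_conv_of_real[where 'a = complex] norm_entry_component_le)

instance opfam :: (type) banach
proof
  fix T :: "nat \<Rightarrow> 'a opfam" assume C: "Cauchy T"
  have "\<exists>l. (\<lambda>n. component (T n) D X \<sigma> \<tau>) \<longlonglongrightarrow> l" for D X \<sigma> \<tau>
    using bounded_linear.Cauchy[OF bounded_linear_entry C, of D X \<sigma> \<tau>]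
    unfolding Cauchy_convergent_iff convergent_def .
  then obtain L where L: "\<And>D X \<sigma> \<tau>. (\<lambda>n. component (T n) D X \<sigma> \<tau>) \<longlonglongrightarrow> L D X \<sigma> \<tau>"
    by metis
  obtain B where B: "\<And>n. norm (T n) \<le> B"
    using cauchy_imp_bounded[OF C] unfolding bounded_iff by auto
  have L_op: "is_op D X (L D X)" for D X
    unfolding is_op_def
  proof (intro allI impI)
    fix \<sigma> \<tau> assume "\<sigma> \<notin> conf D X \<or> \<tau> \<notin> conf D X"
    then have "component (T n) D X \<sigma> \<tau> = 0" for n
      using is_op_component[of D X "T n"] unfolding is_op_def by blast
    then show "L D X \<sigma> \<tau> = 0" using L[of D X \<sigma> \<tau>] by (simp add: LIMSEQ_const_iff)
  qed
  have L_zero: "L D X = (\<lambda>_ _. 0)" if "\<not> (0 < D \<and> finite X)" for D X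
  proof (intro ext)
    fix \<sigma> \<tau>
    show "L D X \<sigma> \<tau> = 0"
      using L[of D X \<sigma> \<tau>] by (simp add: component_eq_zero[OF that] LIMSEQ_const_iff)
  qed
  have L_bound: "op_norm D X (L D X) \<le> B" if "0 < D" "finite X" for D X
    by (rule op_norm_tendsto_le[OF that(2) L])
       (auto intro!: always_eventually order_trans[OF op_norm_component_le[OF that] B])
  define S where "S = Abs_opfam L"
  have S: "component S = L"
    unfolding S_def by (rule Abs_opfam_inverse) (use bounded_familyI[of L B] L_op L_zero L_bound in simp)
  have "T \<longlonglongrightarrow> S"
  proof (rule LIMSEQ_I)
    fix e :: real assume e: "0 < e"
    then obtain N where N: "\<And>m n. N \<le> m \<Longrightarrow> N \<le> n \<Longrightarrow> norm (T m - T n) < e / 2"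
      using C[unfolded Cauchy_iff] by (meson half_gt_zero)
    have "norm (T m - S) < e" if m: "N \<le> m" for m
    proof -
      \<comment> \<open>With \<open>m\<close> fixed, let \<open>n\<close> tend to infinity in the
        Cauchy estimate. The same N serves all \<open>D\<close> and \<open>X\<close>, so entrywise
        limits still give a uniform bound.\<close>
      have "norm (T m - S) \<le> e / 2"
      proof (rule norm_opfam_leI)
        fix D :: nat and X :: "'a set" assume DX: "0 < D" "finite X"
        show "op_norm D X (component (T m - S) D X) \<le> e / 2"
        proof (rule op_norm_tendsto_le[OF DX(2)])
          show "(\<lambda>n. component (T m - T n) D X \<sigma> \<tau>) \<longlonglongrightarrow> component (T m - S) D X \<sigma> \<tau>" for \<sigma> \<tau>
            unfolding component_minus op_diff_def S by (intro tendsto_intros L)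
          have "op_norm D X (component (T m - T n) D X) \<le> e / 2" if "N \<le> n" for n
            using op_norm_component_le[OF DX, of "T m - T n"] N[OF m that] by simp
          then show "\<forall>\<^sub>F n in sequentially. op_norm D X (component (T m - T n) D X) \<le> e / 2"
            unfolding eventually_sequentially by blast
        qed
      qed
      then show ?thesis using e by simp
    qed
    then show "\<exists>no. \<forall>n\<ge>no. norm (T n - S) < e" by blast
  qed
  then show "convergent T" by (rule convergentI)
qed

section \<open>Translation between families and kernels\<close>

lemma component_zero: "component 0 D X = (\<lambda>_ _. 0)"
  by (rule zero_opfam.rep_eq[THEN fun_cong, THEN fun_cong])

lemma component_one: "0 < D \<Longrightarrow> finite X \<Longrightarrow> component 1 D X = op_id D X"
  by (simp add: one_opfam.rep_eq)

lemma component_add: "component (S + T) D X = op_add (component S D X) (component T D X)"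
  by (simp add: plus_opfam.rep_eq)

lemma component_mult: "component (S * T) D X = op_mult D X (component S D X) (component T D X)"
  by (simp add: times_opfam.rep_eq)

lemma component_scaleR: "component (r *\<^sub>R T) D X = op_scale (of_real r) (component T D X)"
  by (simp add: scaleR_opfam.rep_eq)

lemma component_power:
  assumes "0 < D" "finite X"
  shows "component (T ^ n) D X = op_pow D X (component T D X) n"
  by (induction n) (simp_all add: component_one[OF assms] component_mult)

lemma component_exp:
  assumes "0 < D" "finite X"
  shows "component (exp T) D X = op_exp D X (component T D X)"
proof (intro ext)
  fix \<sigma> \<tau>
  have "component (exp T) D X \<sigma> \<tau> = (\<Sum>n. component (T ^ n /\<^sub>R fact n) D X \<sigma> \<tau>)"
    unfolding exp_def by (rule bounded_linear.suminf[OF bounded_linear_entry summable_exp_generic])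
  also have "\<dots> = op_exp D X (component T D X) \<sigma> \<tau>"
    unfolding op_exp_def
    by (intro suminf_cong)
       (simp add: component_scaleR component_power[OF assms] op_scale_def divide_inverse mult.commute of_real_inverse)
  finally show "component (exp T) D X \<sigma> \<tau> = op_exp D X (component T D X) \<sigma> \<tau>" .
qed

text \<open>Extension by zero to all other indices. It is multiplicative and isometric on operators
  over \<open>X\<close> but not unital, so exponentials of its values are compared with
  \<open>op_exp\<close> only at the index \<open>D\<close>, \<open>X\<close>.\<close>

lift_definition single :: "nat \<Rightarrow> 'v set \<Rightarrow> 'v qop \<Rightarrow> 'v opfam"
  is "\<lambda>D X Q D' X'. if D' = D \<and> X' = X \<and> 0 < D \<and> finite X \<and> is_op D X Q then Q else (\<lambda>_ _. 0)"
proof -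
  fix D and X :: "'v set" and Q
  show "bounded_family (\<lambda>D' X'. if D' = D \<and> X' = X \<and> 0 < D \<and> finite X \<and> is_op D X Q then Q else (\<lambda>_ _. 0))"
    by (rule bounded_familyI[of _ "max 0 (op_norm D X Q)"]) auto
qed

lemma component_single:
  "0 < D \<Longrightarrow> finite X \<Longrightarrow> is_op D X Q \<Longrightarrow> component (single D X Q) D X = Q"
  by (simp add: single.rep_eq)

lemma norm_single:
  assumes "0 < D" "finite X" "is_op D X Q"
  shows "norm (single D X Q) = op_norm D X Q"
proof (rule antisym)
  show "norm (single D X Q) \<le> op_norm D X Q"
    by (rule norm_opfam_leI) (auto simp: single.rep_eq assms op_norm_nonneg)
  show "op_norm D X Q \<le> norm (single D X Q)"
    using op_norm_component_le[OF assms(1,2), of "single D X Q"] component_single[OF assms] by simp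
qed


lemma single_mult: "is_op D X P \<Longrightarrow> is_op D X Q \<Longrightarrow> single D X P * single D X Q = single D X (op_mult D X P Q)"
  by (rule opfam_eqI) (auto simp: component_mult single.rep_eq op_mult_def[where P = "\<lambda>_ _. 0"])

lemma single_add: "is_op D X P \<Longrightarrow> is_op D X Q \<Longrightarrow> single D X P + single D X Q = single D X (op_add P Q)"
  by (rule opfam_eqI) (auto simp: component_add single.rep_eq op_add_def[of "\<lambda>_ _. 0"])

lemma single_diff: "is_op D X P \<Longrightarrow> is_op D X Q \<Longrightarrow> single D X P - single D X Q = single D X (op_diff P Q)"
  by (rule opfam_eqI) (auto simp: component_minus single.rep_eq op_diff_def[of "\<lambda>_ _. 0"])

lemma single_zero: "single D X (\<lambda>_ _. 0) = 0"
  by (rule opfam_eqI) (auto simp: component_zero single.rep_eq)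

lemma single_sum:
  "(\<And>i. i \<in> I \<Longrightarrow> is_op D X (F i)) \<Longrightarrow> (\<Sum>i\<in>I. single D X (F i)) = single D X (op_sum F I)"
proof (induction I rule: infinite_finite_induct)
  case (insert i I)
  then show ?case by (simp add: single_add is_op_sum) (simp add: op_add_def op_sum_def)
qed (simp_all add: op_sum_def single_zero)

section \<open>Exponentials in Banach algebras\<close>

text \<open>The series are compared from the quadratic term on. This quantitative form serves both
  the derivative of exp at 0 and the recovery of \<open>b\<close> from its dyadic
  exponentials.\<close>

lemma norm_exp_minus_linear_le:
  fixes d :: "'a::{real_normed_algebra_1,banach}"
  shows "norm (exp d - 1 - d) \<le> exp (norm d) - 1 - norm d"
proof -
  let ?f = "\<lambda>n. inverse (fact (n + 2)) *\<^sub>R d ^ (n + 2)"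
  let ?g = "\<lambda>n. inverse (fact (n + 2)) *\<^sub>R norm d ^ (n + 2)"
  have fg: "norm (?f n) \<le> ?g n" for n
    using norm_power_ineq[of d "n + 2"] by (simp add: mult_left_mono)
  have sg: "summable ?g"
    using summable_exp_generic[of "norm d"] by (subst summable_iff_shift)
  have sn: "summable (\<lambda>n. norm (?f n))"
    by (rule summable_comparison_test'[OF sg, of 0]) (use fg in simp)
  have "norm (exp d - 1 - d) = norm (\<Sum>n. ?f n)"
    by (subst exp_first_two_terms) simp
  also have "\<dots> \<le> (\<Sum>n. norm (?f n))" by (rule summable_norm[OF sn])
  also have "\<dots> \<le> (\<Sum>n. ?g n)" by (rule suminf_le[OF fg sn sg])
  also have "\<dots> = exp (norm d) - 1 - norm d"
    by (subst exp_first_two_terms) simp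
  finally show ?thesis .
qed

lemma has_derivative_exp_zero:
  "(exp has_derivative (\<lambda>h. h)) (at (0::'a::{real_normed_algebra_1,banach}))"
  unfolding has_derivative_at
proof (intro conjI bounded_linear_ident)
  have ev: "\<forall>\<^sub>F h::'a in at 0. norm (norm (exp (0 + h) - exp 0 - h) / norm h) \<le> norm h"
    unfolding eventually_at
  proof (intro exI[of _ 1] conjI ballI impI)
    fix h :: 'a assume h: "h \<noteq> 0 \<and> dist h 0 < 1"
    have "norm (exp h - 1 - h) \<le> exp (norm h) - 1 - norm h" by (rule norm_exp_minus_linear_le)
    also have "\<dots> \<le> (norm h)\<^sup>2" using exp_bound[of "norm h"] h by simp
    finally show "norm (norm (exp (0 + h) - exp 0 - h) / norm h) \<le> norm h"
      using h by (simp add: field_simps power2_eq_square)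
  qed simp
  show "(\<lambda>h::'a. norm (exp (0 + h) - exp 0 - h) / norm h) \<midarrow>0\<rightarrow> 0"
    by (rule Lim_null_comparison[OF ev]) (rule tendsto_norm_zero, rule tendsto_ident_at)
qed

text \<open>Because \<open>b r\<close> commutes with \<open>b s\<close>, the exponential splits as
  exp (b s) times exp (b r - b s). Only the derivative of exp at 0 is then required.\<close>

lemma has_vector_derivative_exp_commuting:
  fixes b :: "real \<Rightarrow> 'a::{real_normed_algebra_1,banach}"
  assumes b: "(b has_vector_derivative b') (at s within T)"
    and comm: "\<And>r. b r * b s = b s * b r"
  shows "((\<lambda>r. exp (b r)) has_vector_derivative exp (b s) * b') (at s within T)"
proof -
  have 1: "exp (b r) = exp (b s) * exp (b r - b s)" for r
    using exp_add_commuting[of "b s" "b r - b s"] comm[of r] by (simp add: algebra_simps)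
  have d: "((\<lambda>r. b r - b s) has_derivative (\<lambda>h. h *\<^sub>R b')) (at s within T)"
    using b unfolding has_vector_derivative_def by (auto intro!: derivative_eq_intros)
  have "((\<lambda>r. exp (b r - b s)) has_derivative (\<lambda>h. h *\<^sub>R b')) (at s within T)"
    using has_derivative_compose[OF d, of exp "\<lambda>h. h"] has_derivative_exp_zero by simp
  then have "((\<lambda>r. exp (b s) * exp (b r - b s)) has_derivative (\<lambda>h. exp (b s) * (h *\<^sub>R b'))) (at s within T)"
    by (rule has_derivative_mult_right)
  moreover have "(\<lambda>r. exp (b r)) = (\<lambda>r. exp (b s) * exp (b r - b s))" by (rule ext) (rule 1)
  ultimately show ?thesis unfolding has_vector_derivative_def by simp
qed

text \<open>
  The logarithm is $b = -\int_0^1 x (1 - t x)^{-1} \, dt$. It lies in the closed span of the powers of $x$; the second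
  conclusion expresses this by functionals.
\<close>

lemma exists_exp_eq_one_minus:
  fixes x :: "'a::{real_normed_algebra_1,banach}"
  assumes x: "norm x < 1"
  obtains b where "exp b = 1 - x"
    "\<And>f :: 'a \<Rightarrow> complex. bounded_linear f \<Longrightarrow> (\<And>n. f (x ^ Suc n) = 0) \<Longrightarrow> f b = 0"
proof -
  \<comment> \<open>The Neumann series of the inverse of 1 - t x.\<close>
  define R where "R t = (\<Sum>n. (t *\<^sub>R x) ^ n)" for t :: real
  have small: "norm (t *\<^sub>R x) < 1" if "t \<in> {0..1}" for t
    using that x mult_left_le_one_le[of "norm x" t] by simp
  have sm: "summable (\<lambda>n. (t *\<^sub>R x) ^ n)" if "t \<in> {0..1}" for t
    by (rule complete_algebra_summable_geometric[OF small[OF that]])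
  have R_shift: "R t - 1 = (\<Sum>n. (t *\<^sub>R x) ^ Suc n)" if "t \<in> {0..1}" for t
    using suminf_split_head[OF sm[OF that]] unfolding R_def power_0 by (rule sym)
  have R_split: "R t = 1 + (t *\<^sub>R x) * R t" if "t \<in> {0..1}" for t
    using R_shift[OF that] suminf_mult[OF sm[OF that], of "t *\<^sub>R x"]
    unfolding R_def[symmetric] power_Suc[symmetric] by (metis add.commute diff_add_cancel)
  have R_split': "R t = 1 + R t * (t *\<^sub>R x)" if "t \<in> {0..1}" for t
    using R_shift[OF that] suminf_mult2[OF sm[OF that], of "t *\<^sub>R x"]
    unfolding R_def[symmetric] power_Suc2[symmetric] by (metis add.commute diff_add_cancel)
  have inv1: "(1 - t *\<^sub>R x) * R t = 1" and inv2: "R t * (1 - t *\<^sub>R x) = 1" if "t \<in> {0..1}" for t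
    using R_split[OF that] R_split'[OF that] by (simp_all add: algebra_simps)
  have R_bound: "norm (R t) \<le> 1 / (1 - norm x)" if "t \<in> {0..1}" for t
  proof -
    have "norm (R t) \<le> 1 + norm ((t *\<^sub>R x) * R t)"
      using norm_triangle_ineq[of 1 "(t *\<^sub>R x) * R t"] R_split[OF that] by simp
    also have "norm ((t *\<^sub>R x) * R t) \<le> norm x * norm (R t)"
    proof -
      have "norm ((t *\<^sub>R x) * R t) \<le> norm (t *\<^sub>R x) * norm (R t)" by (rule norm_mult_ineq)
      also have "norm (t *\<^sub>R x) \<le> norm x" using that by (simp add: mult_left_le_one_le)
      finally show ?thesis by (simp add: mult_right_mono)
    qed
    finally have "norm (R t) * (1 - norm x) \<le> 1" by (simp add: algebra_simps)
    then show ?thesis using x by (simp add: pos_le_divide_eq)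
  qed
  \<comment> \<open>The resolvent identity, which makes \<open>R\<close> Lipschitz on the unit
    interval.\<close>
  have R_diff: "R t - R s = (t - s) *\<^sub>R (R t * x * R s)" if "t \<in> {0..1}" "s \<in> {0..1}" for s t
  proof -
    have "R t - R s = R t * ((1 - s *\<^sub>R x) * R s) - (R t * (1 - t *\<^sub>R x)) * R s"
      using that by (simp add: inv1 inv2)
    also have "\<dots> = (t - s) *\<^sub>R (R t * x * R s)" by (simp add: algebra_simps)
    finally show ?thesis .
  qed
  have R_cont: "continuous_on {0..1} R"
  proof (rule lipschitz_on_continuous_on, rule lipschitz_onI)
    let ?c = "(1 / (1 - norm x)) * norm x * (1 / (1 - norm x))"
    show "0 \<le> ?c" using x by simp
    fix s t :: real assume st: "s \<in> {0..1}" "t \<in> {0..1}"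
    have "norm (R s * x * R t) \<le> norm (R s) * norm x * norm (R t)"
      by (meson mult_right_mono norm_ge_zero norm_mult_ineq order_trans)
    also have "\<dots> \<le> ?c" using st x by (intro mult_mono R_bound) auto
    finally show "dist (R s) (R t) \<le> ?c * dist s t"
      using st mult_left_mono[of "norm (R s * x * R t)" ?c "\<bar>s - t\<bar>"]
      by (simp add: dist_norm R_diff mult.commute)
  qed
  define F where "F t = x * R t" for t
  have F_cont: "continuous_on {0..1} F" unfolding F_def by (intro continuous_intros R_cont)
  define b where "b s = integral {0..s} F" for s
  have integ: "F integrable_on {0..s}" if "s \<in> {0..1}" for s
    by (rule integrable_continuous_real, rule continuous_on_subset[OF F_cont]) (use that in auto)
  have f_F: "f (F t) = 0"
    if f: "bounded_linear f" "\<And>n. f (x ^ Suc n) = 0" and t: "t \<in> {0..1}" for f :: "'a \<Rightarrow> 'b::real_normed_vector" and t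
  proof -
    interpret bounded_linear f by fact
    have "F t = (\<Sum>n. t ^ n *\<^sub>R x ^ Suc n)"
      unfolding F_def R_def by (subst suminf_mult[OF sm[OF t], symmetric]) simp
    moreover have "summable (\<lambda>n. t ^ n *\<^sub>R x ^ Suc n)"
      using summable_mult[OF sm[OF t], of x] by simp
    ultimately show ?thesis using f(2) by (simp add: suminf scaleR)
  qed
  \<comment> \<open>Values in a general Banach space are allowed so that \<open>f\<close> may be a
    commutator map. Applied first to commutation with \<open>x\<close> and then with
    \<open>b s\<close>, this shows that the values of \<open>b\<close> commute with each
    other.\<close>
  have f_b: "f (b s) = 0"
    if f: "bounded_linear f" "\<And>n. f (x ^ Suc n) = 0" and s: "s \<in> {0..1}"
    for f :: "'a \<Rightarrow> 'b::banach" and s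
  proof -
    have "f (b s) = integral {0..s} (f \<circ> F)"
      unfolding b_def by (rule integral_linear[OF integ[OF s] f(1), symmetric])
    also have "\<dots> = integral {0..s} (\<lambda>_. 0)"
      by (rule integral_cong) (use f_F[OF f] s in auto)
    finally show ?thesis by simp
  qed
  have b_neg: "b s = 0" if "s < 0" for s using that by (simp add: b_def)
  have comm_lin: "bounded_linear (\<lambda>y::'a. y * c - c * y)" for c
    by (intro bounded_linear_sub bounded_linear_mult_left bounded_linear_mult_right)
  have bx: "b s * x = x * b s" if "s \<in> {0..1}" for s
    using f_b[OF comm_lin[of x] _ that] by (simp add: power_commutes mult.assoc)
  have bxn: "x ^ n * b s = b s * x ^ n" if "s \<in> {0..1}" for s n
    using power_commuting_commutes[OF bx[OF that, symmetric]] by simp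
  have bb: "b r * b s = b s * b r" if "s \<in> {0..1}" "r \<in> {0..1}" for s r
    using f_b[OF comm_lin[of "b s"] _ that(2)] bxn[OF that(1)] by (simp del: power_Suc)
  \<comment> \<open>This product is shown to be constant on the unit interval. The
    \<open>min 1 s\<close> freezes \<open>b\<close> beyond 1, because the rule for differentiating
    exp asks for commutation at every real parameter; for negative parameters \<open>b\<close> is
    0.\<close>
  define g where "g s = exp (b (min 1 s)) * (1 - s *\<^sub>R x)" for s
  have g': "(g has_vector_derivative 0) (at s within {0..1})" if s: "s \<in> {0..1}" for s
  proof -
    have "(b has_vector_derivative F s) (at s within {0..1})"
      unfolding b_def by (rule integral_has_vector_derivative[OF F_cont s])
    then have "((\<lambda>s. b (min 1 s)) has_vector_derivative F s) (at s within {0..1})"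
      by (rule has_vector_derivative_transform[rotated 2]) (use s in auto)
    then have 1: "((\<lambda>s. exp (b (min 1 s))) has_vector_derivative exp (b (min 1 s)) * F s) (at s within {0..1})"
    proof (rule has_vector_derivative_exp_commuting)
      show "b (min 1 r) * b (min 1 s) = b (min 1 s) * b (min 1 r)" for r
        using bb[of "min 1 s" "min 1 r"] s b_neg[of "min 1 r"] by (cases "r < 0") auto
    qed
    have 2: "((\<lambda>s. 1 - s *\<^sub>R x) has_vector_derivative - x) (at s within {0..1})"
      by (auto intro!: derivative_eq_intros)
    have "exp (b (min 1 s)) * - x + exp (b (min 1 s)) * F s * (1 - s *\<^sub>R x) = 0"
      using inv2[OF s] by (simp add: F_def mult.assoc)
    then show ?thesis
      unfolding g_def using has_vector_derivative_mult[OF 1 2] by simp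
  qed
  have "g 1 = g 0"
    using has_vector_derivative_zero_constant[of "{0..1}" g] g' by (metis atLeastAtMost_iff convex_real_interval(5) order_refl zero_le_one)
  then have "exp (b 1) * (1 - x) = 1" by (simp add: g_def b_def)
  then have "exp (- b 1) * (exp (b 1) * (1 - x)) = exp (- b 1)" by simp
  \<comment> \<open>Within this proof \<open>b 1\<close> is the integral with positive sign, so the
    logarithm is its negative.\<close>
  then have e: "exp (- b 1) = 1 - x" by (simp add: mult.assoc[symmetric] exp_add_commuting[symmetric])
  show ?thesis
  proof (rule that[OF e])
    fix f :: "'a \<Rightarrow> complex" assume "bounded_linear f" "\<And>n. f (x ^ Suc n) = 0"
    then show "f (- b 1) = 0" using f_b[of f 1] by (simp add: bounded_linear.linear linear_neg)
  qed
qed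

text \<open>Gronwall by iteration: compactness gives a crude bound \<open>B\<close> on the
  difference, and each integration of the derivative bound improves the error to the next term B (M
  t)^n / n!, which tends to 0. Tracking the distance from \<open>U 0\<close> instead of the norm of
  \<open>U\<close> produces the -1.\<close>

lemma norm_diff_le_of_derivative_bound:
  fixes U :: "real \<Rightarrow> 'a::real_normed_vector"
  assumes U: "\<And>t. (U has_vector_derivative V t) (at t)"
    and V: "\<And>t. 0 \<le> t \<Longrightarrow> t \<le> T \<Longrightarrow> norm (V t) \<le> M * norm (U t)"
    and M: "0 \<le> M" and T: "0 \<le> T"
  shows "norm (U T - U 0) \<le> norm (U 0) * (exp (M * T) - 1)"
proof -
  have cont: "continuous_on S U" for S
    by (intro continuous_at_imp_continuous_on ballI has_vector_derivative_continuous[OF U])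
  have "bounded ((\<lambda>t. norm (U t - U 0)) ` {0..T})"
    by (intro compact_imp_bounded compact_continuous_image continuous_intros cont compact_Icc)
  then obtain B where "\<forall>r\<in>(\<lambda>t. norm (U t - U 0)) ` {0..T}. norm r \<le> B"
    unfolding bounded_iff by blast
  then have B: "norm (U t - U 0) \<le> B" if "0 \<le> t" "t \<le> T" for t
    using that by simp
  have B0: "0 \<le> B" using B[of 0] T by simp
  have iter: "norm (U t - U 0) \<le> norm (U 0) * (exp (M * t) - 1) + B * (M * t) ^ n / fact n"
    if "0 \<le> t" "t \<le> T" for n t
    using that
  proof (induction n arbitrary: t)
    case 0
    have "0 \<le> norm (U 0) * (exp (M * t) - 1)" using M 0 by simp
    then show ?case using B[of t] 0 by (simp add: add_increasing)
  next
    case (Suc n)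
    show ?case
    proof (cases "t = 0")
      case False
      \<comment> \<open>An antiderivative, vanishing at 0, of M times the bound for norm (U s) that
        the induction hypothesis provides.\<close>
      let ?\<phi> = "\<lambda>t. norm (U 0) * (exp (M * t) - 1) + B * (M * t) ^ Suc n / fact (Suc n)"
      let ?\<phi>' = "\<lambda>t. M * (norm (U 0) * exp (M * t) + B * (M * t) ^ n / fact n)"
      have "norm (U t - U 0) \<le> ?\<phi> t - ?\<phi> 0"
      proof (rule differentiable_bound_general[where f' = V and \<phi>' = ?\<phi>'])
        show "0 < t" using False Suc.prems by simp
        show "continuous_on {0..t} U" by (rule cont)
        show "continuous_on {0..t} ?\<phi>" by (intro continuous_intros) auto
        show "(U has_vector_derivative V s) (at s)" for s by (rule U)
        show "(?\<phi> has_vector_derivative ?\<phi>' s) (at s)" for s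
        proof -
          have "((\<lambda>t. (M * t) ^ Suc n) has_real_derivative real (Suc n) * (M * (M * s) ^ n)) (at s)"
            using DERIV_power[OF DERIV_cmult_Id[of M s UNIV], of "Suc n"] by simp
          then have d1: "((\<lambda>t. B * (M * t) ^ Suc n / fact (Suc n)) has_real_derivative
              B * (real (Suc n) * (M * (M * s) ^ n)) / fact (Suc n)) (at s)"
            by (intro DERIV_cdivide DERIV_cmult)
          have d2: "((\<lambda>t. norm (U 0) * (exp (M * t) - 1)) has_real_derivative
              norm (U 0) * (exp (M * s) * M)) (at s)"
            by (auto intro!: derivative_eq_intros)
          have eq: "norm (U 0) * (exp (M * s) * M) + B * (real (Suc n) * (M * (M * s) ^ n)) / fact (Suc n) = ?\<phi>' s"
            unfolding fact_Suc by (simp add: distrib_left del: of_nat_Suc)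
          show ?thesis
            using DERIV_add[OF d2 d1] unfolding eq has_real_derivative_iff_has_vector_derivative .
        qed
        fix s assume s: "0 < s" "s < t"
        have "norm (V s) \<le> M * norm (U s)" using V s Suc.prems by auto
        also have "norm (U s) \<le> norm (U 0) + norm (U s - U 0)"
          using norm_triangle_ineq[of "U 0" "U s - U 0"] by simp
        also have "\<dots> \<le> norm (U 0) * exp (M * s) + B * (M * s) ^ n / fact n"
          using Suc.IH[of s] s Suc.prems by (simp add: algebra_simps)
        finally show "norm (V s) \<le> ?\<phi>' s" using M by (simp add: mult_left_mono)
      qed
      then show ?thesis by simp
    qed simp
  qed
  have "(\<lambda>n. norm (U 0) * (exp (M * T) - 1) + B * ((M * T) ^ n / fact n))
      \<longlonglongrightarrow> norm (U 0) * (exp (M * T) - 1) + B * 0"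
    using summable_LIMSEQ_zero[OF summable_exp[of "M * T"]]
    by (intro tendsto_add tendsto_mult tendsto_const) (simp add: divide_inverse mult.commute)
  then have "norm (U T - U 0) \<le> norm (U 0) * (exp (M * T) - 1) + B * 0"
    by (rule LIMSEQ_le_const) (use iter[OF T order_refl] in \<open>simp add: exI[of _ 0]\<close>)
  then show ?thesis by simp
qed

text \<open>The sign is the one for which the expansion of exp(-G) w exp(G) has only positive
  coefficients.\<close>

definition commutator :: "'a::ring_1 \<Rightarrow> 'a \<Rightarrow> 'a" where
  "commutator G w = w * G - G * w"

text \<open>The Cauchy product of the two exponential series has coefficients with (n + 1) c (n + 1)
  = commutator G (c n). Writing n + 1 as i + (n + 1 - i), each part lowers one factorial and
  releases a factor -G on the left or G on the right.\<close>

lemma exp_conjugation_sums: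
  fixes G W :: "'a::{real_normed_algebra_1,banach}"
  shows "(\<lambda>n. inverse (fact n) *\<^sub>R (commutator G ^^ n) W) sums (exp (- G) * W * exp G)"
proof -
  define S where "S x n = x ^ n /\<^sub>R fact n" for x :: 'a and n
  have S_Suc: "real (Suc n) *\<^sub>R S x (Suc n) = x * S x n" for x n
    by (simp add: S_def del: of_nat_Suc)
  have S_Suc': "real (Suc n) *\<^sub>R S x (Suc n) = S x n * x" for x n
    by (simp add: S_def power_commutes del: of_nat_Suc)
  define c where "c n = (\<Sum>i\<le>n. (S (- G) i * W) * S G (n - i))" for n
  have step: "real (Suc n) *\<^sub>R c (Suc n) = commutator G (c n)" for n
  proof -
    let ?t = "\<lambda>i. (S (- G) i * W) * S G (Suc n - i)"
    have "real (Suc n) *\<^sub>R c (Suc n)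
        = (\<Sum>i\<le>Suc n. real i *\<^sub>R ?t i) + (\<Sum>i\<le>Suc n. real (Suc n - i) *\<^sub>R ?t i)"
      unfolding c_def scaleR_sum_right sum.distrib[symmetric]
      by (rule sum.cong) (auto simp: scaleR_left_distrib[symmetric])
    also have "(\<Sum>i\<le>Suc n. real i *\<^sub>R ?t i) = (\<Sum>i\<le>n. real (Suc i) *\<^sub>R ?t (Suc i))"
      by (subst sum.atMost_Suc_shift) simp
    also have "\<dots> = - G * c n"
      unfolding c_def sum_distrib_left
    proof (rule sum.cong)
      fix i
      have "real (Suc i) *\<^sub>R ?t (Suc i) = (real (Suc i) *\<^sub>R S (- G) (Suc i)) * W * S G (n - i)"
        by simp
      then show "real (Suc i) *\<^sub>R ?t (Suc i) = - G * (S (- G) i * W * S G (n - i))"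
        unfolding S_Suc by (simp add: mult.assoc)
    qed simp
    also have "(\<Sum>i\<le>Suc n. real (Suc n - i) *\<^sub>R ?t i) = (\<Sum>i\<le>n. real (Suc n - i) *\<^sub>R ?t i)"
      by simp
    also have "\<dots> = c n * G"
      unfolding c_def sum_distrib_right
    proof (rule sum.cong)
      fix i assume "i \<in> {..n}"
      then have i: "Suc n - i = Suc (n - i)" by auto
      have "real (Suc n - i) *\<^sub>R ?t i = S (- G) i * W * (real (Suc (n - i)) *\<^sub>R S G (Suc (n - i)))"
        by (simp add: i)
      then show "real (Suc n - i) *\<^sub>R ?t i = S (- G) i * W * S G (n - i) * G"
        unfolding S_Suc' by (simp add: mult.assoc)
    qed simp
    finally show ?thesis by (simp add: commutator_def)
  qed
  have c_eq: "c n = inverse (fact n) *\<^sub>R (commutator G ^^ n) W" for n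
  proof (induction n)
    case 0
    show ?case by (simp add: c_def S_def)
  next
    case (Suc n)
    have lin: "commutator G (r *\<^sub>R w) = r *\<^sub>R commutator G w" for r w
      by (simp add: commutator_def algebra_simps)
    have "c (Suc n) = inverse (real (Suc n)) *\<^sub>R (real (Suc n) *\<^sub>R c (Suc n))" by (simp del: of_nat_Suc)
    then show ?case unfolding step Suc.IH by (simp add: lin mult.commute del: of_nat_Suc)
  qed
  have sn: "summable (\<lambda>n. norm (S x n))" for x
    unfolding S_def using summable_norm_exp[of x] by simp
  have "summable (\<lambda>n. norm (S (- G) n * W))"
  proof (rule summable_comparison_test')
    show "summable (\<lambda>n. norm (S (- G) n) * norm W)" by (rule summable_mult2[OF sn])
    show "norm (norm (S (- G) n * W)) \<le> norm (S (- G) n) * norm W" if "0 \<le> n" for n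
      using norm_mult_ineq by simp
  qed
  from Cauchy_product_sums[OF this sn]
  have "c sums ((\<Sum>n. S (- G) n * W) * (\<Sum>n. S G n))" unfolding c_def .
  also have "(\<Sum>n. S (- G) n * W) = exp (- G) * W"
    using suminf_mult2[OF summable_norm_cancel[OF sn], of "- G" W] by (simp add: exp_def S_def)
  finally show ?thesis unfolding c_eq exp_def S_def by (simp add: divide_inverse)
qed

section \<open>Self-adjoint logarithms\<close>

definition op_adj :: "'v qop \<Rightarrow> 'v qop" where
  "op_adj Q = (\<lambda>\<sigma> \<tau>. cnj (Q \<tau> \<sigma>))"

lemma selfadj_iff: "selfadj D X Q \<longleftrightarrow> is_op D X Q \<and> op_adj Q = Q"
  unfolding selfadj_def op_adj_def fun_eq_iff by (rule conj_cong[OF refl]) (blast intro: sym)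

lemma selfadj_entry: "selfadj D X Q \<Longrightarrow> cnj (Q \<tau> \<sigma>) = Q \<sigma> \<tau>"
  unfolding selfadj_iff op_adj_def fun_eq_iff by blast

lemma selfadjI: "is_op D X Q \<Longrightarrow> (\<And>\<sigma> \<tau>. cnj (Q \<tau> \<sigma>) = Q \<sigma> \<tau>) \<Longrightarrow> selfadj D X Q"
  unfolding selfadj_iff op_adj_def fun_eq_iff by blast

lemma op_adj_mult: "op_adj (op_mult D X P Q) = op_mult D X (op_adj Q) (op_adj P)"
  by (simp add: op_adj_def op_mult_def cnj_sum mult.commute)

lemma selfadj_id [simp]: "selfadj D X (op_id D X)"
  by (auto simp: selfadj_def op_id_def is_op_def)

lemma selfadj_add: "selfadj D X P \<Longrightarrow> selfadj D X Q \<Longrightarrow> selfadj D X (op_add P Q)"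
  by (auto simp: selfadj_iff op_adj_def op_add_def is_op_def fun_eq_iff)

lemma selfadj_diff: "selfadj D X P \<Longrightarrow> selfadj D X Q \<Longrightarrow> selfadj D X (op_diff P Q)"
  by (auto simp: selfadj_iff op_adj_def op_diff_def is_op_def fun_eq_iff)

lemma selfadj_scale: "selfadj D X Q \<Longrightarrow> selfadj D X (op_scale (of_real r) Q)"
  by (auto simp: selfadj_iff op_adj_def op_scale_def is_op_def fun_eq_iff)

lemma selfadj_sum: "(\<And>s. s \<in> S \<Longrightarrow> selfadj D X (F s)) \<Longrightarrow> selfadj D X (op_sum F S)"
proof (rule selfadjI)
  assume F: "\<And>s. s \<in> S \<Longrightarrow> selfadj D X (F s)"
  show "is_op D X (op_sum F S)" by (rule is_op_sum) (use F in \<open>simp add: selfadj_iff\<close>)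
  show "cnj (op_sum F S \<tau> \<sigma>) = op_sum F S \<sigma> \<tau>" for \<sigma> \<tau>
    unfolding op_sum_def cnj_sum by (rule sum.cong[OF refl]) (rule selfadj_entry[OF F])
qed

lemma op_adj_emb: "op_adj (emb D X Y Q) = emb D X Y (op_adj Q)"
proof (intro ext)
  fix \<sigma> \<tau> :: "'a \<Rightarrow> nat"
  have "(\<forall>v\<in>Y - X. \<tau> v = \<sigma> v) \<longleftrightarrow> (\<forall>v\<in>Y - X. \<sigma> v = \<tau> v)" by metis
  then show "op_adj (emb D X Y Q) \<sigma> \<tau> = emb D X Y (op_adj Q) \<sigma> \<tau>"
    unfolding op_adj_def emb_def by (simp only: conj_ac if_distrib[of cnj] complex_cnj_zero)
qed

lemma op_adj_ptr: "op_adj (ptr D Y X Q) = ptr D Y X (op_adj Q)"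
  by (intro ext) (simp add: op_adj_def ptr_def cnj_sum conj_commute)

lemma selfadj_emb: "selfadj D X Q \<Longrightarrow> selfadj D Y (emb D X Y Q)"
  by (simp add: selfadj_iff op_adj_emb)

lemma selfadj_ptr: "selfadj D Y Q \<Longrightarrow> selfadj D X (ptr D Y X Q)"
  by (simp add: selfadj_iff op_adj_ptr)

lemma selfadj_cond_exp: "selfadj D \<Lambda> Q \<Longrightarrow> selfadj D \<Lambda> (cond_exp D \<Lambda> L Q)"
  using selfadj_scale[of D \<Lambda> "emb D (\<Lambda> \<inter> L) \<Lambda> (ptr D \<Lambda> (\<Lambda> \<inter> L) Q)" "1 / of_nat (D ^ card (\<Lambda> - L))"]
  by (simp add: cond_exp_def selfadj_emb selfadj_ptr)

lemma selfadj_hamiltonian: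
  assumes "local_interaction D \<Phi>" "finite \<Lambda>"
  shows "selfadj D \<Lambda> (hamiltonian D \<Phi> \<Lambda>)"
  unfolding hamiltonian_def
  by (rule selfadj_sum, rule selfadj_emb)
     (use assms finite_subset[of _ \<Lambda>] in \<open>simp add: local_interaction_def\<close>)

lemma op_pow_commute:
  assumes "finite X" "is_op D X Q"
  shows "op_mult D X (op_pow D X Q n) Q = op_mult D X Q (op_pow D X Q n)"
  by (induction n) (simp_all add: assms op_mult_id_left op_mult_id_right op_mult_assoc)

lemma selfadj_pow:
  assumes "finite X" "selfadj D X Q"
  shows "selfadj D X (op_pow D X Q n)"
proof (induction n)
  case (Suc n)
  have Q: "is_op D X Q" "op_adj Q = Q" using assms by (auto simp: selfadj_iff)
  show ?case
    using Suc Q unfolding selfadj_iff by (simp add: op_adj_mult op_pow_commute[OF assms(1) Q(1)])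
qed simp

text \<open>The \<open>suminf\<close> in \<open>op_exp\<close> carries no convergence by itself; it
  is inherited from the Banach algebra exponential.\<close>

lemma op_exp_sums:
  assumes "0 < D" "finite X" "is_op D X Q"
  shows "(\<lambda>n. op_pow D X Q n \<sigma> \<tau> / of_nat (fact n)) sums op_exp D X Q \<sigma> \<tau>"
proof -
  let ?T = "single D X Q"
  have "(\<lambda>n. component (?T ^ n /\<^sub>R fact n) D X \<sigma> \<tau>) sums component (exp ?T) D X \<sigma> \<tau>"
    by (rule bounded_linear.sums[OF bounded_linear_entry]) (rule exp_converges)
  then show ?thesis
    by (simp add: component_exp[OF assms(1,2)] component_scaleR component_power[OF assms(1,2)]
        component_single[OF assms] op_scale_def divide_inverse mult.commute of_real_inverse)
qed

lemma selfadj_exp: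
  assumes "0 < D" "finite X" "selfadj D X Q"
  shows "selfadj D X (op_exp D X Q)"
proof -
  have Q: "is_op D X Q" using assms by (simp add: selfadj_iff)
  have "op_exp D X Q \<sigma> \<tau> = cnj (op_exp D X Q \<tau> \<sigma>)" for \<sigma> \<tau>
  proof (rule sums_unique2[OF op_exp_sums[OF assms(1,2) Q]])
    show "(\<lambda>n. op_pow D X Q n \<sigma> \<tau> / of_nat (fact n)) sums cnj (op_exp D X Q \<tau> \<sigma>)"
      using sums_cnj[THEN iffD2, OF op_exp_sums[OF assms(1,2) Q, of \<tau> \<sigma>]]
      by (simp add: selfadj_entry[OF selfadj_pow[OF assms(2,3)]])
  qed
  note herm = this
  show ?thesis by (rule selfadjI[OF is_op_exp[OF Q] herm[symmetric]])
qed

lemma op_exp_scale_component: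
  assumes "0 < D" "finite X" "is_op D X Q"
  shows "op_exp D X (op_scale (of_real r) Q) = component (exp (r *\<^sub>R single D X Q)) D X"
  unfolding component_exp[OF assms(1,2)] component_scaleR component_single[OF assms] ..

lemma op_exp_scale_add:
  assumes "0 < D" "finite X" "is_op D X Q"
  shows "op_mult D X (op_exp D X (op_scale (of_real r) Q)) (op_exp D X (op_scale (of_real s) Q))
    = op_exp D X (op_scale (of_real (r + s)) Q)"
proof -
  have "exp (r *\<^sub>R single D X Q) * exp (s *\<^sub>R single D X Q) = exp ((r + s) *\<^sub>R single D X Q)"
    unfolding scaleR_left_distrib by (rule exp_add_commuting[symmetric]) simp
  then show ?thesis
    unfolding op_exp_scale_component[OF assms] component_mult[symmetric] by (rule arg_cong)
qed

lemma op_exp_scale_zero: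
  assumes "0 < D" "finite X" "is_op D X Q"
  shows "op_exp D X (op_scale (of_real 0) Q) = op_id D X"
  unfolding op_exp_scale_component[OF assms] by (simp add: component_one[OF assms(1,2)])

lemma sum_cnj_selfadj:
  assumes "op_adj S = S"
  shows "(\<Sum>\<sigma>\<in>conf D X. cnj (\<psi> \<sigma>) * op_apply D X S \<phi> \<sigma>) = (\<Sum>\<sigma>\<in>conf D X. cnj (op_apply D X S \<psi> \<sigma>) * \<phi> \<sigma>)"
proof -
  have S: "S \<sigma> \<tau> = cnj (S \<tau> \<sigma>)" for \<sigma> \<tau> using fun_cong[OF fun_cong[OF assms], of \<sigma> \<tau>] by (simp add: op_adj_def)
  have "(\<Sum>\<sigma>\<in>conf D X. cnj (\<psi> \<sigma>) * op_apply D X S \<phi> \<sigma>)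
      = (\<Sum>\<sigma>\<in>conf D X. \<Sum>\<tau>\<in>conf D X. cnj (\<psi> \<sigma>) * (S \<sigma> \<tau> * \<phi> \<tau>))"
    by (simp add: op_apply_def sum_distrib_left)
  also have "\<dots> = (\<Sum>\<tau>\<in>conf D X. \<Sum>\<sigma>\<in>conf D X. cnj (\<psi> \<sigma>) * (S \<sigma> \<tau> * \<phi> \<tau>))" by (rule sum.swap)
  also have "\<dots> = (\<Sum>\<tau>\<in>conf D X. \<Sum>\<sigma>\<in>conf D X. cnj (S \<tau> \<sigma> * \<psi> \<sigma>) * \<phi> \<tau>)"
  proof (intro sum.cong refl)
    show "cnj (\<psi> \<sigma>) * (S \<sigma> \<tau> * \<phi> \<tau>) = cnj (S \<tau> \<sigma> * \<psi> \<sigma>) * \<phi> \<tau>" for \<sigma> \<tau>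
      by (subst S) simp
  qed
  also have "\<dots> = (\<Sum>\<sigma>\<in>conf D X. cnj (op_apply D X S \<psi> \<sigma>) * \<phi> \<sigma>)"
    by (simp only: op_apply_def cnj_sum sum_distrib_right)
  finally show ?thesis .
qed

lemma vnorm_diff_scale_power2:
  "(vnorm D X (\<lambda>\<sigma>. \<psi> \<sigma> - of_real c * \<phi> \<sigma>))\<^sup>2
    = (vnorm D X \<psi>)\<^sup>2 - 2 * c * Re (\<Sum>\<sigma>\<in>conf D X. cnj (\<psi> \<sigma>) * \<phi> \<sigma>) + c\<^sup>2 * (vnorm D X \<phi>)\<^sup>2"
proof -
  have key: "(cmod (x - of_real c * y))\<^sup>2 = (cmod x)\<^sup>2 - 2 * c * Re (cnj x * y) + c\<^sup>2 * (cmod y)\<^sup>2" for x y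
    unfolding cmod_power2 by (simp add: power2_eq_square algebra_simps)
  show ?thesis
    by (simp only: vnorm_power2 key sum.distrib sum_subtractf Re_sum sum_distrib_left)
qed

text \<open>
  With $S = e^{B/2}$ one has $\langle v, e^B v \rangle = \|S v\|^2$ and $\|e^B v\| \le \|S\| \, \|S v\|$, so
  $c = \|S\|^{-2}$ works.
\<close>

lemma op_norm_id_minus_exp_lt_one:
  assumes "0 < D" "finite X" "selfadj D X B"
  obtains c where "0 < c" "op_norm D X (op_diff (op_id D X) (op_scale (of_real c) (op_exp D X B))) < 1"
proof -
  have B: "is_op D X B" using assms by (simp add: selfadj_iff)
  define S where "S = op_exp D X (op_scale (of_real (1/2)) B)"
  define S' where "S' = op_exp D X (op_scale (of_real (-1/2)) B)"
  have adj: "op_adj S = S"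
    using selfadj_exp[OF assms(1,2) selfadj_scale[OF assms(3)]] unfolding S_def selfadj_iff by blast
  have SS: "op_mult D X S S = op_exp D X B"
    unfolding S_def op_exp_scale_add[OF assms(1,2) B] by (simp add: op_scale_def)
  have S'S: "op_mult D X S' S = op_id D X"
    unfolding S_def S'_def op_exp_scale_add[OF assms(1,2) B] using op_exp_scale_zero[OF assms(1,2) B] by simp
  define s r where "s = op_norm D X S" and "r = op_norm D X S'"
  have "1 \<le> r * s"
    using op_norm_mult[OF assms(2), of D S' S] op_norm_id[OF assms(2,1)] by (simp add: S'S r_def s_def)
  moreover have "0 \<le> s" "0 \<le> r" using op_norm_nonneg[OF assms(2)] by (simp_all add: s_def r_def)
  ultimately have pos: "0 < s" "0 < r" and rs: "1 \<le> r * s"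
    by (auto simp: less_le)
  define c where "c = 1 / s\<^sup>2"
  have c: "0 < c" "c * s\<^sup>2 = 1" using pos by (simp_all add: c_def)
  \<comment> \<open>With w = S S \<psi>, ||\<psi> - c w||^2 is at most ||\<psi>||^2 - c ||S
    \<psi>||^2 by the choice of \<open>c\<close>. As \<open>S'\<close> inverts \<open>S\<close>,
    ||\<psi>|| is at most r ||S \<psi>||, and \<open>q\<close> remains.\<close>
  define q where "q = 1 - c / r\<^sup>2"
  have "c / r\<^sup>2 \<le> 1"
  proof -
    have "1 \<le> (r * s)\<^sup>2" using rs by simp
    then show ?thesis using pos by (simp add: c_def power_mult_distrib divide_le_eq mult.commute)
  qed
  then have q: "0 \<le> q" "q < 1" using c pos by (simp_all add: q_def)
  have "op_norm D X (op_diff (op_id D X) (op_scale (of_real c) (op_exp D X B))) \<le> sqrt q"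
  proof (rule op_norm_leI)
    fix \<psi>
    let ?\<phi> = "op_apply D X S \<psi>"
    let ?w = "op_apply D X S ?\<phi>"
    have "vnorm D X (op_apply D X (op_diff (op_id D X) (op_scale (of_real c) (op_exp D X B))) \<psi>)
        = vnorm D X (\<lambda>\<sigma>. \<psi> \<sigma> - of_real c * ?w \<sigma>)"
    proof (rule vnorm_cong)
      fix \<sigma> assume \<sigma>: "\<sigma> \<in> conf D X"
      have "op_apply D X (op_diff (op_id D X) (op_scale (of_real c) (op_exp D X B))) \<psi> \<sigma>
        = op_apply D X (op_id D X) \<psi> \<sigma> - of_real c * op_apply D X (op_exp D X B) \<psi> \<sigma>"
        by (simp add: op_apply_def op_diff_def op_scale_def sum_subtractf algebra_simps sum_distrib_left)
      then show "op_apply D X (op_diff (op_id D X) (op_scale (of_real c) (op_exp D X B))) \<psi> \<sigma> = \<psi> \<sigma> - of_real c * ?w \<sigma>"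
        by (simp add: op_apply_id[OF assms(2) \<sigma>] SS[symmetric] op_apply_mult)
    qed
    also have "(vnorm D X (\<lambda>\<sigma>. \<psi> \<sigma> - of_real c * ?w \<sigma>))\<^sup>2 \<le> q * (vnorm D X \<psi>)\<^sup>2"
    proof -
      have "Re (\<Sum>\<sigma>\<in>conf D X. cnj (\<psi> \<sigma>) * ?w \<sigma>) = (vnorm D X ?\<phi>)\<^sup>2"
      proof -
        have "Re (cnj z * z) = (cmod z)\<^sup>2" for z 
          unfolding cmod_power2 by (simp add: power2_eq_square)
        then show ?thesis
          unfolding sum_cnj_selfadj[OF adj, of \<psi> D X ?\<phi>] Re_sum by (simp only: vnorm_power2)
      qed
      moreover have "c\<^sup>2 * (vnorm D X ?w)\<^sup>2 \<le> c * (vnorm D X ?\<phi>)\<^sup>2"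
      proof -
        have "(vnorm D X ?w)\<^sup>2 \<le> s\<^sup>2 * (vnorm D X ?\<phi>)\<^sup>2"
          using power_mono[OF vnorm_op_apply[OF assms(2), of D S ?\<phi>], of 2] by (simp add: s_def power_mult_distrib)
        then have "c\<^sup>2 * (vnorm D X ?w)\<^sup>2 \<le> c\<^sup>2 * (s\<^sup>2 * (vnorm D X ?\<phi>)\<^sup>2)"
          by (rule mult_left_mono) simp
        also have "\<dots> = c * (c * s\<^sup>2) * (vnorm D X ?\<phi>)\<^sup>2"
          by (simp only: power2_eq_square[of c] mult.assoc)
        finally show ?thesis unfolding c(2) by simp
      qed
      moreover have "c * ((vnorm D X \<psi>)\<^sup>2 / r\<^sup>2) \<le> c * (vnorm D X ?\<phi>)\<^sup>2"
      proof -
        have "vnorm D X \<psi> = vnorm D X (op_apply D X S' ?\<phi>)"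
          unfolding op_apply_mult[symmetric] S'S
          by (rule vnorm_cong) (simp add: op_apply_id[OF assms(2)])
        also have "\<dots> \<le> r * vnorm D X ?\<phi>" unfolding r_def by (rule vnorm_op_apply[OF assms(2)])
        finally have "(vnorm D X \<psi>)\<^sup>2 \<le> r\<^sup>2 * (vnorm D X ?\<phi>)\<^sup>2"
          using power_mono[of "vnorm D X \<psi>" "r * vnorm D X ?\<phi>" 2] by (simp add: power_mult_distrib)
        then show ?thesis using pos c by (intro mult_left_mono) (auto simp: divide_le_eq mult.commute)
      qed
      ultimately show ?thesis
        unfolding vnorm_diff_scale_power2 q_def by (simp add: algebra_simps)
    qed
    then have "vnorm D X (\<lambda>\<sigma>. \<psi> \<sigma> - of_real c * ?w \<sigma>) \<le> sqrt (q * (vnorm D X \<psi>)\<^sup>2)"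
      by (rule real_le_rsqrt)
    finally show "vnorm D X (op_apply D X (op_diff (op_id D X) (op_scale (of_real c) (op_exp D X B))) \<psi>) \<le> sqrt q * vnorm D X \<psi>"
      by (simp add: real_sqrt_mult)
  qed (use q in simp)
  also have "sqrt q < 1" using q by simp
  finally show ?thesis by (rule that[OF c(1)])
qed

text \<open>Writing Q as (1 - P) / c, take a logarithm of 1 - P and subtract ln c. The difference
  between an entry and its conjugate transpose is a real linear functional that kills all powers of
  the self-adjoint \<open>P\<close>, hence also the logarithm.\<close>

lemma exists_selfadj_log:
  assumes D: "0 < D" "finite X" and Q: "selfadj D X Q" and c: "0 < c"
    and small: "op_norm D X (op_diff (op_id D X) (op_scale (of_real c) Q)) < 1"
  obtains B where "selfadj D X B" "op_exp D X B = Q"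
proof -
  define P where "P = op_diff (op_id D X) (op_scale (of_real c) Q)"
  have P: "selfadj D X P" unfolding P_def by (intro selfadj_diff selfadj_scale selfadj_id Q)
  have Pop: "is_op D X P" using P by (simp add: selfadj_iff)
  define x where "x = single D X P"
  have "norm x = op_norm D X P" unfolding x_def by (rule norm_single[OF D Pop])
  then have "norm x < 1" using small by (simp add: P_def)
  then obtain b where b: "exp b = 1 - x"
    "\<And>f :: 'a opfam \<Rightarrow> complex. bounded_linear f \<Longrightarrow> (\<And>n. f (x ^ Suc n) = 0) \<Longrightarrow> f b = 0"
    by (rule exists_exp_eq_one_minus) blast
  define b' where "b' = b + of_real (- ln c)"
  have comp_x: "component x D X = P" unfolding x_def by (rule component_single[OF D Pop])
  have "selfadj D X (component b D X)"
  proof (rule selfadjI[OF is_op_component])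
    fix \<sigma> \<tau>
    let ?f = "\<lambda>T. component T D X \<sigma> \<tau> - cnj (component T D X \<tau> \<sigma>)"
    have "?f b = 0"
    proof (rule b(2))
      show "bounded_linear ?f"
        by (intro bounded_linear_sub bounded_linear_entry bounded_linear_compose[OF bounded_linear_cnj])
      show "?f (x ^ Suc n) = 0" for n
        unfolding component_power[OF D] comp_x selfadj_entry[OF selfadj_pow[OF D(2) P]] by (rule diff_self)
    qed
    then show "cnj (component b D X \<tau> \<sigma>) = component b D X \<sigma> \<tau>" by simp
  qed
  moreover have comp_b': "component b' D X = op_add (component b D X) (op_scale (of_real (- ln c)) (op_id D X))"
    unfolding b'_def of_real_def component_add component_scaleR component_one[OF D] ..
  ultimately have "selfadj D X (component b' D X)"
    by (simp only: selfadj_add selfadj_scale selfadj_id)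
  moreover have "op_exp D X (component b' D X) = Q"
  proof -
    have "exp b' = exp b * exp (of_real (- ln c))"
      unfolding b'_def by (rule exp_add_commuting) (simp add: of_real_def)
    also have "\<dots> = (1 / c) *\<^sub>R (1 - x)"
      using c unfolding b(1) exp_of_real by (simp add: of_real_def exp_minus divide_inverse)
    finally have "component (exp b') D X = op_scale (of_real (1 / c)) (op_diff (op_id D X) P)"
      by (simp only: component_scaleR component_minus component_one[OF D] comp_x)
    also have "\<dots> = Q" using c by (simp add: op_scale_def op_diff_def P_def)
    finally show ?thesis by (simp add: component_exp[OF D])
  qed
  ultimately show ?thesis by (rule that)
qed

section \<open>Uniqueness of self-adjoint logarithms\<close>

lemma op_trace_mult_commute: "op_trace D X (op_mult D X P Q) = op_trace D X (op_mult D X Q P)"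
  unfolding op_trace_def op_mult_def by (subst sum.swap) (simp add: mult.commute)

lemma op_trace_adj_mult:
  "op_trace D X (op_mult D X (op_adj M) M) = of_real (\<Sum>\<sigma>\<in>conf D X. \<Sum>\<tau>\<in>conf D X. (cmod (M \<tau> \<sigma>))\<^sup>2)"
  unfolding op_trace_def op_mult_def op_adj_def of_real_sum
  by (intro sum.cong refl) (simp only: complex_norm_square mult.commute)

text \<open>
  With $\Delta = P - Q$ the hypothesis gives $\Delta P + Q \Delta = 0$, hence
  $\operatorname{tr}(\Delta P \Delta) + \operatorname{tr}(\Delta Q \Delta) = 0$ with both terms nonnegative.
\<close>

lemma square_root_unique:
  assumes fin: "finite X"
    and P: "P = op_mult D X P1 P1" "is_op D X P1" "op_adj P1 = P1" "op_mult D X P2 P1 = op_id D X"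
    and Q: "Q = op_mult D X Q1 Q1" "is_op D X Q1" "op_adj Q1 = Q1"
    and eq: "op_mult D X P P = op_mult D X Q Q"
  shows "P = Q"
proof -
  define \<Delta> where "\<Delta> = op_diff P Q"
  have ops: "is_op D X P" "is_op D X Q" unfolding P(1) Q(1) using P(2) Q(2) by simp_all
  then have op\<Delta>: "is_op D X \<Delta>" by (simp add: \<Delta>_def)
  have adj: "op_adj \<Delta> = \<Delta>"
  proof -
    have "op_adj P = P" "op_adj Q = Q" unfolding P(1) Q(1) op_adj_mult P(3) Q(3) by (rule refl)+
    moreover have "op_adj (op_diff P Q) = op_diff (op_adj P) (op_adj Q)"
      by (simp add: op_diff_def op_adj_def)
    ultimately show ?thesis by (simp only: \<Delta>_def)
  qed
  have diff1: "op_mult D X (op_diff R S) T = op_diff (op_mult D X R T) (op_mult D X S T)" for R S T :: "'a qop"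
    by (simp add: op_mult_def op_diff_def sum_subtractf algebra_simps)
  have diff2: "op_mult D X T (op_diff R S) = op_diff (op_mult D X T R) (op_mult D X T S)" for R S T :: "'a qop"
    by (simp add: op_mult_def op_diff_def sum_subtractf algebra_simps)
  have zero: "op_add (op_mult D X \<Delta> P) (op_mult D X Q \<Delta>) = (\<lambda>_ _. 0)"
    unfolding \<Delta>_def diff1 diff2 eq by (simp add: op_add_def op_diff_def)
  let ?hs = "\<lambda>M. \<Sum>\<sigma>\<in>conf D X. \<Sum>\<tau>\<in>conf D X. (cmod (M \<tau> \<sigma>))\<^sup>2"
  \<comment> \<open>A trace of this shape is the squared Hilbert-Schmidt norm of R \<Delta>. It is
    used with the self-adjoint roots \<open>P1\<close> and \<open>Q1\<close>.\<close>
  have hs: "op_trace D X (op_mult D X (op_mult D X \<Delta> (op_mult D X R R)) \<Delta>) = of_real (?hs (op_mult D X R \<Delta>))"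
    if "op_adj R = R" for R
    unfolding op_trace_adj_mult[symmetric] op_adj_mult adj that by (simp add: op_mult_assoc)
  have "0 = op_trace D X (op_mult D X (op_add (op_mult D X \<Delta> P) (op_mult D X Q \<Delta>)) \<Delta>)"
    unfolding zero by (simp add: op_mult_def op_trace_def)
  also have "\<dots> = op_trace D X (op_mult D X (op_mult D X \<Delta> P) \<Delta>) + op_trace D X (op_mult D X (op_mult D X Q \<Delta>) \<Delta>)"
    unfolding op_mult_add_left by (simp add: op_trace_def op_add_def sum.distrib)
  also have "op_trace D X (op_mult D X (op_mult D X Q \<Delta>) \<Delta>) = op_trace D X (op_mult D X (op_mult D X \<Delta> Q) \<Delta>)"
    by (subst op_trace_mult_commute) (simp add: op_mult_assoc)
  also have "op_trace D X (op_mult D X (op_mult D X \<Delta> P) \<Delta>) + \<dots>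
      = of_real (?hs (op_mult D X P1 \<Delta>) + ?hs (op_mult D X Q1 \<Delta>))"
    unfolding P(1) Q(1) hs[OF P(3)] hs[OF Q(3)] by simp
  finally have "complex_of_real (?hs (op_mult D X P1 \<Delta>) + ?hs (op_mult D X Q1 \<Delta>)) = 0"
    by (rule sym)
  then have "?hs (op_mult D X P1 \<Delta>) + ?hs (op_mult D X Q1 \<Delta>) = 0"
    by (simp only: of_real_eq_0_iff)
  moreover have "0 \<le> ?hs (op_mult D X P1 \<Delta>)" "0 \<le> ?hs (op_mult D X Q1 \<Delta>)"
    by (intro sum_nonneg zero_le_power2)+
  ultimately have "?hs (op_mult D X P1 \<Delta>) = 0" by linarith
  then have "op_mult D X P1 \<Delta> \<sigma> \<tau> = 0" if "\<sigma> \<in> conf D X" "\<tau> \<in> conf D X" for \<sigma> \<tau>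
    using that fin by (simp add: sum_nonneg_eq_0_iff sum_nonneg)
  then have "op_mult D X P1 \<Delta> = (\<lambda>_ _. 0)"
    by (intro qop_eqI[of D X]) (simp_all add: P(2) op\<Delta>)
  then have "op_mult D X (op_mult D X P2 P1) \<Delta> = (\<lambda>_ _. 0)"
    unfolding op_mult_assoc by (simp add: op_mult_def)
  then have "\<Delta> = (\<lambda>_ _. 0)" unfolding P(4) op_mult_id_left[OF fin op\<Delta>] .
  then show ?thesis unfolding \<Delta>_def op_diff_def fun_eq_iff by simp
qed

text \<open>Recovers \<open>b\<close> from the dyadic roots of its exponential: the error is
  quadratic in b / 2^n and is multiplied only by 2^n.\<close>

lemma tendsto_scaled_exp_minus_one:
  fixes b :: "'a::{real_normed_algebra_1,banach}"
  shows "(\<lambda>n. 2 ^ n *\<^sub>R (exp ((1 / 2 ^ n) *\<^sub>R b) - 1)) \<longlonglongrightarrow> b"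
proof (rule LIM_zero_cancel)
  obtain N :: nat where N: "norm b \<le> 2 ^ N"
    using real_arch_pow[of 2 "norm b"] less_imp_le by auto
  show "(\<lambda>n. 2 ^ n *\<^sub>R (exp ((1 / 2 ^ n) *\<^sub>R b) - 1) - b) \<longlonglongrightarrow> 0"
  proof (rule Lim_null_comparison)
    show "(\<lambda>n. (norm b)\<^sup>2 * (1 / 2) ^ n) \<longlonglongrightarrow> 0"
      by (intro tendsto_mult_right_zero LIMSEQ_power_zero) simp
    show "\<forall>\<^sub>F n in sequentially. norm (2 ^ n *\<^sub>R (exp ((1 / 2 ^ n) *\<^sub>R b) - 1) - b) \<le> (norm b)\<^sup>2 * (1 / 2) ^ n"
      unfolding eventually_sequentially
    proof (intro exI[of _ N] allI impI)
      fix n assume "N \<le> n"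
      then have n: "norm b \<le> 2 ^ n" using order_trans[OF N power_increasing[of N n "2::real"]] by simp
      define d where "d = (1 / 2 ^ n) *\<^sub>R b"
      have nd: "norm d = norm b / 2 ^ n" "norm d \<le> 1" using n by (simp_all add: d_def)
      have "2 ^ n *\<^sub>R (exp d - 1) - b = 2 ^ n *\<^sub>R (exp d - 1 - d)"
        by (simp add: d_def scaleR_diff_right)
      then have "norm (2 ^ n *\<^sub>R (exp d - 1) - b) = 2 ^ n * norm (exp d - 1 - d)" by simp
      also have "\<dots> \<le> 2 ^ n * (norm d)\<^sup>2"
        using norm_exp_minus_linear_le[of d] exp_bound[of "norm d"] nd by (intro mult_left_mono) auto
      also have "\<dots> = (norm b)\<^sup>2 * (1 / 2) ^ n"
        unfolding nd by (simp add: power2_eq_square power_one_over divide_simps)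
      finally show "norm (2 ^ n *\<^sub>R (exp ((1 / 2 ^ n) *\<^sub>R b) - 1) - b) \<le> (norm b)\<^sup>2 * (1 / 2) ^ n"
        unfolding d_def .
    qed
  qed
qed

text \<open>Equality of exponentials descends from B to B / 2 by uniqueness of positive square
  roots, hence to every B / 2^n, and the difference quotients at 0 then determine B.\<close>

lemma op_exp_selfadj_inject:
  assumes D: "0 < D" "finite X" and B: "selfadj D X B1" "selfadj D X B2"
    and eq: "op_exp D X B1 = op_exp D X B2"
  shows "B1 = B2"
proof -
  have ops: "is_op D X B1" "is_op D X B2" using B by (auto simp: selfadj_iff)
  let ?E = "\<lambda>B r. op_exp D X (op_scale (of_real r) B)"
  have add: "op_mult D X (?E B s) (?E B t) = ?E B u" if "is_op D X B" "s + t = u" for B s t u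
    unfolding that(2)[symmetric] by (rule op_exp_scale_add[OF D that(1)])
  \<comment> \<open>\<open>square_root_unique\<close> expects its operators as squares of
    self-adjoint ones, hence the exponents r / 4.\<close>
  have half: "?E B1 (r / 2) = ?E B2 (r / 2)" if r: "?E B1 r = ?E B2 r" for r
  proof (rule square_root_unique[OF D(2)])
    show "?E B1 (r / 2) = op_mult D X (?E B1 (r / 4)) (?E B1 (r / 4))"
      by (rule add[OF ops(1), symmetric]) simp
    show "?E B2 (r / 2) = op_mult D X (?E B2 (r / 4)) (?E B2 (r / 4))"
      by (rule add[OF ops(2), symmetric]) simp
    show "op_adj (?E B1 (r / 4)) = ?E B1 (r / 4)" "op_adj (?E B2 (r / 4)) = ?E B2 (r / 4)"
      using selfadj_exp[OF D selfadj_scale[OF B(1)]] selfadj_exp[OF D selfadj_scale[OF B(2)]]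
      unfolding selfadj_iff by blast+
    show "op_mult D X (?E B1 (- r / 4)) (?E B1 (r / 4)) = op_id D X"
      unfolding op_exp_scale_zero[OF D ops(1), symmetric] by (rule add[OF ops(1)]) simp
    have "op_mult D X (?E B1 (r / 2)) (?E B1 (r / 2)) = ?E B1 r" by (rule add[OF ops(1)]) simp
    also have "\<dots> = op_mult D X (?E B2 (r / 2)) (?E B2 (r / 2))"
      unfolding r by (rule add[OF ops(2), symmetric]) simp
    finally show "op_mult D X (?E B1 (r / 2)) (?E B1 (r / 2)) = op_mult D X (?E B2 (r / 2)) (?E B2 (r / 2))" .
  qed (rule is_op_exp, rule is_op_scale, rule ops)+
  have all: "?E B1 (1 / 2 ^ n) = ?E B2 (1 / 2 ^ n)" for n
  proof (induction n)
    case 0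
    then show ?case using eq by (simp add: op_scale_def)
  next
    case (Suc n)
    then show ?case using half[of "1 / 2 ^ n"] by (simp only: power_Suc2 divide_divide_eq_left)
  qed
  have lim: "(\<lambda>n. op_scale (of_real (2 ^ n)) (op_diff (?E B (1 / 2 ^ n)) (op_id D X)) \<sigma> \<tau>) \<longlonglongrightarrow> B \<sigma> \<tau>"
    if "is_op D X B" for B \<sigma> \<tau>
    using bounded_linear.tendsto[OF bounded_linear_entry tendsto_scaled_exp_minus_one[of "single D X B"], of D X \<sigma> \<tau>]
    unfolding component_scaleR component_minus component_one[OF D] op_exp_scale_component[OF D that, symmetric]
      component_single[OF D that] .
  have "B1 \<sigma> \<tau> = B2 \<sigma> \<tau>" for \<sigma> \<tau>
    using lim[OF ops(1), of \<sigma> \<tau>] lim[OF ops(2), of \<sigma> \<tau>] unfolding all by (rule LIMSEQ_unique)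
  then show ?thesis by (simp add: fun_eq_iff)
qed

lemma op_log_exp:
  assumes "0 < D" "finite X" "selfadj D X B"
  shows "op_log D X (op_exp D X B) = B"
  unfolding op_log_def by (rule the_equality) (use assms op_exp_selfadj_inject in blast)+

text \<open>The description in \<open>op_log\<close> can be trusted once an estimate ||1 - c Q|| < 1
  holds. It holds for the exponential itself, and \<open>cond_exp\<close> preserves it, being
  linear, unital and contractive.\<close>

lemma exp_op_log_cond_exp:
  assumes D: "0 < D" "finite \<Lambda>" and K: "selfadj D \<Lambda> K"
  shows "op_exp D \<Lambda> (op_log D \<Lambda> (cond_exp D \<Lambda> L (op_exp D \<Lambda> K))) = cond_exp D \<Lambda> L (op_exp D \<Lambda> K)"
proof -
  let ?E = "op_exp D \<Lambda> K"
  obtain c where c: "0 < c" "op_norm D \<Lambda> (op_diff (op_id D \<Lambda>) (op_scale (of_real c) ?E)) < 1"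
    by (rule op_norm_id_minus_exp_lt_one[OF D K])
  have "op_norm D \<Lambda> (op_diff (op_id D \<Lambda>) (op_scale (of_real c) (cond_exp D \<Lambda> L ?E)))
      = op_norm D \<Lambda> (cond_exp D \<Lambda> L (op_diff (op_id D \<Lambda>) (op_scale (of_real c) ?E)))"
    by (simp only: cond_exp_diff cond_exp_scale cond_exp_id[OF D(2,1)])
  also have "\<dots> < 1" using op_norm_cond_exp_le[OF D(2,1)] c(2) by (rule le_less_trans)
  finally obtain B where B: "selfadj D \<Lambda> B" "op_exp D \<Lambda> B = cond_exp D \<Lambda> L ?E"
    using exists_selfadj_log[OF D selfadj_cond_exp[OF selfadj_exp[OF D K]] c(1)] by blast
  then show ?thesis using op_log_exp[OF D B(1)] by simp
qed

section \<open>Iterated commutators of local terms\<close>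

text \<open>The factorial in the hypothesis cancels the one in the conjugation series, which becomes
  geometric with ratio a t. Its sum is at most w / (1 - a \<beta>) on the whole interval, and
  Gronwall applies with this rate.\<close>

lemma norm_exp_mult_exp_minus_one_le:
  fixes G W :: "'a::{real_normed_algebra_1,banach}"
  assumes ad: "\<And>n. norm ((commutator G ^^ n) W) \<le> w * fact n * a ^ n"
    and w: "0 \<le> w" and a: "0 \<le> a" "a * \<beta> < 1" and \<beta>: "0 \<le> \<beta>"
  shows "norm (exp (\<beta> *\<^sub>R - G) * exp (\<beta> *\<^sub>R (G - W)) - 1) \<le> exp (w / (1 - a * \<beta>) * \<beta>) - 1"
proof -
  define U where "U t = exp (t *\<^sub>R - G) * exp (t *\<^sub>R (G - W))" for t
  define R where "R t = exp (t *\<^sub>R - G) * W * exp (t *\<^sub>R G)" for t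
  have inv: "exp (t *\<^sub>R G) * exp (t *\<^sub>R - G) = 1" for t
    using exp_add_commuting[of "t *\<^sub>R G" "t *\<^sub>R - G"] by simp
  have U': "(U has_vector_derivative - (R t * U t)) (at t)" for t
  proof -
    have "(U has_vector_derivative (exp (t *\<^sub>R - G) * ((G - W) * exp (t *\<^sub>R (G - W)))
        + exp (t *\<^sub>R - G) * - G * exp (t *\<^sub>R (G - W)))) (at t)"
      unfolding U_def
      by (intro has_vector_derivative_mult exp_scaleR_has_vector_derivative_right exp_scaleR_has_vector_derivative_left)
    also have "exp (t *\<^sub>R - G) * ((G - W) * exp (t *\<^sub>R (G - W))) + exp (t *\<^sub>R - G) * - G * exp (t *\<^sub>R (G - W))
        = - (exp (t *\<^sub>R - G) * W * exp (t *\<^sub>R (G - W)))"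
      by (simp add: algebra_simps)
    also have "exp (t *\<^sub>R - G) * W * exp (t *\<^sub>R (G - W)) = R t * U t"
    proof -
      have "R t * U t = exp (t *\<^sub>R - G) * W * (exp (t *\<^sub>R G) * exp (t *\<^sub>R - G)) * exp (t *\<^sub>R (G - W))"
        by (simp only: R_def U_def mult.assoc)
      then show ?thesis by (simp only: inv mult_1_right)
    qed
    finally show ?thesis .
  qed
  have pow: "(commutator (t *\<^sub>R G) ^^ n) W = t ^ n *\<^sub>R (commutator G ^^ n) W" for t n
    by (induction n) (simp_all add: commutator_def algebra_simps)
  have R: "norm (R t) \<le> w / (1 - a * \<beta>)" if t: "0 \<le> t" "t \<le> \<beta>" for t
  proof -
    have at: "a * t \<le> a * \<beta>" using a t by (simp add: mult_left_mono)
    let ?f = "\<lambda>n. inverse (fact n) *\<^sub>R (commutator (t *\<^sub>R G) ^^ n) W"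
    have f: "norm (?f n) \<le> w * (a * t) ^ n" for n
    proof -
      have "norm (?f n) = inverse (fact n) * (t ^ n * norm ((commutator G ^^ n) W))"
        unfolding pow using t by simp
      also have "\<dots> \<le> inverse (fact n) * (t ^ n * (w * fact n * a ^ n))"
        using t by (intro mult_left_mono ad) auto
      also have "\<dots> = w * (a * t) ^ n" by (simp add: power_mult_distrib)
      finally show ?thesis .
    qed
    have g: "(\<lambda>n. w * (a * t) ^ n) sums (w * (1 / (1 - a * t)))"
      using a at t by (intro sums_mult geometric_sums) simp
    have sn: "summable (\<lambda>n. norm (?f n))"
      by (rule summable_comparison_test'[OF sums_summable[OF g], of 0]) (use f in simp)
    have "R t = (\<Sum>n. ?f n)"
      using exp_conjugation_sums[of "t *\<^sub>R G" W] by (simp add: R_def sums_iff)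
    also have "norm \<dots> \<le> (\<Sum>n. norm (?f n))" by (rule summable_norm[OF sn])
    also have "\<dots> \<le> (\<Sum>n. w * (a * t) ^ n)" by (rule suminf_le[OF f sn sums_summable[OF g]])
    also have "\<dots> = w * (1 / (1 - a * t))" using g by (simp add: sums_iff)
    also have "\<dots> \<le> w / (1 - a * \<beta>)"
      using a at w by (simp add: divide_left_mono mult_pos_pos)
    finally show ?thesis .
  qed
  have "norm (U \<beta> - U 0) \<le> norm (U 0) * (exp (w / (1 - a * \<beta>) * \<beta>) - 1)"
  proof (rule norm_diff_le_of_derivative_bound[OF U'])
    fix t assume t: "0 \<le> t" "t \<le> \<beta>"
    have "norm (- (R t * U t)) \<le> norm (R t) * norm (U t)" by (simp add: norm_mult_ineq)
    also have "\<dots> \<le> w / (1 - a * \<beta>) * norm (U t)" by (intro mult_right_mono R t) simp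
    finally show "norm (- (R t * U t)) \<le> w / (1 - a * \<beta>) * norm (U t)" .
  qed (use w a \<beta> in auto)
  then show ?thesis by (simp add: U_def)
qed

text \<open>On the right every \<open>X\<close> is counted once for each site it shares with
  \<open>S\<close>, hence at least once if it meets \<open>S\<close>.\<close>

lemma sum_meeting_le:
  fixes f :: "'v set \<Rightarrow> real"
  assumes "finite \<Lambda>" "S \<subseteq> \<Lambda>" "\<And>X. X \<subseteq> \<Lambda> \<Longrightarrow> 0 \<le> f X"
  shows "(\<Sum>X\<in>{X \<in> Pow \<Lambda>. X \<inter> S \<noteq> {}}. f X) \<le> (\<Sum>x\<in>S. \<Sum>X\<in>{X \<in> Pow \<Lambda>. x \<in> X}. f X)"
proof -
  have fS: "finite S" using assms finite_subset by blast
  have "(\<Sum>x\<in>S. \<Sum>X\<in>{X \<in> Pow \<Lambda>. x \<in> X}. f X) = (\<Sum>X\<in>Pow \<Lambda>. \<Sum>x\<in>{x \<in> S. x \<in> X}. f X)"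
    using fS assms(1) by (intro sum.swap_restrict) auto
  also have "\<dots> \<ge> (\<Sum>X\<in>Pow \<Lambda>. if X \<inter> S \<noteq> {} then f X else 0)"
  proof (rule sum_mono)
    fix X assume X: "X \<in> Pow \<Lambda>"
    show "(if X \<inter> S \<noteq> {} then f X else 0) \<le> (\<Sum>x\<in>{x \<in> S. x \<in> X}. f X)"
    proof (cases "X \<inter> S = {}")
      case False
      have "card {x \<in> S. x \<in> X} \<noteq> 0" using fS False by (auto simp: card_eq_0_iff)
      then have "1 * f X \<le> real (card {x \<in> S. x \<in> X}) * f X"
        using assms(3) X by (intro mult_right_mono) auto
      then show ?thesis using False by simp
    qed (use assms(3) X in \<open>auto intro!: sum_nonneg\<close>)
  qed
  finally show ?thesis
    unfolding sum.inter_filter[OF iffD2[OF finite_Pow_iff assms(1)], of f "\<lambda>X. X \<inter> S \<noteq> {}"] .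
qed

lemma funpow_commutator_sum:
  fixes G :: "'a::ring_1"
  shows "(commutator G ^^ n) (\<Sum>i\<in>I. f i) = (\<Sum>i\<in>I. (commutator G ^^ n) (f i))"
  by (induction n) (simp_all add: commutator_def sum_subtractf sum_distrib_left sum_distrib_right)

lemma norm_commutator_le:
  fixes G :: "'a::real_normed_algebra_1"
  shows "norm (commutator G w) \<le> 2 * norm G * norm w"
proof -
  have "norm (commutator G w) \<le> norm (w * G) + norm (G * w)"
    unfolding commutator_def by (rule norm_triangle_ineq4)
  also have "\<dots> \<le> norm w * norm G + norm G * norm w" by (intro add_mono norm_mult_ineq)
  finally show ?thesis by simp
qed

text \<open>The admissible constants $B$ absorb the growth of the support: passing from $S$ to $S \cup X$
  costs a factor $e^{\lambda |X|} / |S|$, and there are at most $|S|$ sites through which $X$ can meet $S$.\<close>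

lemma norm_iterated_commutator_le:
  fixes g :: "'v set \<Rightarrow> 'a::real_normed_algebra_1" and loc :: "'v set \<Rightarrow> 'a set"
  assumes fin: "finite \<Lambda>"
    and g: "\<And>X. X \<subseteq> \<Lambda> \<Longrightarrow> g X \<in> loc X"
    and loc: "\<And>X Y a b. X \<subseteq> \<Lambda> \<Longrightarrow> Y \<subseteq> \<Lambda> \<Longrightarrow> a \<in> loc X \<Longrightarrow> b \<in> loc Y \<Longrightarrow> commutator b a \<in> loc (X \<union> Y)"
    and disj: "\<And>X Y a b. X \<subseteq> \<Lambda> \<Longrightarrow> Y \<subseteq> \<Lambda> \<Longrightarrow> a \<in> loc X \<Longrightarrow> b \<in> loc Y \<Longrightarrow> X \<inter> Y = {} \<Longrightarrow> commutator b a = 0"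
    and decay: "\<And>x. x \<in> \<Lambda> \<Longrightarrow> (\<Sum>X\<in>{X \<in> Pow \<Lambda>. x \<in> X}. norm (g X) * exp (lam * real (card X))) \<le> \<Delta>"
    and \<Delta>: "0 \<le> \<Delta>"
    and S: "S \<subseteq> \<Lambda>" "a \<in> loc S"
    and B: "\<And>t::nat. real (card S + t) ^ n * exp (- lam * real t) \<le> B"
  shows "norm ((commutator (\<Sum>X\<in>Pow \<Lambda>. g X) ^^ n) a) \<le> (2 * \<Delta>) ^ n * norm a * B"
  using S B
proof (induction n arbitrary: S a B)
  case 0
  then have "1 \<le> B" using "0.prems"(3)[of 0] by simp
  then show ?case by (simp add: mult_left_mono[of 1 B "norm a", simplified])
next
  case (Suc n)
  define G where "G = (\<Sum>X\<in>Pow \<Lambda>. g X)"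
  define I where "I = {X \<in> Pow \<Lambda>. X \<inter> S \<noteq> {}}"
  define m where "m = real (card S)"
  have fS: "finite S" using fin Suc.prems(1) finite_subset by blast
  have B0: "0 \<le> B" using Suc.prems(3)[of 0] by (rule order_trans[rotated]) simp
  have "commutator G a = (\<Sum>X\<in>Pow \<Lambda>. commutator (g X) a)"
    by (simp add: G_def commutator_def sum_subtractf sum_distrib_left sum_distrib_right)
  also have "\<dots> = (\<Sum>X\<in>I. commutator (g X) a)"
  proof (rule sum.mono_neutral_right)
    show "\<forall>X\<in>Pow \<Lambda> - I. commutator (g X) a = 0"
      using disj[OF Suc.prems(1) _ Suc.prems(2) g] by (auto simp: I_def)
  qed (use fin in \<open>auto simp: I_def\<close>)
  finally have "(commutator G ^^ Suc n) a = (\<Sum>X\<in>I. (commutator G ^^ n) (commutator (g X) a))"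
    by (simp add: funpow_Suc_right funpow_commutator_sum del: funpow.simps)
  then have "norm ((commutator G ^^ Suc n) a) \<le> (\<Sum>X\<in>I. norm ((commutator G ^^ n) (commutator (g X) a)))"
    by (simp add: norm_sum del: funpow.simps)
  also have "\<dots> \<le> (\<Sum>X\<in>I. (2 * \<Delta>) ^ n * 2 * norm a * B / m * (norm (g X) * exp (lam * real (card X))))"
  proof (rule sum_mono)
    fix X assume "X \<in> I"
    then have X: "X \<subseteq> \<Lambda>" "X \<inter> S \<noteq> {}" by (auto simp: I_def)
    then have m: "1 \<le> m" using fS by (auto simp: m_def card_gt_0_iff Suc_le_eq)
    have fX: "finite X" using X fin finite_subset by blast
    let ?B = "exp (lam * real (card X)) * B / m"
    have "norm ((commutator G ^^ n) (commutator (g X) a)) \<le> (2 * \<Delta>) ^ n * norm (commutator (g X) a) * ?B"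
      unfolding G_def
    proof (rule Suc.IH)
      show "S \<union> X \<subseteq> \<Lambda>" using X Suc.prems by auto
      show "commutator (g X) a \<in> loc (S \<union> X)" by (rule loc[OF Suc.prems(1) X(1) Suc.prems(2) g[OF X(1)]])
      fix t :: nat
      \<comment> \<open>The sites of \<open>X\<close> are moved into the free parameter: the
        assumption on \<open>B\<close> is used at \<open>card X + t\<close>, which releases exp(lam
        |X|). Since y is at least m, raising its power by one costs a division by m.\<close>
      define y where "y = real (card S + (card X + t))"
      have "real (card (S \<union> X) + t) \<le> y" using card_Un_le[of S X] by (simp add: y_def)
      then have "real (card (S \<union> X) + t) ^ n \<le> y ^ n" by (rule power_mono) simp
      also have "\<dots> \<le> y ^ Suc n / m"
      proof -
        have "m * y ^ n \<le> y * y ^ n" by (rule mult_right_mono) (simp_all add: m_def y_def)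
        then show ?thesis using m by (simp add: le_divide_eq mult.commute)
      qed
      finally have "real (card (S \<union> X) + t) ^ n * exp (- lam * real t) \<le> y ^ Suc n / m * exp (- lam * real t)"
        by (rule mult_right_mono) simp
      also have "\<dots> = exp (lam * real (card X)) * (y ^ Suc n * exp (- lam * real (card X + t))) / m"
      proof -
        have "exp (- lam * real t) = exp (lam * real (card X)) * exp (- lam * real (card X + t))"
          by (simp add: exp_add[symmetric] algebra_simps)
        then show ?thesis by simp
      qed
      also have "\<dots> \<le> ?B"
        using Suc.prems(3)[of "card X + t"] m unfolding y_def by (intro divide_right_mono mult_left_mono) auto
      finally show "real (card (S \<union> X) + t) ^ n * exp (- lam * real t) \<le> ?B" .
    qed
    also have "\<dots> \<le> (2 * \<Delta>) ^ n * (2 * norm (g X) * norm a) * ?B"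
      using \<Delta> B0 m by (intro mult_right_mono mult_left_mono norm_commutator_le) auto
    also have "\<dots> = (2 * \<Delta>) ^ n * 2 * norm a * B / m * (norm (g X) * exp (lam * real (card X)))"
      by simp
    finally show "norm ((commutator G ^^ n) (commutator (g X) a)) \<le>
      (2 * \<Delta>) ^ n * 2 * norm a * B / m * (norm (g X) * exp (lam * real (card X)))" .
  qed
  also have "\<dots> = (2 * \<Delta>) ^ n * 2 * norm a * B / m * (\<Sum>X\<in>I. norm (g X) * exp (lam * real (card X)))"
    by (rule sum_distrib_left[symmetric])
  also have "\<dots> \<le> (2 * \<Delta>) ^ n * 2 * norm a * B / m * (m * \<Delta>)"
  proof (rule mult_left_mono)
    have "(\<Sum>X\<in>I. norm (g X) * exp (lam * real (card X)))
        \<le> (\<Sum>x\<in>S. \<Sum>X\<in>{X \<in> Pow \<Lambda>. x \<in> X}. norm (g X) * exp (lam * real (card X)))"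
      unfolding I_def by (rule sum_meeting_le[OF fin Suc.prems(1)]) simp
    also have "\<dots> \<le> (\<Sum>x\<in>S. \<Delta>)" using Suc.prems(1) by (intro sum_mono decay) auto
    finally show "(\<Sum>X\<in>I. norm (g X) * exp (lam * real (card X))) \<le> m * \<Delta>" by (simp add: m_def)
    show "0 \<le> (2 * \<Delta>) ^ n * 2 * norm a * B / m" using \<Delta> B0 by (simp add: m_def)
  qed
  also have "\<dots> \<le> (2 * \<Delta>) ^ Suc n * norm a * B"
    \<comment> \<open>For empty \<open>S\<close> the quotient by m is 0 by convention, and so is the
      whole left side.\<close>
    using \<Delta> B0 by (cases "m = 0") (simp_all add: field_simps)
  finally show ?case unfolding G_def .
qed

lemma power_le_fact_exp:
  fixes y :: real
  assumes "0 \<le> y"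
  shows "y ^ n \<le> fact n * exp y"
proof -
  have "(\<Sum>k\<in>{n}. y ^ k /\<^sub>R fact k) \<le> (\<Sum>k. y ^ k /\<^sub>R fact k)"
    by (rule sum_le_suminf[OF summable_exp_generic]) (use assms in auto)
  then have "y ^ n / fact n \<le> exp y" by (simp add: exp_def divide_inverse mult.commute)
  then show ?thesis by (simp add: divide_le_eq mult.commute)
qed

text \<open>An admissible \<open>B\<close> for the commutator bound, from y^n \<le> n! exp y at y =
  lam (m + t). Both the n! and the power of 1 / lam originate here.\<close>

lemma power_mult_exp_le:
  fixes m t :: nat
  assumes "0 < lam"
  shows "real (m + t) ^ n * exp (- lam * real t) \<le> fact n / lam ^ n * exp (lam * real m)"
proof -
  have "(lam * real (m + t)) ^ n * exp (- lam * real t) \<le> fact n * exp (lam * real (m + t)) * exp (- lam * real t)"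
    using assms by (intro mult_right_mono power_le_fact_exp) auto
  also have "\<dots> = fact n * exp (lam * real m)"
    by (simp add: mult.assoc exp_add[symmetric] algebra_simps)
  finally have "lam ^ n * (real (m + t) ^ n * exp (- lam * real t)) \<le> fact n * exp (lam * real m)"
    by (simp only: power_mult_distrib mult.assoc)
  then show ?thesis using assms by (simp add: pos_le_divide_eq mult.commute del: of_nat_add)
qed

section \<open>Decay of correlations\<close>

lemma op_scale_scale: "op_scale a (op_scale b Q) = op_scale (a * b) Q"
  by (simp add: op_scale_def mult.assoc)

text \<open>The copy of the observables of \<open>X\<close> in the algebra of families; it
  instantiates \<open>loc\<close> in the commutator bound.\<close>

definition local_ops :: "nat \<Rightarrow> 'v set \<Rightarrow> 'v set \<Rightarrow> 'v opfam set" where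
  "local_ops D \<Lambda> X = {single D \<Lambda> (emb D X \<Lambda> q) | q. is_op D X q}"

lemma commutator_local_ops:
  assumes "finite \<Lambda>" "X \<subseteq> \<Lambda>" "Y \<subseteq> \<Lambda>" "a \<in> local_ops D \<Lambda> X" "b \<in> local_ops D \<Lambda> Y"
  shows "commutator b a \<in> local_ops D \<Lambda> (X \<union> Y)"
proof -
  obtain p q where p: "a = single D \<Lambda> (emb D X \<Lambda> p)" and q: "b = single D \<Lambda> (emb D Y \<Lambda> q)"
    using assms(4,5) by (auto simp: local_ops_def)
  let ?Z = "X \<union> Y"
  have Z: "?Z \<subseteq> \<Lambda>" using assms by auto
  define p' q' where "p' = emb D X ?Z p" and "q' = emb D Y ?Z q"
  have pq: "emb D X \<Lambda> p = emb D ?Z \<Lambda> p'" "emb D Y \<Lambda> q = emb D ?Z \<Lambda> q'"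
    unfolding p'_def q'_def using Z by (auto intro!: emb_trans[symmetric])
  have "commutator b a = single D \<Lambda> (emb D ?Z \<Lambda> (op_diff (op_mult D ?Z p' q') (op_mult D ?Z q' p')))"
    unfolding commutator_def p q pq emb_diff emb_mult[OF Z assms(1)]
    by (simp add: single_mult single_diff)
  moreover have "is_op D ?Z (op_diff (op_mult D ?Z p' q') (op_mult D ?Z q' p'))"
    by (simp add: p'_def q'_def)
  ultimately show ?thesis unfolding local_ops_def by blast
qed

lemma local_ops_disjoint_commute:
  assumes "finite \<Lambda>" "X \<subseteq> \<Lambda>" "Y \<subseteq> \<Lambda>" "a \<in> local_ops D \<Lambda> X" "b \<in> local_ops D \<Lambda> Y" "X \<inter> Y = {}"
  shows "a * b = b * a"
proof -
  obtain p q where p: "a = single D \<Lambda> (emb D X \<Lambda> p)" and q: "b = single D \<Lambda> (emb D Y \<Lambda> q)"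
    using assms(4,5) by (auto simp: local_ops_def)
  show ?thesis
    unfolding p q by (simp add: single_mult emb_commute[OF assms(2,3,6,1)])
qed

section \<open>Effective Hamiltonians and marginals in a fixed finite volume\<close>

context
  fixes D :: nat and \<Phi> :: "'v set \<Rightarrow> 'v qop" and \<Psi> :: "'v set \<Rightarrow> 'v set \<Rightarrow> 'v qop"
    and \<beta> :: real and \<Lambda> :: "'v set"
  assumes D: "0 < D" and \<Phi>: "local_interaction D \<Phi>" and \<beta>: "0 < \<beta>"
    and eff: "strong_local_eff_ham D \<Phi> \<beta> \<Psi>" and fin: "finite \<Lambda>"
begin

definition eff_term :: "'v set \<Rightarrow> 'v set \<Rightarrow> 'v opfam" where
  "eff_term L X = single D \<Lambda> (emb D X \<Lambda> (\<Psi> L X))"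

definition eff_ham :: "'v set \<Rightarrow> 'v opfam" where
  "eff_ham L = (\<Sum>X\<in>Pow \<Lambda>. eff_term L X)"

definition weight :: "'v qop" where
  "weight = op_exp D \<Lambda> (op_scale (- complex_of_real \<beta>) (hamiltonian D \<Phi> \<Lambda>))"

lemma eff_ham_eq: "eff_ham L = single D \<Lambda> (hamiltonian D (\<Psi> L) \<Lambda>)"
  unfolding eff_ham_def eff_term_def hamiltonian_def by (rule single_sum) simp

lemma is_op_hamiltonian: "is_op D \<Lambda> (hamiltonian D F \<Lambda>)"
  unfolding hamiltonian_def by (rule is_op_sum) simp

lemma component_exp_eff_ham:
  "component (exp (r *\<^sub>R eff_ham L)) D \<Lambda> = op_exp D \<Lambda> (op_scale (of_real r) (hamiltonian D (\<Psi> L) \<Lambda>))"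
  unfolding eff_ham_eq by (rule op_exp_scale_component[OF D fin is_op_hamiltonian, symmetric])

text \<open>Condition (iii) of the hypothesis with the logarithm removed, the form in which it is
  used from here on.\<close>

lemma cond_exp_weight: "cond_exp D \<Lambda> L weight = component (exp ((- \<beta>) *\<^sub>R eff_ham L)) D \<Lambda>"
proof -
  let ?K = "op_scale (- complex_of_real \<beta>) (hamiltonian D \<Phi> \<Lambda>)"
  let ?B = "op_log D \<Lambda> (cond_exp D \<Lambda> L weight)"
  have K: "selfadj D \<Lambda> ?K"
    using selfadj_scale[OF selfadj_hamiltonian[OF \<Phi> fin], of "- \<beta>"] by simp
  have "op_scale (- 1 / complex_of_real \<beta>) ?B = hamiltonian D (\<Psi> L) \<Lambda>"
    unfolding weight_def
    by (rule eff[unfolded strong_local_eff_ham_def, THEN conjunct2, THEN conjunct2, THEN conjunct2, rule_format, OF fin])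
  then have "op_scale (of_real (- \<beta>)) (op_scale (- 1 / complex_of_real \<beta>) ?B)
      = op_scale (of_real (- \<beta>)) (hamiltonian D (\<Psi> L) \<Lambda>)" by simp
  moreover have "op_scale (of_real (- \<beta>)) (op_scale (- 1 / complex_of_real \<beta>) ?B) = ?B"
    using \<beta> by (simp add: op_scale_def)
  ultimately have B: "?B = op_scale (of_real (- \<beta>)) (hamiltonian D (\<Psi> L) \<Lambda>)" by simp
  have "op_exp D \<Lambda> ?B = cond_exp D \<Lambda> L weight"
    unfolding weight_def by (rule exp_op_log_cond_exp[OF D fin K])
  then show ?thesis by (simp only: component_exp_eff_ham B)
qed

text \<open>By condition (i) each term lives on \<open>X \<inter> L\<close>, so the whole sum lives
  on \<open>L\<close>. This yields the commutation relations and lets the inverse of a marginal be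
  written down on \<open>L\<close> itself.\<close>

lemma eff_ham_localE:
  assumes "L \<subseteq> \<Lambda>"
  obtains k where "is_op D L k" "hamiltonian D (\<Psi> L) \<Lambda> = emb D L \<Lambda> k"
proof -
  have "\<exists>Q. finite X \<longrightarrow> \<Psi> L X = emb D (X \<inter> L) X Q" for X
    using eff[unfolded strong_local_eff_ham_def, THEN conjunct2, THEN conjunct1, rule_format, of X L] by blast
  then have "\<forall>X. \<exists>Q. finite X \<longrightarrow> \<Psi> L X = emb D (X \<inter> L) X Q" by (rule allI)
  from choice[OF this] obtain Q where Q: "\<And>X. finite X \<Longrightarrow> \<Psi> L X = emb D (X \<inter> L) X (Q X)" by blast
  define k where "k = op_sum (\<lambda>X. emb D (X \<inter> L) L (Q X)) (Pow \<Lambda>)"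
  have "emb D X \<Lambda> (\<Psi> L X) = emb D L \<Lambda> (emb D (X \<inter> L) L (Q X))" if X: "X \<in> Pow \<Lambda>" for X
  proof -
    have "finite X" using X fin finite_subset by blast
    then have "emb D X \<Lambda> (\<Psi> L X) = emb D (X \<inter> L) \<Lambda> (Q X)"
      unfolding Q[OF \<open>finite X\<close>] using X by (intro emb_trans) auto
    also have "\<dots> = emb D L \<Lambda> (emb D (X \<inter> L) L (Q X))"
      using assms by (intro emb_trans[symmetric]) auto
    finally show ?thesis .
  qed
  then have "hamiltonian D (\<Psi> L) \<Lambda> = emb D L \<Lambda> k"
    unfolding hamiltonian_def k_def emb_sum by (simp add: op_sum_def)
  moreover have "is_op D L k" unfolding k_def by (rule is_op_sum) simp
  ultimately show ?thesis using that by blast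
qed

lemma eff_ham_local: "L \<subseteq> \<Lambda> \<Longrightarrow> eff_ham L \<in> local_ops D \<Lambda> L"
  by (rule eff_ham_localE[of L]) (auto simp: local_ops_def eff_ham_eq)

text \<open>For empty \<open>L\<close> the conditional expectation is the normalised trace, so this
  exponential is a scalar: the partition function divided by the dimension.\<close>

lemma op_trace_weight:
  "component (exp ((- \<beta>) *\<^sub>R eff_ham {})) D \<Lambda> = op_scale (op_trace D \<Lambda> weight / of_nat (D ^ card \<Lambda>)) (op_id D \<Lambda>)"
proof -
  have m: "merge {} \<sigma> \<eta> = \<eta>" for \<sigma> \<eta> :: "'v \<Rightarrow> nat" by (simp add: merge_def)
  have c: "conf D {} = {\<lambda>_. 0 :: nat}" by (auto simp: conf_def)
  have "ptr D \<Lambda> {} weight = op_scale (op_trace D \<Lambda> weight) (op_id D {})"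
    by (auto simp: fun_eq_iff ptr_def op_scale_def op_id_def op_trace_def m c)
  then have "cond_exp D \<Lambda> {} weight = op_scale (1 / of_nat (D ^ card \<Lambda>)) (op_scale (op_trace D \<Lambda> weight) (op_id D \<Lambda>))"
    by (simp add: cond_exp_def emb_scale emb_id)
  then show ?thesis unfolding cond_exp_weight op_scale_scale times_divide_eq_left mult_1 .
qed

lemma exp_eff_ham_cancel:
  "exp ((- \<beta>) *\<^sub>R eff_ham L) * exp (\<beta> *\<^sub>R eff_ham L) = 1"
  "exp (\<beta> *\<^sub>R eff_ham L) * exp ((- \<beta>) *\<^sub>R eff_ham L) = 1"
  by (simp_all add: exp_add_commuting[symmetric])

text \<open>Otherwise an invertible exponential would be zero. The normalisation of
  \<open>gibbs\<close> is therefore a genuine division.\<close>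

lemma op_trace_weight_nonzero: "op_trace D \<Lambda> weight \<noteq> 0"
proof
  assume "op_trace D \<Lambda> weight = 0"
  then have "component (exp ((- \<beta>) *\<^sub>R eff_ham {})) D \<Lambda> = (\<lambda>_ _. 0)"
    unfolding op_trace_weight by (simp add: op_scale_def)
  then have "component (exp ((- \<beta>) *\<^sub>R eff_ham {}) * exp (\<beta> *\<^sub>R eff_ham {})) D \<Lambda> = (\<lambda>_ _. 0)"
    unfolding component_mult by (simp add: op_mult_def)
  then have "op_id D \<Lambda> = (\<lambda>_ _. 0)" unfolding exp_eff_ham_cancel component_one[OF D fin] .
  then show False using op_norm_id[OF fin D] by simp
qed

lemma marginal_eq:
  assumes L: "L \<subseteq> \<Lambda>"
  shows "emb D L \<Lambda> (ptr D \<Lambda> L (gibbs D \<Phi> \<beta> \<Lambda>))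
    = op_scale (of_nat (D ^ card (\<Lambda> - L)) / op_trace D \<Lambda> weight) (component (exp ((- \<beta>) *\<^sub>R eff_ham L)) D \<Lambda>)"
proof -
  have i: "\<Lambda> \<inter> L = L" using L by auto
  have "emb D L \<Lambda> (ptr D \<Lambda> L weight) = op_scale (of_nat (D ^ card (\<Lambda> - L))) (cond_exp D \<Lambda> L weight)"
    using D by (simp add: cond_exp_def i op_scale_def)
  then show ?thesis
    unfolding gibbs_def Let_def weight_def[symmetric] ptr_scale emb_scale cond_exp_weight by (simp add: op_scale_def)
qed

text \<open>The candidate inverse is an exponential on \<open>L\<close>. Both inverse identities are
  checked in the full volume, where the effective Hamiltonian is available, and pulled back by
  injectivity of \<open>emb\<close>.\<close>

lemma emb_inv_marginal:
  assumes L: "L \<subseteq> \<Lambda>"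
  shows "emb D L \<Lambda> (op_inv D L (ptr D \<Lambda> L (gibbs D \<Phi> \<beta> \<Lambda>)))
    = op_scale (op_trace D \<Lambda> weight / of_nat (D ^ card (\<Lambda> - L))) (component (exp (\<beta> *\<^sub>R eff_ham L)) D \<Lambda>)"
proof -
  let ?\<rho> = "ptr D \<Lambda> L (gibbs D \<Phi> \<beta> \<Lambda>)"
  define c where "c = of_nat (D ^ card (\<Lambda> - L)) / op_trace D \<Lambda> weight"
  have c: "c \<noteq> 0" using D op_trace_weight_nonzero by (simp add: c_def)
  obtain k where k: "is_op D L k" "hamiltonian D (\<Psi> L) \<Lambda> = emb D L \<Lambda> k" by (rule eff_ham_localE[OF L])
  let ?R = "op_scale (1 / c) (op_exp D L (op_scale (of_real \<beta>) k))"
  have e: "emb D L \<Lambda> (op_exp D L (op_scale (of_real r) k)) = component (exp (r *\<^sub>R eff_ham L)) D \<Lambda>" for r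
    unfolding component_exp_eff_ham k(2) emb_exp[OF L fin] emb_scale ..
  have R: "emb D L \<Lambda> ?R = op_scale (1 / c) (component (exp (\<beta> *\<^sub>R eff_ham L)) D \<Lambda>)"
    unfolding emb_scale e ..
  have \<rho>: "emb D L \<Lambda> ?\<rho> = op_scale c (component (exp ((- \<beta>) *\<^sub>R eff_ham L)) D \<Lambda>)"
    unfolding c_def by (rule marginal_eq[OF L])
  have id: "op_scale c (op_scale (1 / c) (op_id D \<Lambda>)) = op_id D \<Lambda>"
    "op_scale (1 / c) (op_scale c (op_id D \<Lambda>)) = op_id D \<Lambda>"
    using c by (simp_all add: op_scale_def)
  have inj: "P = op_id D L" if "is_op D L P" "emb D L \<Lambda> P = op_id D \<Lambda>" for P
    by (rule emb_inject[OF L D]) (simp_all add: that emb_id[OF L])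
  have "op_inv D L ?\<rho> = ?R"
  proof (rule op_inv_eqI)
    show "finite L" using L fin finite_subset by blast
    show "is_op D L ?R" using k by simp
    show "op_mult D L ?\<rho> ?R = op_id D L"
    proof (rule inj)
      show "emb D L \<Lambda> (op_mult D L ?\<rho> ?R) = op_id D \<Lambda>"
        unfolding emb_mult[OF L fin] R \<rho>
        unfolding op_mult_scale_left op_mult_scale_right component_mult[symmetric]
          exp_eff_ham_cancel component_one[OF D fin] id ..
    qed (use k in simp)
    show "op_mult D L ?R ?\<rho> = op_id D L"
    proof (rule inj)
      show "emb D L \<Lambda> (op_mult D L ?R ?\<rho>) = op_id D \<Lambda>"
        unfolding emb_mult[OF L fin] R \<rho>
        unfolding op_mult_scale_left op_mult_scale_right component_mult[symmetric]
          exp_eff_ham_cancel component_one[OF D fin] id ..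
    qed (use k in simp)
  qed
  then show ?thesis using R by (simp add: c_def)
qed

text \<open>The isometry \<open>emb\<close> carries the correlation operator to \<Lambda>, where it
  is one component of the family on the right; the norm of a component is at most that of the
  family.\<close>

lemma op_norm_correlation:
  assumes A: "A \<subseteq> \<Lambda>" and C: "C \<subseteq> \<Lambda>" and AC: "A \<inter> C = {}"
  defines "\<rho> \<equiv> gibbs D \<Phi> \<beta> \<Lambda>"
  shows "op_norm D (A \<union> C) (op_diff (op_mult D (A \<union> C) (ptr D \<Lambda> (A \<union> C) \<rho>)
            (op_mult D (A \<union> C) (emb D A (A \<union> C) (op_inv D A (ptr D \<Lambda> A \<rho>)))
                                (emb D C (A \<union> C) (op_inv D C (ptr D \<Lambda> C \<rho>)))))
          (op_id D (A \<union> C)))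
    \<le> norm (exp (\<beta> *\<^sub>R - eff_ham (A \<union> C)) * exp (\<beta> *\<^sub>R (eff_ham A + eff_ham C - eff_ham {})) - 1)"
proof -
  let ?Z = "A \<union> C"
  let ?t = "op_trace D \<Lambda> weight"
  let ?d = "\<lambda>L. of_nat (D ^ card (\<Lambda> - L)) :: complex"
  have Z: "?Z \<subseteq> \<Lambda>" using A C by auto
  define T where "T = op_diff (op_mult D ?Z (ptr D \<Lambda> ?Z \<rho>)
            (op_mult D ?Z (emb D A ?Z (op_inv D A (ptr D \<Lambda> A \<rho>))) (emb D C ?Z (op_inv D C (ptr D \<Lambda> C \<rho>)))))
          (op_id D ?Z)"
  define E where "E L = exp (\<beta> *\<^sub>R eff_ham L)" for L
  \<comment> \<open>As \<open>A\<close> and \<open>C\<close> are disjoint, the complement sizes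
    satisfy |\<Lambda> - (A \<union> C)| + |\<Lambda>| = |\<Lambda> - A| + |\<Lambda> - C|. The
    powers of \<open>D\<close> thus collapse to the dimension of the full space.\<close>
  have scal: "?d ?Z / ?t * (?t / ?d A * (?t / ?d C)) = ?t / of_nat (D ^ card \<Lambda>)"
  proof -
    have f: "finite A" "finite C" using A C fin finite_subset by blast+
    have "card (\<Lambda> - ?Z) + card \<Lambda> = card (\<Lambda> - A) + card (\<Lambda> - C)"
    proof -
      have "card ?Z = card A + card C" using card_Un_disjoint[OF f AC] .
      moreover have "card ?Z \<le> card \<Lambda>" using card_mono[OF fin Z] .
      moreover have "card (\<Lambda> - ?Z) = card \<Lambda> - card ?Z" "card (\<Lambda> - A) = card \<Lambda> - card A"
        "card (\<Lambda> - C) = card \<Lambda> - card C"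
        using card_Diff_subset[OF _ Z] card_Diff_subset[OF f(1) A] card_Diff_subset[OF f(2) C] f by auto
      ultimately show ?thesis by linarith
    qed
    then have "?d A * ?d C = ?d ?Z * of_nat (D ^ card \<Lambda>)"
      unfolding of_nat_mult[symmetric] power_add[symmetric] by simp
    moreover have "?d ?Z / ?t * (?t / ?d A * (?t / ?d C)) = ?d ?Z * ?t / (?d A * ?d C)"
      using op_trace_weight_nonzero by simp
    moreover have "?d ?Z \<noteq> 0" using D by simp
    ultimately show ?thesis by (metis nonzero_mult_divide_mult_cancel_left)
  qed
  \<comment> \<open>The empty set is disjoint from \<open>A\<close> and \<open>C\<close>, so
    locality covers all three pairs.\<close>
  have comm: "eff_ham A * eff_ham C = eff_ham C * eff_ham A"
    "eff_ham A * eff_ham {} = eff_ham {} * eff_ham A" "eff_ham C * eff_ham {} = eff_ham {} * eff_ham C"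
    by (rule local_ops_disjoint_commute[OF fin _ _ eff_ham_local eff_ham_local]; use A C AC in auto)+
  have prod: "E A * E C * exp ((- \<beta>) *\<^sub>R eff_ham {}) = exp (\<beta> *\<^sub>R (eff_ham A + eff_ham C - eff_ham {}))"
  proof -
    have "E A * E C = exp (\<beta> *\<^sub>R (eff_ham A + eff_ham C))"
      unfolding E_def scaleR_right_distrib by (rule exp_add_commuting[symmetric]) (simp add: comm)
    moreover have "exp (\<beta> *\<^sub>R (eff_ham A + eff_ham C)) * exp ((- \<beta>) *\<^sub>R eff_ham {})
        = exp (\<beta> *\<^sub>R (eff_ham A + eff_ham C) + (- \<beta>) *\<^sub>R eff_ham {})"
      by (rule exp_add_commuting[symmetric]) (simp add: comm algebra_simps)
    ultimately show ?thesis by (simp add: algebra_simps)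
  qed
  have "emb D ?Z \<Lambda> T = op_diff (op_mult D \<Lambda> (emb D ?Z \<Lambda> (ptr D \<Lambda> ?Z \<rho>))
      (op_mult D \<Lambda> (emb D A \<Lambda> (op_inv D A (ptr D \<Lambda> A \<rho>))) (emb D C \<Lambda> (op_inv D C (ptr D \<Lambda> C \<rho>))))) (op_id D \<Lambda>)"
    unfolding T_def emb_diff emb_mult[OF Z fin] emb_id[OF Z] emb_trans[OF Un_upper1 Z] emb_trans[OF Un_upper2 Z] ..
  also have "op_mult D \<Lambda> (emb D ?Z \<Lambda> (ptr D \<Lambda> ?Z \<rho>))
      (op_mult D \<Lambda> (emb D A \<Lambda> (op_inv D A (ptr D \<Lambda> A \<rho>))) (emb D C \<Lambda> (op_inv D C (ptr D \<Lambda> C \<rho>))))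
    = op_scale (?d ?Z / ?t * (?t / ?d A * (?t / ?d C))) (component (exp ((- \<beta>) *\<^sub>R eff_ham ?Z) * (E A * E C)) D \<Lambda>)"
    unfolding \<rho>_def marginal_eq[OF Z] emb_inv_marginal[OF A] emb_inv_marginal[OF C]
      op_mult_scale_left op_mult_scale_right component_mult E_def
    by (simp only: op_scale_scale mult_ac)
  \<comment> \<open>The remaining scalar is exactly the one in \<open>op_trace_weight\<close>, so it
    is absorbed as a right factor.\<close>
  also have "\<dots> = component (exp ((- \<beta>) *\<^sub>R eff_ham ?Z) * (E A * E C) * exp ((- \<beta>) *\<^sub>R eff_ham {})) D \<Lambda>"
    unfolding scal component_mult[of _ "exp ((- \<beta>) *\<^sub>R eff_ham {})"] op_trace_weight op_mult_scale_right
      op_mult_id_right[OF fin is_op_component] ..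
  also have "op_diff \<dots> (op_id D \<Lambda>)
      = component (exp (\<beta> *\<^sub>R - eff_ham ?Z) * exp (\<beta> *\<^sub>R (eff_ham A + eff_ham C - eff_ham {})) - 1) D \<Lambda>"
    unfolding component_minus component_one[OF D fin] mult.assoc[of "exp ((- \<beta>) *\<^sub>R eff_ham ?Z)"] prod by simp
  finally have "op_norm D \<Lambda> (emb D ?Z \<Lambda> T)
      \<le> norm (exp (\<beta> *\<^sub>R - eff_ham ?Z) * exp (\<beta> *\<^sub>R (eff_ham A + eff_ham C - eff_ham {})) - 1)"
    using op_norm_component_le[OF D fin] by simp
  then show ?thesis unfolding op_norm_emb[OF Z fin D] T_def .
qed

lemma norm_eff_term:
  assumes "X \<subseteq> \<Lambda>"
  shows "norm (eff_term L X) = op_norm D X (\<Psi> L X)"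
  unfolding eff_term_def by (simp add: norm_single[OF D fin] op_norm_emb[OF assms fin D])

lemma eff_term_local:
  assumes "X \<subseteq> \<Lambda>"
  shows "eff_term L X \<in> local_ops D \<Lambda> X"
proof -
  have "finite X" using assms fin finite_subset by blast
  then have "is_op D X (\<Psi> L X)"
    using eff[unfolded strong_local_eff_ham_def, THEN conjunct1, rule_format, of L]
    by (simp add: local_interaction_def selfadj_iff)
  then show ?thesis by (auto simp: eff_term_def local_ops_def)
qed

lemma eff_term_cong:
  assumes "X \<subseteq> \<Lambda>" "X \<inter> L' = X \<inter> L"
  shows "eff_term L X = eff_term L' X"
proof -
  have "finite X" using assms fin finite_subset by blast
  from eff[unfolded strong_local_eff_ham_def, THEN conjunct2, THEN conjunct2, THEN conjunct1, rule_format,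
      OF this assms(2)]
  have "\<Psi> L X = \<Psi> L' X" .
  then show ?thesis by (simp add: eff_term_def)
qed

text \<open>A mixed second difference in the set \<open>L\<close>; consistency makes it vanish as
  soon as \<open>X\<close> misses \<open>A\<close> or \<open>C\<close>.\<close>

definition eff_defect :: "'v set \<Rightarrow> 'v set \<Rightarrow> 'v set \<Rightarrow> 'v opfam" where
  "eff_defect A C X = eff_term (A \<union> C) X - eff_term A X - eff_term C X + eff_term {} X"

lemma eff_ham_defect:
  "eff_ham (A \<union> C) - (\<Sum>X\<in>{X \<in> Pow \<Lambda>. X \<inter> A \<noteq> {} \<and> X \<inter> C \<noteq> {}}. eff_defect A C X)
    = eff_ham A + eff_ham C - eff_ham {}"
proof -
  have "(\<Sum>X\<in>Pow \<Lambda>. eff_defect A C X) = (\<Sum>X\<in>{X \<in> Pow \<Lambda>. X \<inter> A \<noteq> {} \<and> X \<inter> C \<noteq> {}}. eff_defect A C X)"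
  proof (rule sum.mono_neutral_right)
    show "\<forall>X\<in>Pow \<Lambda> - {X \<in> Pow \<Lambda>. X \<inter> A \<noteq> {} \<and> X \<inter> C \<noteq> {}}. eff_defect A C X = 0"
    proof
      fix X assume "X \<in> Pow \<Lambda> - {X \<in> Pow \<Lambda>. X \<inter> A \<noteq> {} \<and> X \<inter> C \<noteq> {}}"
      then have X: "X \<subseteq> \<Lambda>" and "X \<inter> A = {} \<or> X \<inter> C = {}" by auto
      then show "eff_defect A C X = 0"
      proof (elim disjE)
        assume "X \<inter> A = {}"
        then have "eff_term (A \<union> C) X = eff_term C X" "eff_term A X = eff_term {} X"
          by (auto intro!: eff_term_cong[OF X])
        then show ?thesis by (simp add: eff_defect_def)
      next
        assume "X \<inter> C = {}"
        then have "eff_term (A \<union> C) X = eff_term A X" "eff_term C X = eff_term {} X"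
          by (auto intro!: eff_term_cong[OF X])
        then show ?thesis by (simp add: eff_defect_def)
      qed
    qed
  qed (use fin in auto)
  moreover have "(\<Sum>X\<in>Pow \<Lambda>. eff_defect A C X) = eff_ham (A \<union> C) - eff_ham A - eff_ham C + eff_ham {}"
    unfolding eff_ham_def eff_defect_def by (simp only: sum.distrib sum_subtractf)
  ultimately show ?thesis by (simp add: algebra_simps)
qed

end


text \<open>Converts the exp K - 1 of the Gronwall step into the form of the claim; it is 1 - K
  \<le> exp(-K) multiplied by exp K.\<close>

lemma mult_exp_ge_exp_minus_one: "exp K - 1 \<le> exp K * (K::real)"
proof -
  have "1 - K \<le> exp (- K)" using exp_ge_add_one_self[of "- K"] by simp
  then have "exp K * (1 - K) \<le> exp K * exp (- K)" by (intro mult_left_mono) auto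
  then show ?thesis by (simp add: algebra_simps exp_minus)
qed

text \<open>A set that contains x and meets \<open>C\<close> has diameter at least the distance from
  x to \<open>C\<close>. The diameter weight in the decay assumption therefore buys exp(- \<mu>
  dist(x, C)), while the weight in |X| is kept for the commutators.\<close>

lemma sum_weights_meeting_le:
  fixes \<Lambda> A C :: "'v::metric_space set" and f :: "'v set \<Rightarrow> real"
  assumes fin: "finite \<Lambda>" and A: "A \<subseteq> \<Lambda>" and \<mu>: "0 \<le> \<mu>" and f: "\<And>X. X \<subseteq> \<Lambda> \<Longrightarrow> 0 \<le> f X"
    and decay: "\<And>x. x \<in> A \<Longrightarrow>
      (\<Sum>X\<in>{X \<in> Pow \<Lambda>. x \<in> X}. f X * exp (lam * real (card X) + \<mu> * diameter X)) \<le> \<Delta>"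
  shows "(\<Sum>X\<in>{X \<in> Pow \<Lambda>. X \<inter> A \<noteq> {} \<and> X \<inter> C \<noteq> {}}. f X * exp (lam * real (card X)))
    \<le> \<Delta> * (\<Sum>x\<in>A. exp (- \<mu> * infdist x C))"
proof -
  let ?g = "\<lambda>X. if X \<inter> C \<noteq> {} then f X * exp (lam * real (card X)) else 0"
  have fP: "finite {X \<in> Pow \<Lambda>. X \<inter> A \<noteq> {}}" using fin by simp
  have "(\<Sum>X\<in>{X \<in> Pow \<Lambda>. X \<inter> A \<noteq> {} \<and> X \<inter> C \<noteq> {}}. f X * exp (lam * real (card X)))
      = (\<Sum>X\<in>{X \<in> {X \<in> Pow \<Lambda>. X \<inter> A \<noteq> {}}. X \<inter> C \<noteq> {}}. f X * exp (lam * real (card X)))"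
    by (rule sum.cong) auto
  also have "\<dots> = (\<Sum>X\<in>{X \<in> Pow \<Lambda>. X \<inter> A \<noteq> {}}. ?g X)" by (rule sum.inter_filter[OF fP])
  also have "\<dots> \<le> (\<Sum>x\<in>A. \<Sum>X\<in>{X \<in> Pow \<Lambda>. x \<in> X}. ?g X)"
    by (rule sum_meeting_le[OF fin A]) (simp add: f)
  also have "\<dots> \<le> (\<Sum>x\<in>A. \<Delta> * exp (- \<mu> * infdist x C))"
  proof (rule sum_mono)
    fix x assume x: "x \<in> A"
    have "(\<Sum>X\<in>{X \<in> Pow \<Lambda>. x \<in> X}. ?g X)
        \<le> (\<Sum>X\<in>{X \<in> Pow \<Lambda>. x \<in> X}. f X * exp (lam * real (card X) + \<mu> * diameter X) * exp (- \<mu> * infdist x C))"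
    proof (rule sum_mono)
      fix X assume "X \<in> {X \<in> Pow \<Lambda>. x \<in> X}"
      then have X: "X \<subseteq> \<Lambda>" "x \<in> X" by auto
      show "?g X \<le> f X * exp (lam * real (card X) + \<mu> * diameter X) * exp (- \<mu> * infdist x C)"
      proof (cases "X \<inter> C = {}")
        case True
        then show ?thesis using f[OF X(1)] by simp
      next
        case False
        then obtain y where y: "y \<in> X" "y \<in> C" by blast
        have "bounded X" using X(1) fin finite_subset finite_imp_bounded by blast
        then have "dist x y \<le> diameter X" using X(2) y(1) by (rule diameter_bounded_bound)
        then have "infdist x C \<le> diameter X" using infdist_le[OF y(2), of x] by simp
        then have "\<mu> * infdist x C \<le> \<mu> * diameter X" using \<mu> by (rule mult_left_mono)
        then have "exp (lam * real (card X)) \<le> exp (lam * real (card X) + \<mu> * diameter X) * exp (- \<mu> * infdist x C)"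
          by (simp add: exp_add[symmetric])
        then show ?thesis using False f[OF X(1)] by (simp add: mult.assoc mult_left_mono)
      qed
    qed
    also have "\<dots> = (\<Sum>X\<in>{X \<in> Pow \<Lambda>. x \<in> X}. f X * exp (lam * real (card X) + \<mu> * diameter X)) * exp (- \<mu> * infdist x C)"
      by (rule sum_distrib_right[symmetric])
    also have "\<dots> \<le> \<Delta> * exp (- \<mu> * infdist x C)" by (rule mult_right_mono[OF decay[OF x]]) simp
    finally show "(\<Sum>X\<in>{X \<in> Pow \<Lambda>. x \<in> X}. ?g X) \<le> \<Delta> * exp (- \<mu> * infdist x C)" .
  qed
  finally show ?thesis by (simp only: sum_distrib_left)
qed

theorem theorem4p1:
  fixes D :: nat and \<Phi> :: "'v::metric_space set \<Rightarrow> 'v qop"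
    and \<Psi> :: "'v set \<Rightarrow> 'v set \<Rightarrow> 'v qop"
    and \<beta> lam \<mu> \<Delta> :: real and \<Lambda> A C :: "'v set"
  assumes "D > 0"
    and "local_interaction D \<Phi>"
    and "\<beta> > 0"
    and "strong_local_eff_ham D \<Phi> \<beta> \<Psi>"
    and "lam > 0" and "\<mu> > 0" and "\<Delta> > 0"
    and decay: "\<And>L x F. finite F \<Longrightarrow> (\<forall>X\<in>F. finite X \<and> x \<in> X) \<Longrightarrow>
          (\<Sum>X\<in>F. op_norm D X (\<Psi> L X) * exp (lam * real (card X) + \<mu> * diameter X)) \<le> \<Delta>"
    and "\<beta> < lam / (2 * \<Delta>)"
    and "finite \<Lambda>" and "A \<subseteq> \<Lambda>" and "C \<subseteq> \<Lambda>" and "A \<inter> C = {}"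
    and "A \<noteq> {}" and "C \<noteq> {}"
  shows "let \<rho> = gibbs D \<Phi> \<beta> \<Lambda>;
             \<rho>AC = ptr D \<Lambda> (A \<union> C) \<rho>; \<rho>A = ptr D \<Lambda> A \<rho>; \<rho>C = ptr D \<Lambda> C \<rho>;
             K = 4 * \<Delta> * lam * \<beta> / (lam - 2 * \<Delta> * \<beta>) * (\<Sum>x\<in>A. exp (- \<mu> * infdist x C))
         in op_norm D (A \<union> C)
              (op_diff
                (op_mult D (A \<union> C) \<rho>AC
                  (op_mult D (A \<union> C) (emb D A (A \<union> C) (op_inv D A \<rho>A))
                                      (emb D C (A \<union> C) (op_inv D C \<rho>C))))
                (op_id D (A \<union> C)))
            \<le> exp K * K"
proof -
  note ctx = assms(1-4) \<open>finite \<Lambda>\<close>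
  let ?ham = "eff_ham D \<Psi> \<Lambda>" and ?term = "eff_term D \<Psi> \<Lambda>" and ?def = "eff_defect D \<Psi> \<Lambda> A C"
  define J where "J = {X \<in> Pow \<Lambda>. X \<inter> A \<noteq> {} \<and> X \<inter> C \<noteq> {}}"
  define G where "G = ?ham (A \<union> C)"
  define W where "W = (\<Sum>X\<in>J. ?def X)"
  define s where "s = (\<Sum>x\<in>A. exp (- \<mu> * infdist x C))"
  have s: "0 \<le> s" unfolding s_def by (rule sum_nonneg) simp
  have finX: "finite X" if "X \<subseteq> \<Lambda>" for X using that \<open>finite \<Lambda>\<close> by (rule finite_subset)
  have dec: "(\<Sum>X\<in>{X \<in> Pow \<Lambda>. x \<in> X}. norm (?term L X) * exp (lam * real (card X) + \<mu> * diameter X)) \<le> \<Delta>" for L x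
  proof -
    have "(\<Sum>X\<in>{X \<in> Pow \<Lambda>. x \<in> X}. norm (?term L X) * exp (lam * real (card X) + \<mu> * diameter X))
        = (\<Sum>X\<in>{X \<in> Pow \<Lambda>. x \<in> X}. op_norm D X (\<Psi> L X) * exp (lam * real (card X) + \<mu> * diameter X))"
      by (rule sum.cong[OF refl]) (simp add: norm_eff_term[OF ctx])
    also have "\<dots> \<le> \<Delta>" by (rule decay) (use \<open>finite \<Lambda>\<close> finX in auto)
    finally show ?thesis .
  qed
  have dec0: "(\<Sum>X\<in>{X \<in> Pow \<Lambda>. x \<in> X}. norm (?term L X) * exp (lam * real (card X))) \<le> \<Delta>" for L x
  proof (rule order_trans[OF _ dec])
    show "(\<Sum>X\<in>{X \<in> Pow \<Lambda>. x \<in> X}. norm (?term L X) * exp (lam * real (card X)))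
        \<le> (\<Sum>X\<in>{X \<in> Pow \<Lambda>. x \<in> X}. norm (?term L X) * exp (lam * real (card X) + \<mu> * diameter X))"
    proof (intro sum_mono mult_left_mono)
      fix X assume "X \<in> {X \<in> Pow \<Lambda>. x \<in> X}"
      then have "0 \<le> diameter X" using finX finite_imp_bounded by (intro diameter_ge_0) auto
      then show "exp (lam * real (card X)) \<le> exp (lam * real (card X) + \<mu> * diameter X)"
        using \<open>\<mu> > 0\<close> by simp
    qed simp
  qed
  have ad_term: "norm ((commutator G ^^ n) (?term L X))
      \<le> (2 * \<Delta>) ^ n * norm (?term L X) * (fact n / lam ^ n * exp (lam * real (card X)))"
    if X: "X \<subseteq> \<Lambda>" for n L X
    unfolding G_def eff_ham_def[OF ctx]
  proof (rule norm_iterated_commutator_le[where loc = "local_ops D \<Lambda>" and lam = lam and S = X])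
    show "commutator b a = 0"
      if "Y \<subseteq> \<Lambda>" "Z \<subseteq> \<Lambda>" "a \<in> local_ops D \<Lambda> Y" "b \<in> local_ops D \<Lambda> Z" "Y \<inter> Z = {}" for Y Z a b
      using local_ops_disjoint_commute[OF \<open>finite \<Lambda>\<close> that] by (simp add: commutator_def)
    show "real (card X + t) ^ n * exp (- lam * real t) \<le> fact n / lam ^ n * exp (lam * real (card X))" for t
      by (rule power_mult_exp_le[OF \<open>lam > 0\<close>])
  qed (use \<open>finite \<Lambda>\<close> X \<open>\<Delta> > 0\<close> eff_term_local[OF ctx] commutator_local_ops dec0 in auto)
  \<comment> \<open>Four sums of effective terms, each of weight at most
    \<open>\<Delta> * s\<close>. The \<open>a\<close> below is the growth rate per commutator: 2
    \<Delta> from the bound and 1 / lam from \<open>power_mult_exp_le\<close>.\<close>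
  define w where "w = 4 * \<Delta> * s"
  define a where "a = 2 * \<Delta> / lam"
  have ad: "norm ((commutator G ^^ n) W) \<le> w * fact n * a ^ n" for n
  proof -
    let ?N = "\<lambda>L X. norm (?term L X) * exp (lam * real (card X))"
    let ?c = "(2 * \<Delta>) ^ n * (fact n / lam ^ n)"
    \<comment> \<open>The defects are split again because the decay assumption speaks of one
      effective interaction at a time; the cancellation has already served to restrict the sum to
      \<open>J\<close>.\<close>
    have W_eq: "W = (\<Sum>X\<in>J. ?term (A \<union> C) X) - (\<Sum>X\<in>J. ?term A X) - (\<Sum>X\<in>J. ?term C X) + (\<Sum>X\<in>J. ?term {} X)"
      unfolding W_def eff_defect_def[OF ctx] by (simp only: sum.distrib sum_subtractf)
    have part: "norm ((commutator G ^^ n) (\<Sum>X\<in>J. ?term L X)) \<le> ?c * (\<Delta> * s)" for L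
    proof -
      have "norm ((commutator G ^^ n) (\<Sum>X\<in>J. ?term L X)) \<le> (\<Sum>X\<in>J. norm ((commutator G ^^ n) (?term L X)))"
        unfolding funpow_commutator_sum by (rule norm_sum)
      also have "\<dots> \<le> (\<Sum>X\<in>J. ?c * ?N L X)"
      proof (rule sum_mono)
        fix X assume "X \<in> J"
        then have "X \<subseteq> \<Lambda>" by (simp add: J_def)
        from ad_term[OF this, of n L] show "norm ((commutator G ^^ n) (?term L X)) \<le> ?c * ?N L X"
          by (simp only: mult_ac)
      qed
      also have "\<dots> = ?c * (\<Sum>X\<in>J. ?N L X)" by (rule sum_distrib_left[symmetric])
      also have "\<dots> \<le> ?c * (\<Delta> * s)"
        unfolding J_def s_def using \<open>\<Delta> > 0\<close> \<open>lam > 0\<close> \<open>\<mu> > 0\<close> dec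
        by (intro mult_left_mono sum_weights_meeting_le \<open>finite \<Lambda>\<close> \<open>A \<subseteq> \<Lambda>\<close>) auto
      finally show ?thesis .
    qed
    have "commutator G (x - y) = commutator G x - commutator G y"
      "commutator G (x + y) = commutator G x + commutator G y" for x y
      by (simp_all add: commutator_def algebra_simps)
    then have lin: "(commutator G ^^ n) (x - y) = (commutator G ^^ n) x - (commutator G ^^ n) y"
      "(commutator G ^^ n) (x + y) = (commutator G ^^ n) x + (commutator G ^^ n) y" for x y
      by (induction n) simp_all
    have "norm ((commutator G ^^ n) W) \<le> norm ((commutator G ^^ n) (\<Sum>X\<in>J. ?term (A \<union> C) X))
        + norm ((commutator G ^^ n) (\<Sum>X\<in>J. ?term A X)) + norm ((commutator G ^^ n) (\<Sum>X\<in>J. ?term C X))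
        + norm ((commutator G ^^ n) (\<Sum>X\<in>J. ?term {} X))"
      unfolding W_eq lin by (intro norm_triangle_le norm_triangle_le_diff add_mono order_refl)
    also have "\<dots> \<le> ?c * (\<Delta> * s) + ?c * (\<Delta> * s) + ?c * (\<Delta> * s) + ?c * (\<Delta> * s)"
      by (intro add_mono part)
    also have "\<dots> = w * fact n * a ^ n"
      by (simp add: w_def a_def power_divide power_mult_distrib)
    finally show ?thesis .
  qed
  \<comment> \<open>The smallness of \<beta> in the form that makes the geometric series converge,
    since it says that \<open>a * \<beta>\<close> is less than 1.\<close>
  have pos: "0 < lam - 2 * \<Delta> * \<beta>"
    using \<open>\<beta> < lam / (2 * \<Delta>)\<close> \<open>\<Delta> > 0\<close> by (simp add: pos_less_divide_eq mult.commute mult.left_commute)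
  have ab: "1 - a * \<beta> = (lam - 2 * \<Delta> * \<beta>) / lam"
    using \<open>lam > 0\<close> by (simp add: a_def diff_divide_distrib)
  define K where "K = 4 * \<Delta> * lam * \<beta> / (lam - 2 * \<Delta> * \<beta>) * s"
  have K: "w / (1 - a * \<beta>) * \<beta> = K"
    unfolding ab K_def w_def by simp
  have "norm (exp (\<beta> *\<^sub>R - G) * exp (\<beta> *\<^sub>R (G - W)) - 1) \<le> exp K - 1"
    unfolding K[symmetric]
  proof (rule norm_exp_mult_exp_minus_one_le[OF ad])
    have "0 < 1 - a * \<beta>" unfolding ab using pos \<open>lam > 0\<close> by simp
    then show "a * \<beta> < 1" by simp
  qed (use s \<open>\<Delta> > 0\<close> \<open>lam > 0\<close> \<open>\<beta> > 0\<close> in \<open>auto simp: w_def a_def\<close>)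
  also have "\<dots> \<le> exp K * K" by (rule mult_exp_ge_exp_minus_one)
  also have "G - W = ?ham A + ?ham C - ?ham {}"
    unfolding G_def W_def J_def by (rule eff_ham_defect[OF ctx])
  finally have "norm (exp (\<beta> *\<^sub>R - ?ham (A \<union> C)) * exp (\<beta> *\<^sub>R (?ham A + ?ham C - ?ham {})) - 1) \<le> exp K * K"
    unfolding G_def .
  from order_trans[OF op_norm_correlation[OF ctx \<open>A \<subseteq> \<Lambda>\<close> \<open>C \<subseteq> \<Lambda>\<close> \<open>A \<inter> C = {}\<close>] this]
  show ?thesis unfolding Let_def K_def s_def .
qed

end
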